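(* Let $n\geq 1$ be an integer. Then $$\int_{\mathbb{R}^n}|\Delta u|^2\,dx\int_{\mathbb{R}^n}|\nabla u\cdot x|^2\,dx\;\geq\;\Big(\frac{n+2}{2}\Big)^2\Big(\int_{\mathbb{R}^n}|\nabla u|^2\,dx\Big)^2$$ for every $u\in H^2_{0,-2}(\mathbb{R}^n)$. This inequality is sharp (the constant $\big(\frac{n+2}{2}\big)^2$ cannot be replaced by a larger one), and equality is attained by the Gaussian function $\exp(-|x|^2/2)$.
   Context: Functions are real-valued. $H^2_{0,-2}(\mathbb{R}^n)$ denotes the completion of $C_0^\infty(\mathbb{R}^n)$ under the norm $$\|u\|=\Big(\int_{\mathbb{R}^n}|\Delta u|^2\,dx+\int_{\mathbb{R}^n}|\nabla u|^2|x|^{2}\,dx\Big)^{1/2},\qquad u\in C_0^\infty(\mathbb{R}^n).$$ *)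

theory Defs
  imports "HOL-Analysis.Analysis"
begin

section \<open>Test functions and classical derivatives\<close>

definition partial :: "'a::euclidean_space \<Rightarrow> ('a \<Rightarrow> real) \<Rightarrow> 'a \<Rightarrow> real" where
  "partial b f = (\<lambda>x. frechet_derivative f (at x) b)"

primrec C_k :: "nat \<Rightarrow> ('a::euclidean_space \<Rightarrow> real) \<Rightarrow> bool" where
  "C_k 0 f \<longleftrightarrow> continuous_on UNIV f"
| "C_k (Suc k) f \<longleftrightarrow> (\<forall>x. f differentiable (at x)) \<and> (\<forall>b\<in>Basis. C_k k (partial b f))"

definition test_function :: "('a::euclidean_space \<Rightarrow> real) \<Rightarrow> bool" where
  "test_function f \<longleftrightarrow> (\<forall>k. C_k k f) \<and> compact (closure {x. f x \<noteq> 0})"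

definition grad :: "('a::euclidean_space \<Rightarrow> real) \<Rightarrow> 'a \<Rightarrow> 'a" where
  "grad f x = (\<Sum>b\<in>Basis. partial b f x *\<^sub>R b)"

definition laplacian :: "('a::euclidean_space \<Rightarrow> real) \<Rightarrow> 'a \<Rightarrow> real" where
  "laplacian f x = (\<Sum>b\<in>Basis. partial b (partial b f) x)"

section \<open>Weak derivatives\<close>

definition locally_integrable ::
    "('a::euclidean_space \<Rightarrow> 'b::{banach,second_countable_topology}) \<Rightarrow> bool" where
  "locally_integrable f \<longleftrightarrow> (\<forall>K. compact K \<longrightarrow> set_integrable lebesgue K f)"

definition is_weak_grad :: "('a::euclidean_space \<Rightarrow> real) \<Rightarrow> ('a \<Rightarrow> 'a) \<Rightarrow> bool" where
  "is_weak_grad u G \<longleftrightarrow> locally_integrable G \<and>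
    (\<forall>\<psi>. test_function \<psi> \<longrightarrow>
      (LINT x|lebesgue. u x *\<^sub>R grad \<psi> x) = - (LINT x|lebesgue. \<psi> x *\<^sub>R G x))"

definition is_weak_laplacian :: "('a::euclidean_space \<Rightarrow> real) \<Rightarrow> ('a \<Rightarrow> real) \<Rightarrow> bool" where
  "is_weak_laplacian u L \<longleftrightarrow> locally_integrable L \<and>
    (\<forall>\<psi>. test_function \<psi> \<longrightarrow>
      (LINT x|lebesgue. u x * laplacian \<psi> x) = (LINT x|lebesgue. \<psi> x * L x))"

text \<open>Weak derivatives are unique up to null sets, so integrals of the following
  representatives do not depend on the choice. They are meaningful only if a weak
  derivative exists.\<close>

definition weak_grad :: "('a::euclidean_space \<Rightarrow> real) \<Rightarrow> 'a \<Rightarrow> 'a" where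
  "weak_grad u = (SOME G. is_weak_grad u G)"

definition weak_laplacian :: "('a::euclidean_space \<Rightarrow> real) \<Rightarrow> 'a \<Rightarrow> real" where
  "weak_laplacian u = (SOME L. is_weak_laplacian u L)"

section \<open>The completion of the test functions\<close>

definition H2_norm :: "('a::euclidean_space \<Rightarrow> real) \<Rightarrow> real" where
  "H2_norm \<phi> = sqrt ((LINT x|lebesgue. (laplacian \<phi> x)\<^sup>2) +
                     (LINT x|lebesgue. (norm (grad \<phi> x))\<^sup>2 * (norm x)\<^sup>2))"

definition H2_Cauchy :: "(nat \<Rightarrow> 'a::euclidean_space \<Rightarrow> real) \<Rightarrow> bool" where
  "H2_Cauchy \<phi> \<longleftrightarrow> (\<forall>k. test_function (\<phi> k)) \<and>
    (\<forall>e>0. \<exists>N. \<forall>j\<ge>N. \<forall>k\<ge>N. H2_norm (\<lambda>x. \<phi> j x - \<phi> k x) < e)"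

text \<open>The completion is realised as a space of functions: an abstract element, given by a
  norm-Cauchy sequence of test functions, is identified with the local \<open>L\<^sup>1\<close> limit of that
  sequence. The limit exists because, in dimension \<open>n\<close>, Hardy's inequality bounds
  \<open>(n/2)\<^sup>2 \<integral> \<phi>\<^sup>2\<close> by \<open>\<integral> |\<nabla>\<phi>|\<^sup>2 |x|\<^sup>2\<close>, so that norm-Cauchy sequences even converge in \<open>L\<^sup>2\<close>.
  The identification is injective up to null sets: a norm-Cauchy sequence with limit \<open>0\<close> tends
  to \<open>0\<close> in norm, since its derivatives converge to the weak derivatives of the limit.\<close>

definition H2_space :: "('a::euclidean_space \<Rightarrow> real) set" where
  "H2_space = {u. locally_integrable u \<and>
    (\<exists>\<phi>. H2_Cauchy \<phi> \<and>
      (\<forall>K. compact K \<longrightarrow> (\<lambda>k. LINT x:K|lebesgue. \<bar>\<phi> k x - u x\<bar>) \<longlonglongrightarrow> 0))}"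

definition gaussian :: "'a::euclidean_space \<Rightarrow> real" where
  "gaussian x = exp (- (norm x)\<^sup>2 / 2)"

end

theory Submission
  imports Defs "HOL-Probability.Distributions"
begin

text \<open>
  For a test function \<open>u\<close> on an \<open>n\<close>-dimensional space, integration by parts gives
  \<open>\<integral> \<Delta>u (x \<cdot> \<nabla>u) = (n-2)/2 \<integral> |\<nabla>u|\<^sup>2\<close>, \<open>\<integral> u \<Delta>u = - \<integral> |\<nabla>u|\<^sup>2\<close> and \<open>\<integral> u (x \<cdot> \<nabla>u) = - n/2 \<integral> u\<^sup>2\<close>.
  Hence \<open>\<integral> \<Delta>u (x \<cdot> \<nabla>u + n u) = - (n+2)/2 \<integral> |\<nabla>u|\<^sup>2\<close>, whereas \<open>x \<cdot> \<nabla>u + n u\<close> and \<open>x \<cdot> \<nabla>u\<close> have the same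
  \<open>L\<^sup>2\<close> norm; the inequality is the Cauchy--Schwarz inequality for \<open>\<Delta>u\<close> and \<open>x \<cdot> \<nabla>u + n u\<close>.
  The third identity contains a Hardy inequality, by which the functions and all derivatives involved
  converge in \<open>L\<^sup>2\<close> along a norm-Cauchy sequence, so the identities hold on the completion, where the
  limits are the weak derivatives. The Gaussian satisfies \<open>\<Delta>u = - (x \<cdot> \<nabla>u + n u)\<close>, which is the
  equality case of Cauchy--Schwarz; it lies in the space because it is the limit of its smooth cutoffs.
\<close>

section \<open>Square integrable functions\<close>

text \<open>Cauchy-Schwarz for \<Delta>u and x \<cdot> \<nabla>u alone yields only the factor
  |n-2|/2. The gain comes from the freedom to add c u: by the third identity, ||x \<cdot> \<nabla>u
  + c u||^2 = ||x \<cdot> \<nabla>u||^2 + (c^2 - n c) ||u||^2, so c = n is the only nonzero shift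
  that preserves the norm when u is not zero. Structurally, x \<cdot> \<nabla> + n/2 is
  skew-symmetric, so adding and subtracting n/2 produce the same norm. The weight |x|^2 vanishes at
  the origin, so the norm does not control \<nabla>u directly; once Hardy has bounded u, the second
  identity bounds \<nabla>u by u and \<Delta>u. The weak derivatives in the statement are chosen by
  \<open>SOME\<close>, hence uniqueness up to null sets is required; this is why bump functions and
  the fundamental lemma of the calculus of variations appear. Sharpness further requires that the
  Gaussian have a nonzero gradient integral.\<close>

lemma tendsto_zero_bound:
  fixes a b :: "nat \<Rightarrow> real"
  assumes "b \<longlonglongrightarrow> 0" "\<And>k. \<bar>a k\<bar> \<le> b k"
  shows "a \<longlonglongrightarrow> 0"
  by (rule Lim_null_comparison[OF always_eventually assms(1)]) (simp add: assms(2))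

text \<open>Square integrability of functions rather than of classes. Measurability is listed
  separately because it does not follow from that of the square.\<close>

definition L2 :: "'a measure \<Rightarrow> ('a \<Rightarrow> real) \<Rightarrow> bool" where
  "L2 M f \<longleftrightarrow> f \<in> borel_measurable M \<and> integrable M (\<lambda>x. (f x)\<^sup>2)"

definition L2_tendsto :: "'a measure \<Rightarrow> (nat \<Rightarrow> 'a \<Rightarrow> real) \<Rightarrow> ('a \<Rightarrow> real) \<Rightarrow> bool" where
  "L2_tendsto M f g \<longleftrightarrow> (\<forall>k. L2 M (f k)) \<and> L2 M g \<and>
    (\<lambda>k. LINT x|M. (f k x - g x)\<^sup>2) \<longlonglongrightarrow> 0"

lemma L2_measurable: "L2 M f \<Longrightarrow> f \<in> borel_measurable M"
  and L2_integrable: "L2 M f \<Longrightarrow> integrable M (\<lambda>x. (f x)\<^sup>2)"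
  by (auto simp: L2_def)

lemma L2_dominated:
  assumes "L2 M f" "g \<in> borel_measurable M" "\<And>x. \<bar>g x\<bar> \<le> C * \<bar>f x\<bar>"
  shows "L2 M g"
proof -
  have "(g x)\<^sup>2 \<le> C\<^sup>2 * (f x)\<^sup>2" for x
    using power_mono[OF assms(3)[of x], of 2] by (simp add: power_mult_distrib)
  then have le: "AE x in M. norm ((g x)\<^sup>2) \<le> norm (C\<^sup>2 * (f x)\<^sup>2)" by simp
  have i: "integrable M (\<lambda>x. C\<^sup>2 * (f x)\<^sup>2)" using assms(1) by (simp add: L2_def)
  have m: "(\<lambda>x. (g x)\<^sup>2) \<in> borel_measurable M" using assms(2) by measurable
  have "integrable M (\<lambda>x. (g x)\<^sup>2)"
    by (rule Bochner_Integration.integrable_bound[OF i m le])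
  with assms(2) show ?thesis by (auto simp: L2_def)
qed

lemma L2_mult_integrable:
  assumes "L2 M f" "L2 M g" shows "integrable M (\<lambda>x. f x * g x)"
proof (rule Bochner_Integration.integrable_bound)
  show "integrable M (\<lambda>x. (f x)\<^sup>2 + (g x)\<^sup>2)"
    using assms by (auto simp: L2_def)
  show "(\<lambda>x. f x * g x) \<in> borel_measurable M"
    using assms by (auto simp: L2_def)
  have "\<bar>f x * g x\<bar> \<le> (f x)\<^sup>2 + (g x)\<^sup>2" for x
  proof -
    have "0 \<le> \<bar>f x\<bar> * \<bar>g x\<bar>" by simp
    moreover have "2 * (\<bar>f x\<bar> * \<bar>g x\<bar>) \<le> (f x)\<^sup>2 + (g x)\<^sup>2"
      using sum_squares_bound[of "\<bar>f x\<bar>" "\<bar>g x\<bar>"] by simp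
    ultimately show ?thesis unfolding abs_mult by linarith
  qed
  then show "AE x in M. norm (f x * g x) \<le> norm ((f x)\<^sup>2 + (g x)\<^sup>2)"
    by auto
qed

lemma L2_add: assumes "L2 M f" "L2 M g" shows "L2 M (\<lambda>x. f x + g x)"
proof -
  have "integrable M (\<lambda>x. (f x)\<^sup>2 + (g x)\<^sup>2 + 2 * (f x * g x))"
    using assms L2_mult_integrable[OF assms] by (auto simp: L2_def)
  moreover have "(\<lambda>x. (f x + g x)\<^sup>2) = (\<lambda>x. (f x)\<^sup>2 + (g x)\<^sup>2 + 2 * (f x * g x))"
    by (auto simp: power2_eq_square algebra_simps)
  ultimately show ?thesis
    using assms by (auto simp: L2_def)
qed

lemma L2_cmult: "L2 M f \<Longrightarrow> L2 M (\<lambda>x. c * f x)"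
  by (auto simp: L2_def power_mult_distrib)

lemma L2_diff: assumes "L2 M f" "L2 M g" shows "L2 M (\<lambda>x. f x - g x)"
  using L2_add[OF assms(1) L2_cmult[OF assms(2), of "-1"]] by simp

lemma L2_zero: "L2 M (\<lambda>x. 0)"
  by (auto simp: L2_def)

lemma L2_sum: "(\<And>i. i \<in> I \<Longrightarrow> L2 M (f i)) \<Longrightarrow> L2 M (\<lambda>x. \<Sum>i\<in>I. f i x)"
  by (induction I rule: infinite_finite_induct) (auto intro: L2_add L2_zero)

text \<open>The quadratic polynomial t \<mapsto> \<integral> (f + t g)^2 is nonnegative, which
  bounds its discriminant.\<close>

lemma L2_Cauchy_Schwarz:
  assumes "L2 M f" "L2 M g"
  shows "(LINT x|M. f x * g x)\<^sup>2 \<le> (LINT x|M. (f x)\<^sup>2) * (LINT x|M. (g x)\<^sup>2)"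
proof -
  let ?A = "LINT x|M. (f x)\<^sup>2" and ?B = "LINT x|M. f x * g x" and ?C = "LINT x|M. (g x)\<^sup>2"
  have q: "0 \<le> ?A + 2 * t * ?B + t\<^sup>2 * ?C" for t
  proof -
    have "0 \<le> (LINT x|M. (f x + t * g x)\<^sup>2)"
      by simp
    also have "\<dots> = (LINT x|M. (f x)\<^sup>2 + 2 * t * (f x * g x) + t\<^sup>2 * (g x)\<^sup>2)"
      by (auto simp: power2_eq_square algebra_simps intro!: Bochner_Integration.integral_cong)
    also have "\<dots> = ?A + 2 * t * ?B + t\<^sup>2 * ?C"
      using assms L2_mult_integrable[OF assms] by (simp add: L2_def)
    finally show ?thesis .
  qed
  have C: "0 \<le> ?C" by simp
  show ?thesis
  proof (cases "?C = 0")
    case False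
    with C have "0 < ?C" by linarith
    \<comment> \<open>The quadratic attains its minimum at t = -B/C.\<close>
    have "0 \<le> (?A + 2 * (- ?B / ?C) * ?B + (- ?B / ?C)\<^sup>2 * ?C) * ?C"
      using q[of "- ?B / ?C"] C by (rule mult_nonneg_nonneg)
    also have "\<dots> = ?A * ?C - ?B\<^sup>2"
      using \<open>0 < ?C\<close> by (simp add: field_simps power2_eq_square)
    finally show ?thesis by simp
  next
    case True
    \<comment> \<open>For C = 0 the polynomial is affine in t, and at t = -(A+1)/(2B) it would take
      the value -1.\<close>
    have "?B = 0"
    proof (rule ccontr)
      assume "?B \<noteq> 0"
      then show False
        using q[of "- (?A + 1) / (2 * ?B)"] True by (simp add: field_simps)
    qed
    with True show ?thesis by simp
  qed
qed

lemma L2_abs_inner: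
  assumes "L2 M f" "L2 M g"
  shows "\<bar>LINT x|M. f x * g x\<bar> \<le> sqrt (LINT x|M. (f x)\<^sup>2) * sqrt (LINT x|M. (g x)\<^sup>2)"
  using L2_Cauchy_Schwarz[OF assms]
  by (auto simp: real_sqrt_mult[symmetric] intro!: real_le_rsqrt)

text \<open>Expanding the product around F G leaves only differences and the fixed norms of F and G
  as factors, so the norms of the approximating functions need no uniform bound.\<close>

lemma L2_tendsto_inner:
  assumes f: "L2_tendsto M f F" and g: "L2_tendsto M g G"
  shows "(\<lambda>k. LINT x|M. f k x * g k x) \<longlonglongrightarrow> (LINT x|M. F x * G x)"
proof -
  have L: "L2 M (f k)" "L2 M (g k)" "L2 M F" "L2 M G" for k
    using f g by (auto simp: L2_tendsto_def)
  let ?d = "\<lambda>k. LINT x|M. (f k x - F x)\<^sup>2" and ?e = "\<lambda>k. LINT x|M. (g k x - G x)\<^sup>2"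
  have lim: "?d \<longlonglongrightarrow> 0" "?e \<longlonglongrightarrow> 0"
    using f g by (auto simp: L2_tendsto_def)
  have "\<bar>(LINT x|M. f k x * g k x) - (LINT x|M. F x * G x)\<bar>
    \<le> sqrt (?d k) * sqrt (?e k) + sqrt (?d k) * sqrt (LINT x|M. (G x)\<^sup>2)
      + sqrt (LINT x|M. (F x)\<^sup>2) * sqrt (?e k)" for k
  proof -
    note D = L2_diff[OF L(1)[of k] L(3)] L2_diff[OF L(2)[of k] L(4)]
    have "(LINT x|M. f k x * g k x) = (LINT x|M. (f k x - F x) * (g k x - G x) + (f k x - F x) * G x
        + F x * (g k x - G x) + F x * G x)"
      by (rule Bochner_Integration.integral_cong) (auto simp: algebra_simps)
    also have "\<dots> = (LINT x|M. (f k x - F x) * (g k x - G x)) + (LINT x|M. (f k x - F x) * G x)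
        + (LINT x|M. F x * (g k x - G x)) + (LINT x|M. F x * G x)"
      using L D by (simp add: L2_mult_integrable)
    finally show ?thesis
      using L2_abs_inner[OF D] L2_abs_inner[OF D(1) L(4)] L2_abs_inner[OF L(3) D(2)] by linarith
  qed
  note bound = this
  have "(\<lambda>k. sqrt (?d k) * sqrt (?e k) + sqrt (?d k) * sqrt (LINT x|M. (G x)\<^sup>2)
      + sqrt (LINT x|M. (F x)\<^sup>2) * sqrt (?e k)) \<longlonglongrightarrow> sqrt 0 * sqrt 0 + sqrt 0 * sqrt (LINT x|M. (G x)\<^sup>2)
      + sqrt (LINT x|M. (F x)\<^sup>2) * sqrt 0"
    by (intro tendsto_intros lim)
  then have "(\<lambda>k. sqrt (?d k) * sqrt (?e k) + sqrt (?d k) * sqrt (LINT x|M. (G x)\<^sup>2)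
      + sqrt (LINT x|M. (F x)\<^sup>2) * sqrt (?e k)) \<longlonglongrightarrow> 0"
    by (simp only: real_sqrt_zero mult_zero_left mult_zero_right add_0)
  from tendsto_zero_bound[OF this bound]
  have "(\<lambda>k. (LINT x|M. f k x * g k x) - (LINT x|M. F x * G x)) \<longlonglongrightarrow> 0" .
  then show ?thesis
    using LIM_zero_iff by blast
qed

lemma L2_tendsto_const: "L2 M f \<Longrightarrow> L2_tendsto M (\<lambda>_. f) f"
  by (auto simp: L2_tendsto_def)

lemma L2_tendsto_dominated:
  assumes f: "L2_tendsto M f F" and m: "\<And>k. L2 M (g k)" "L2 M G"
    and le: "\<And>k x. \<bar>g k x - G x\<bar> \<le> C * \<bar>f k x - F x\<bar>"
  shows "L2_tendsto M g G"
proof -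
  have le2: "(g k x - G x)\<^sup>2 \<le> C\<^sup>2 * (f k x - F x)\<^sup>2" for k x
    using power_mono[OF le[of k x], of 2] by (simp add: power_mult_distrib)
  have L: "L2 M (\<lambda>x. f k x - F x)" for k
    using f by (auto simp: L2_tendsto_def intro: L2_diff)
  have "(\<lambda>k. C\<^sup>2 * (LINT x|M. (f k x - F x)\<^sup>2)) \<longlonglongrightarrow> C\<^sup>2 * 0"
    using f by (intro tendsto_intros) (auto simp: L2_tendsto_def)
  then have lim: "(\<lambda>k. C\<^sup>2 * (LINT x|M. (f k x - F x)\<^sup>2)) \<longlonglongrightarrow> 0"
    by (simp only: mult_zero_right)
  have "\<bar>LINT x|M. (g k x - G x)\<^sup>2\<bar> \<le> C\<^sup>2 * (LINT x|M. (f k x - F x)\<^sup>2)" for k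
  proof -
    have "(LINT x|M. (g k x - G x)\<^sup>2) \<le> (LINT x|M. C\<^sup>2 * (f k x - F x)\<^sup>2)"
      using L2_integrable[OF L2_diff[OF m(1)[of k] m(2)]] L2_integrable[OF L[of k]]
      by (intro integral_mono le2) simp_all
    then show ?thesis by simp
  qed
  from tendsto_zero_bound[OF lim this] have "(\<lambda>k. LINT x|M. (g k x - G x)\<^sup>2) \<longlonglongrightarrow> 0" .
  with m show ?thesis by (auto simp: L2_tendsto_def)
qed

lemma L2_tendsto_add:
  assumes f: "L2_tendsto M f F" and g: "L2_tendsto M g G"
  shows "L2_tendsto M (\<lambda>k x. f k x + g k x) (\<lambda>x. F x + G x)"
proof -
  have L: "L2 M (f k)" "L2 M (g k)" "L2 M F" "L2 M G" for k
    using f g by (auto simp: L2_tendsto_def)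
  have "(\<lambda>k. 2 * (LINT x|M. (f k x - F x)\<^sup>2) + 2 * (LINT x|M. (g k x - G x)\<^sup>2)) \<longlonglongrightarrow> 2 * 0 + 2 * 0"
    using f g by (intro tendsto_intros) (auto simp: L2_tendsto_def)
  then have lim: "(\<lambda>k. 2 * (LINT x|M. (f k x - F x)\<^sup>2) + 2 * (LINT x|M. (g k x - G x)\<^sup>2)) \<longlonglongrightarrow> 0"
    by (simp only: mult_zero_right add_0)
  have "\<bar>LINT x|M. (f k x + g k x - (F x + G x))\<^sup>2\<bar>
      \<le> 2 * (LINT x|M. (f k x - F x)\<^sup>2) + 2 * (LINT x|M. (g k x - G x)\<^sup>2)" for k
  proof -
    have "(LINT x|M. (f k x + g k x - (F x + G x))\<^sup>2)
        \<le> (LINT x|M. 2 * (f k x - F x)\<^sup>2 + 2 * (g k x - G x)\<^sup>2)"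
    proof (rule integral_mono)
      show "(f k x + g k x - (F x + G x))\<^sup>2 \<le> 2 * (f k x - F x)\<^sup>2 + 2 * (g k x - G x)\<^sup>2" for x
        using sum_squares_bound[of "f k x - F x" "g k x - G x"]
        by (simp add: power2_eq_square algebra_simps)
    qed (use L2_diff[OF L(1)[of k] L(3)] L2_diff[OF L(2)[of k] L(4)]
           L2_diff[OF L2_add[OF L(1,2)] L2_add[OF L(3,4)]] in \<open>auto simp: L2_def\<close>)
    also have "\<dots> = 2 * (LINT x|M. (f k x - F x)\<^sup>2) + 2 * (LINT x|M. (g k x - G x)\<^sup>2)"
      using L2_diff[OF L(1)[of k] L(3)] L2_diff[OF L(2)[of k] L(4)] by (simp add: L2_def)
    finally show ?thesis by simp
  qed
  from tendsto_zero_bound[OF lim this] have "(\<lambda>k. LINT x|M. (f k x + g k x - (F x + G x))\<^sup>2) \<longlonglongrightarrow> 0" .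
  with L show ?thesis by (auto simp: L2_tendsto_def intro: L2_add)
qed

lemma L2_tendsto_sum:
  "(\<And>i. i \<in> I \<Longrightarrow> L2_tendsto M (f i) (F i)) \<Longrightarrow> L2_tendsto M (\<lambda>k x. \<Sum>i\<in>I. f i k x) (\<lambda>x. \<Sum>i\<in>I. F i x)"
  by (induction I rule: infinite_finite_induct)
    (auto intro: L2_tendsto_add L2_tendsto_const L2_zero)

text \<open>Along a subsequence with squared increments at most \<open>4\<^sup>-\<^sup>k\<close>, the sum of \<open>2\<^sup>k\<close> times
  these increments is integrable, so the subsequence converges geometrically almost everywhere.\<close>

lemma L2_complete:
  assumes L: "\<And>k. L2 M (f k)"
    and C: "\<And>e. e > 0 \<Longrightarrow> \<exists>N. \<forall>j\<ge>N. \<forall>k\<ge>N. (LINT x|M. (f j x - f k x)\<^sup>2) < e"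
  shows "\<exists>g. L2_tendsto M f g"
proof -
  have [measurable]: "f k \<in> borel_measurable M" for k
    using L by (auto simp: L2_def)
  have D: "integrable M (\<lambda>x. (f j x - f k x)\<^sup>2)" for j k
    using L2_diff[OF L[of j] L[of k]] by (simp add: L2_def)
  have "\<exists>N. \<forall>j\<ge>N. \<forall>k\<ge>N. (LINT x|M. (f j x - f k x)\<^sup>2) < (1/4) ^ i" for i
    using C[of "(1/4)^i"] by simp
  then obtain N where N: "\<And>i j k. j \<ge> N i \<Longrightarrow> k \<ge> N i \<Longrightarrow> (LINT x|M. (f j x - f k x)\<^sup>2) < (1/4) ^ i"
    by metis
  \<comment> \<open>Adding i and all earlier thresholds makes \<open>r\<close> nondecreasing and at
    least as large as both \<open>N i\<close> and \<open>i\<close>; the latter lets the subsequence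
    run past any given index.\<close>
  define r where "r i = i + (\<Sum>l\<le>i. N l)" for i
  have rN: "r i \<ge> N i" "r i \<ge> i" for i
    using member_le_sum[of i "{..i}" N] by (auto simp: r_def)
  have rS: "r (Suc i) \<ge> r i" for i by (simp add: r_def)
  define d where "d i x = (f (r (Suc i)) x - f (r i) x)\<^sup>2" for i x
  have d_int: "(LINT x|M. d i x) < (1/4) ^ i" for i
    unfolding d_def using N[of i "r (Suc i)" "r i"] rN(1)[of i] rS[of i] by simp
  have [measurable]: "d i \<in> borel_measurable M" for i
    by (simp add: d_def[abs_def])
  have d0: "0 \<le> d i x" for i x by (simp add: d_def)
  have "(\<integral>\<^sup>+x. (\<Sum>i. ennreal (2^i * d i x)) \<partial>M) = (\<Sum>i. \<integral>\<^sup>+x. ennreal (2^i * d i x) \<partial>M)"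
    by (rule nn_integral_suminf) auto
  also have "\<dots> \<le> (\<Sum>i. ennreal ((1/2)^i))"
  proof (rule suminf_le)
    fix i
    have "(\<integral>\<^sup>+x. ennreal (2^i * d i x) \<partial>M) = ennreal (LINT x|M. 2^i * d i x)"
      using D d0 by (intro nn_integral_eq_integral) (auto simp: d_def)
    also have "\<dots> \<le> ennreal (2^i * (1/4)^i)"
      using d_int[of i] by (intro ennreal_leI) simp
    also have "2^i * (1/4)^i = (1/2::real)^i"
      by (simp flip: power_mult_distrib)
    finally show "(\<integral>\<^sup>+x. ennreal (2^i * d i x) \<partial>M) \<le> ennreal ((1/2)^i)" .
  qed auto
  also have "\<dots> = ennreal (\<Sum>i. (1/2)^i)"
    by (rule suminf_ennreal2) (auto intro: summable_geometric)
  finally have "(\<integral>\<^sup>+x. (\<Sum>i. ennreal (2^i * d i x)) \<partial>M) \<noteq> \<infinity>"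
    using neq_top_trans[OF ennreal_neq_top] by simp
  then have "AE x in M. (\<Sum>i. ennreal (2^i * d i x)) \<noteq> \<infinity>"
    by (intro nn_integral_PInf_AE) auto
  then have conv: "AE x in M. convergent (\<lambda>i. f (r i) x)"
  proof (rule AE_mp, intro AE_I2 impI)
    fix x assume fin: "(\<Sum>i. ennreal (2^i * d i x)) \<noteq> \<infinity>"
    then obtain B where B: "(\<Sum>i. ennreal (2^i * d i x)) = ennreal B" "0 \<le> B"
      by (cases "(\<Sum>i. ennreal (2^i * d i x))") auto
    have dB: "2^i * d i x \<le> B" for i
    proof -
      have "ennreal (2^i * d i x) \<le> ennreal B"
        using sum_le_suminf[of "\<lambda>i. ennreal (2^i * d i x)" "{i}"] B by simp
      then show ?thesis using B(2) by (simp add: ennreal_le_iff)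
    qed
    have incr: "norm (f (r (Suc i)) x - f (r i) x) \<le> sqrt B * (sqrt (1/2)) ^ i" for i
    proof -
      have "norm (f (r (Suc i)) x - f (r i) x) = sqrt (d i x)" by (simp add: d_def)
      also have "\<dots> \<le> sqrt (B * (1/2)^i)"
        using dB[of i] by (intro real_sqrt_le_mono) (simp add: field_simps)
      finally show ?thesis by (simp add: real_sqrt_mult real_sqrt_power)
    qed
    have "summable (\<lambda>i. f (r (Suc i)) x - f (r i) x)"
      by (rule summable_comparison_test'[OF _ incr]) (auto intro!: summable_mult summable_geometric)
    then have "convergent (\<lambda>n. \<Sum>i<n. f (r (Suc i)) x - f (r i) x)"
      by (simp add: summable_iff_convergent)
    then have "convergent (\<lambda>n. f (r n) x - f (r 0) x)"
      by (subst (asm) sum_lessThan_telescope)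
    then show "convergent (\<lambda>i. f (r i) x)"
      using convergent_diff_const_right_iff by blast
  qed
  define g where "g x = lim (\<lambda>i. f (r i) x)" for x
  have [measurable]: "g \<in> borel_measurable M"
    unfolding g_def[abs_def] by (rule borel_measurable_lim_metric) simp
  have lim: "AE x in M. (\<lambda>i. f (r i) x) \<longlonglongrightarrow> g x"
    using conv by (auto simp: g_def convergent_LIMSEQ_iff)
  \<comment> \<open>Fatou's lemma along the subsequence estimates the distance from the limit of
    every \<open>f k\<close>, not only of the members of the subsequence.\<close>
  have bound: "(\<integral>\<^sup>+x. ennreal ((f k x - g x)\<^sup>2) \<partial>M) \<le> ennreal e"
    if kN: "\<And>j. j \<ge> k \<Longrightarrow> (LINT x|M. (f k x - f j x)\<^sup>2) < e" for k e
  proof -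
    have "(\<integral>\<^sup>+x. ennreal ((f k x - g x)\<^sup>2) \<partial>M) = (\<integral>\<^sup>+x. liminf (\<lambda>i. ennreal ((f k x - f (r i) x)\<^sup>2)) \<partial>M)"
    proof (rule nn_integral_cong_AE)
      show "AE x in M. ennreal ((f k x - g x)\<^sup>2) = liminf (\<lambda>i. ennreal ((f k x - f (r i) x)\<^sup>2))"
        using lim
      proof eventually_elim
        case (elim x)
        then have "(\<lambda>i. ennreal ((f k x - f (r i) x)\<^sup>2)) \<longlonglongrightarrow> ennreal ((f k x - g x)\<^sup>2)"
          by (intro tendsto_intros tendsto_ennrealI)
        then show ?case
          by (intro lim_imp_Liminf[symmetric]) auto
      qed
    qed
    also have "\<dots> \<le> liminf (\<lambda>i. \<integral>\<^sup>+x. ennreal ((f k x - f (r i) x)\<^sup>2) \<partial>M)"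
      by (rule nn_integral_liminf) measurable
    also have "\<dots> \<le> limsup (\<lambda>i. \<integral>\<^sup>+x. ennreal ((f k x - f (r i) x)\<^sup>2) \<partial>M)"
      by (rule Liminf_le_Limsup) simp
    also have "\<dots> \<le> ennreal e"
    proof (rule Limsup_bounded)
      show "\<forall>\<^sub>F i in sequentially. (\<integral>\<^sup>+x. ennreal ((f k x - f (r i) x)\<^sup>2) \<partial>M) \<le> ennreal e"
        using eventually_ge_at_top[of k]
      proof eventually_elim
        case (elim i)
        then have "(LINT x|M. (f k x - f (r i) x)\<^sup>2) < e"
          using rN(2)[of i] by (intro kN) simp
        then show ?case
          using D by (subst nn_integral_eq_integral) (auto intro: ennreal_leI)
      qed
    qed
    finally show ?thesis .
  qed
  have int: "integrable M (\<lambda>x. (f k x - g x)\<^sup>2) \<and> (LINT x|M. (f k x - g x)\<^sup>2) \<le> e"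
    if "\<And>j. j \<ge> k \<Longrightarrow> (LINT x|M. (f k x - f j x)\<^sup>2) < e" for k e
  proof -
    have "0 \<le> e" using that[of k] by simp
    have fin: "(\<integral>\<^sup>+x. ennreal ((f k x - g x)\<^sup>2) \<partial>M) \<le> ennreal e"
      by (rule bound) (rule that)
    then have "integrable M (\<lambda>x. (f k x - g x)\<^sup>2)"
      by (intro integrableI_nonneg) (auto simp: less_top[symmetric] top_unique)
    with fin \<open>0 \<le> e\<close> show ?thesis
      by (subst (asm) nn_integral_eq_integral) (auto simp: ennreal_le_iff)
  qed
  \<comment> \<open>The index \<open>N 0\<close> belongs to the tolerance (1/4)^0 = 1; subtracting
    this difference from \<open>f (N 0)\<close> recovers g.\<close>
  have "L2 M (\<lambda>x. f (N 0) x - g x)"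
    using int[of "N 0" 1] N[of 0 "N 0"] by (auto simp: L2_def)
  from L2_diff[OF L[of "N 0"] this] have "L2 M g" by simp
  moreover have "(\<lambda>k. LINT x|M. (f k x - g x)\<^sup>2) \<longlonglongrightarrow> 0"
  proof (rule LIMSEQ_I)
    fix e :: real assume "e > 0"
    then obtain N where N: "\<And>j k. j \<ge> N \<Longrightarrow> k \<ge> N \<Longrightarrow> (LINT x|M. (f j x - f k x)\<^sup>2) < e / 2"
      using C[of "e/2"] by auto
    have "(LINT x|M. (f k x - g x)\<^sup>2) \<le> e / 2" if "k \<ge> N" for k
      using int[of k "e/2"] N that by auto
    then show "\<exists>no. \<forall>n\<ge>no. norm ((LINT x|M. (f n x - g x)\<^sup>2) - 0) < e"
      using \<open>e > 0\<close> by (intro exI[of _ N]) force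
  qed
  ultimately show ?thesis
    using L by (auto simp: L2_tendsto_def)
qed

section \<open>Smooth functions\<close>

lemma partial_eqI: "(f has_derivative f') (at x) \<Longrightarrow> partial b f x = f' b"
  by (simp add: partial_def frechet_derivative_at[symmetric])

lemma C_k_SucD: "C_k (Suc k) f \<Longrightarrow> C_k k f"
  by (induction k arbitrary: f)
    (auto simp: continuous_on_eq_continuous_within intro: differentiable_imp_continuous_within)

lemma C_k_const: "C_k k (\<lambda>x. c)"
proof (induction k arbitrary: c)
  case (Suc k)
  have "partial b (\<lambda>x::'a. c) = (\<lambda>x. 0)" for b :: 'a
    by (rule ext, rule partial_eqI) simp
  with Suc show ?case by simp
qed simp

lemma partial_add:
  assumes "\<And>x. f differentiable (at x)" "\<And>x. g differentiable (at x)"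
  shows "partial b (\<lambda>x. f x + g x) = (\<lambda>x. partial b f x + partial b g x)"
  by (rule ext, rule partial_eqI)
    (use assms in \<open>auto simp: partial_def frechet_derivative_works intro!: derivative_eq_intros\<close>)

lemma partial_mult:
  assumes "\<And>x. f differentiable (at x)" "\<And>x. g differentiable (at x)"
  shows "partial b (\<lambda>x. f x * g x) = (\<lambda>x. partial b f x * g x + f x * partial b g x)"
proof
  fix x
  have "((\<lambda>x. f x * g x) has_derivative
      (\<lambda>h. f x * frechet_derivative g (at x) h + frechet_derivative f (at x) h * g x)) (at x)"
    using assms by (intro has_derivative_mult) (auto simp: frechet_derivative_works[symmetric])
  from partial_eqI[OF this] show "partial b (\<lambda>x. f x * g x) x = partial b f x * g x + f x * partial b g x"
    by (simp add: partial_def)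
qed

text \<open>Since \<open>1\<close> is the basis vector of the reals, \<open>partial 1 h\<close> is
  the ordinary derivative of \<open>h\<close>; linearity of the Frechet derivative pulls out the
  scalar \<open>partial b g x\<close>.\<close>

lemma partial_compose:
  fixes h :: "real \<Rightarrow> real"
  assumes "\<And>x. h differentiable (at x)" "\<And>x. g differentiable (at x)"
  shows "partial b (\<lambda>x. h (g x)) = (\<lambda>x. partial 1 h (g x) * partial b g x)"
proof
  fix x
  let ?h = "frechet_derivative h (at (g x))"
  have h: "(h has_derivative ?h) (at (g x))"
    using assms by (auto simp: frechet_derivative_works[symmetric])
  have "((\<lambda>x. h (g x)) has_derivative (\<lambda>y. ?h (frechet_derivative g (at x) y))) (at x)"
    by (rule has_derivative_compose[where f = g and g = h, OF _ h])
      (use assms in \<open>auto simp: frechet_derivative_works[symmetric]\<close>)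
  from partial_eqI[OF this] have "partial b (\<lambda>x. h (g x)) x = ?h (partial b g x *\<^sub>R 1)"
    by (simp add: partial_def)
  also have "\<dots> = partial b g x *\<^sub>R ?h 1"
    by (intro linear_scale linear_frechet_derivative assms)
  finally show "partial b (\<lambda>x. h (g x)) x = partial 1 h (g x) * partial b g x"
    by (simp add: partial_def)
qed

lemma partial_inner: "partial b (\<lambda>x. x \<bullet> c) = (\<lambda>x. b \<bullet> c)"
  by (rule ext, rule partial_eqI) (auto intro!: derivative_eq_intros)

lemma C_k_add: "C_k k f \<Longrightarrow> C_k k g \<Longrightarrow> C_k k (\<lambda>x. f x + g x)"
  by (induction k arbitrary: f g) (auto intro: continuous_on_add simp: partial_add)

lemma C_k_mult: "C_k k f \<Longrightarrow> C_k k g \<Longrightarrow> C_k k (\<lambda>x. f x * g x)"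
proof (induction k arbitrary: f g)
  case (Suc k)
  then show ?case
    using C_k_SucD[OF Suc.prems(1)] C_k_SucD[OF Suc.prems(2)]
    by (auto simp: partial_mult intro!: C_k_add Suc.IH)
qed (auto intro: continuous_on_mult)

lemma C_k_compose: "C_k k h \<Longrightarrow> C_k k g \<Longrightarrow> C_k k (\<lambda>x. h (g x))"
proof (induction k arbitrary: h g)
  case 0
  then show ?case
    by (auto intro: continuous_on_compose2[of UNIV h UNIV g])
next
  case (Suc k)
  from Suc.prems have d: "h differentiable (at x)" "g differentiable (at y)" for x y
    by auto
  have "(\<lambda>x. h (g x)) differentiable (at x)" for x
    by (rule differentiable_compose) (use d in auto)
  moreover have "C_k k (partial b (\<lambda>x. h (g x)))" if "b \<in> Basis" for b
  proof -
    have "C_k k (\<lambda>x. partial 1 h (g x))"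
      by (rule Suc.IH[OF _ C_k_SucD[OF Suc.prems(2)]]) (use Suc.prems(1) in auto)
    then show ?thesis
      using Suc.prems(2) that by (simp add: partial_compose[OF d] C_k_mult)
  qed
  ultimately show ?case by simp
qed

lemma C_k_inner: "C_k k (\<lambda>x. x \<bullet> c)"
  by (cases k) (auto simp: partial_inner intro!: continuous_intros C_k_const)

definition smooth :: "('a::euclidean_space \<Rightarrow> real) \<Rightarrow> bool" where
  "smooth f \<longleftrightarrow> (\<forall>k. C_k k f)"

lemma smooth_const: "smooth (\<lambda>x. c)"
  and smooth_inner: "smooth (\<lambda>x. x \<bullet> a)"
  and smooth_add: "smooth f \<Longrightarrow> smooth g \<Longrightarrow> smooth (\<lambda>x. f x + g x)"
  and smooth_mult: "smooth f \<Longrightarrow> smooth g \<Longrightarrow> smooth (\<lambda>x. f x * g x)"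
  and smooth_compose: "smooth h \<Longrightarrow> smooth f \<Longrightarrow> smooth (\<lambda>x. h (f x))"
  by (auto simp: smooth_def intro: C_k_const C_k_inner C_k_add C_k_mult C_k_compose)

lemma smooth_cmult: "smooth f \<Longrightarrow> smooth (\<lambda>x. c * f x)"
  by (intro smooth_mult smooth_const)

lemma smooth_diff: "smooth f \<Longrightarrow> smooth g \<Longrightarrow> smooth (\<lambda>x. f x - g x)"
  using smooth_add[of f "\<lambda>x. - 1 * g x"] smooth_cmult[of g "-1"] by simp

lemma smooth_sum: "(\<And>i. i \<in> I \<Longrightarrow> smooth (f i)) \<Longrightarrow> smooth (\<lambda>x. \<Sum>i\<in>I. f i x)"
  by (induction I rule: infinite_finite_induct) (auto intro: smooth_add smooth_const)

lemma smooth_prod: "(\<And>i. i \<in> I \<Longrightarrow> smooth (f i)) \<Longrightarrow> smooth (\<lambda>x. \<Prod>i\<in>I. f i x)"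
  by (induction I rule: infinite_finite_induct) (auto intro: smooth_mult smooth_const)

lemma smooth_norm_square: "smooth (\<lambda>x::'a::euclidean_space. (norm x)\<^sup>2)"
proof -
  have "(\<lambda>x::'a. (norm x)\<^sup>2) = (\<lambda>x. \<Sum>b\<in>Basis. (x \<bullet> b) * (x \<bullet> b))"
    by (simp add: power2_norm_eq_inner euclidean_inner[symmetric])
  then show ?thesis
    by (simp add: smooth_sum smooth_mult smooth_inner)
qed

lemma smooth_differentiable: "smooth f \<Longrightarrow> f differentiable (at x)"
  unfolding smooth_def by (auto dest!: spec[of _ "Suc 0"])

lemma smooth_continuous: "smooth f \<Longrightarrow> continuous_on UNIV f"
  unfolding smooth_def by (auto dest!: spec[of _ 0])

lemma smooth_partial: "smooth f \<Longrightarrow> b \<in> Basis \<Longrightarrow> smooth (partial b f)"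
  unfolding smooth_def by (metis C_k.simps(2))

lemma smooth_measurable: "smooth f \<Longrightarrow> f \<in> borel_measurable lebesgue"
  by (intro measurable_completion) (simp add: borel_measurable_continuous_onI smooth_continuous)

section \<open>Mean value theorems along lines and symmetry of second derivatives\<close>

lemma smooth_DERIV_line:
  assumes "smooth f"
  shows "((\<lambda>t. f (x + t *\<^sub>R b)) has_real_derivative partial b f (x + t *\<^sub>R b)) (at t)"
proof -
  let ?f' = "frechet_derivative f (at (x + t *\<^sub>R b))"
  have d: "f differentiable (at (x + t *\<^sub>R b))"
    using assms by (rule smooth_differentiable)
  then have f': "(f has_derivative ?f') (at (x + t *\<^sub>R b))"
    by (simp add: frechet_derivative_works[symmetric])
  have "((\<lambda>t. f (x + t *\<^sub>R b)) has_derivative (\<lambda>s. ?f' (s *\<^sub>R b))) (at t)"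
    by (rule has_derivative_compose[where f = "\<lambda>t. x + t *\<^sub>R b" and g = f, OF _ f']) (auto intro!: derivative_eq_intros)
  moreover have "?f' (s *\<^sub>R b) = ?f' b * s" for s
    using linear_scale[OF linear_frechet_derivative[OF d]] by simp
  ultimately show ?thesis
    by (simp add: has_field_derivative_def partial_def mult_commute_abs)
qed

lemma smooth_MVT:
  assumes "smooth f" "0 < h"
  obtains s where "0 < s" "s < h" "f (x + h *\<^sub>R b) - f x = h * partial b f (x + s *\<^sub>R b)"
  using MVT2[of 0 h "\<lambda>t. f (x + t *\<^sub>R b)" "\<lambda>t. partial b f (x + t *\<^sub>R b)"]
    smooth_DERIV_line[OF assms(1)] assms(2) by auto

text \<open>Two applications of the mean value theorem: along b, to the difference of
  \<open>f\<close> at positions that are h c apart, and then along c, to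
  \<open>partial b f\<close>.\<close>

lemma smooth_second_difference:
  assumes "smooth f" "b \<in> Basis" "0 < h"
  shows "\<exists>s t. 0 < s \<and> s < h \<and> 0 < t \<and> t < h \<and>
    f (x + h *\<^sub>R b + h *\<^sub>R c) - f (x + h *\<^sub>R b) - f (x + h *\<^sub>R c) + f x
      = h * h * partial c (partial b f) (x + s *\<^sub>R b + t *\<^sub>R c)"
proof -
  have "\<exists>s>0. s < h \<and> (f (x + h *\<^sub>R c + h *\<^sub>R b) - f (x + h *\<^sub>R b)) - (f (x + h *\<^sub>R c + 0 *\<^sub>R b) - f (x + 0 *\<^sub>R b))
      = (h - 0) * (partial b f (x + h *\<^sub>R c + s *\<^sub>R b) - partial b f (x + s *\<^sub>R b))"
    by (rule MVT2) (auto intro!: DERIV_diff smooth_DERIV_line assms)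
  then obtain s where s: "0 < s" "s < h" "(f (x + h *\<^sub>R c + h *\<^sub>R b) - f (x + h *\<^sub>R b)) - (f (x + h *\<^sub>R c) - f x)
      = h * (partial b f (x + h *\<^sub>R c + s *\<^sub>R b) - partial b f (x + s *\<^sub>R b))"
    by auto
  obtain t where t: "0 < t" "t < h" "partial b f (x + s *\<^sub>R b + h *\<^sub>R c) - partial b f (x + s *\<^sub>R b)
      = h * partial c (partial b f) (x + s *\<^sub>R b + t *\<^sub>R c)"
    using smooth_MVT[OF smooth_partial[OF assms(1,2)] assms(3)] .
  show ?thesis
    using s t by (intro exI[of _ s] exI[of _ t]) (auto simp: algebra_simps)
qed

text \<open>Schwarz's theorem. The second difference is symmetric in the two directions, and its
  quotient by h^2 tends to the mixed derivative in either order, because the intermediate points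
  tend to x.\<close>

lemma partial_commute:
  assumes f: "smooth f" and b: "b \<in> Basis" and c: "c \<in> Basis"
  shows "partial b (partial c f) x = partial c (partial b f) x"
proof -
  define h where "h n = inverse (real (Suc n))" for n
  have h0: "0 < h n" for n by (simp add: h_def)
  have hlim: "h \<longlonglongrightarrow> 0"
    unfolding h_def by (rule LIMSEQ_inverse_real_of_nat)
  define D where "D b c n = f (x + h n *\<^sub>R b + h n *\<^sub>R c) - f (x + h n *\<^sub>R b) - f (x + h n *\<^sub>R c) + f x" for b c n
  have lim: "(\<lambda>n. D b c n / (h n * h n)) \<longlonglongrightarrow> partial c (partial b f) x" if b: "b \<in> Basis" and c: "c \<in> Basis" for b c
  proof -
    have "\<forall>n. \<exists>s t. 0 < s \<and> s < h n \<and> 0 < t \<and> t < h n \<and>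
        D b c n = h n * h n * partial c (partial b f) (x + s *\<^sub>R b + t *\<^sub>R c)"
      unfolding D_def using smooth_second_difference[OF f b h0] by blast
    then obtain s t where st: "0 < s n" "s n < h n" "0 < t n" "t n < h n"
        "D b c n = h n * h n * partial c (partial b f) (x + s n *\<^sub>R b + t n *\<^sub>R c)" for n
      by metis
    have s0: "s \<longlonglongrightarrow> 0" and t0: "t \<longlonglongrightarrow> 0"
      using st by (auto intro!: tendsto_zero_bound[OF hlim] less_imp_le simp: abs_of_pos)
    have "(\<lambda>n. x + s n *\<^sub>R b + t n *\<^sub>R c) \<longlonglongrightarrow> x + 0 *\<^sub>R b + 0 *\<^sub>R c"
      by (intro tendsto_intros s0 t0)
    then have "(\<lambda>n. partial c (partial b f) (x + s n *\<^sub>R b + t n *\<^sub>R c)) \<longlonglongrightarrow> partial c (partial b f) x"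
      using smooth_continuous[OF smooth_partial[OF smooth_partial[OF f b] c]]
      by (auto simp: continuous_on_eq_continuous_at intro: isCont_tendsto_compose)
    moreover have eq: "D b c n / (h n * h n) = partial c (partial b f) (x + s n *\<^sub>R b + t n *\<^sub>R c)" for n
      using st(5)[of n] h0[of n] by (simp add: field_simps)
    ultimately show ?thesis by simp
  qed
  have "(\<lambda>n. D b c n / (h n * h n)) \<longlonglongrightarrow> partial b (partial c f) x"
    using lim[OF c b] by (simp add: D_def algebra_simps)
  from LIMSEQ_unique[OF this lim[OF b c]] show ?thesis .
qed

section \<open>Integral identities for test functions\<close>

lemma test_function_iff: "test_function f \<longleftrightarrow> smooth f \<and> bounded {x. f x \<noteq> 0}"
  by (simp add: test_function_def smooth_def compact_closure)

lemma test_function_smooth: "test_function f \<Longrightarrow> smooth f"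
  and test_function_bounded: "test_function f \<Longrightarrow> bounded {x. f x \<noteq> 0}"
  by (simp_all add: test_function_iff)

text \<open>Off the closed support, f vanishes on a neighbourhood. The closure matters: where f
  passes through zero its derivative may be nonzero.\<close>

lemma partial_support_subset: "{x. partial b f x \<noteq> 0} \<subseteq> closure {x. f x \<noteq> 0}"
proof (intro subsetI, rule ccontr)
  fix x assume x: "x \<in> {x. partial b f x \<noteq> 0}" "x \<notin> closure {x. f x \<noteq> 0}"
  have "(f has_derivative (\<lambda>_. 0)) (at x)"
    by (rule has_derivative_transform_within_open[of "\<lambda>_. 0" _ x UNIV "- closure {x. f x \<noteq> 0}"])
      (use x closure_subset[of "{x. f x \<noteq> 0}"] in \<open>auto simp: open_Compl\<close>)
  from partial_eqI[OF this, of b] x(1) show False by simp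
qed

lemma test_function_partial: "test_function f \<Longrightarrow> b \<in> Basis \<Longrightarrow> test_function (partial b f)"
  unfolding test_function_iff
  using bounded_subset[OF _ partial_support_subset] by (auto intro: smooth_partial bounded_closure)

lemma test_function_mult:
  assumes "test_function f" "smooth g" shows "test_function (\<lambda>x. f x * g x)"
proof -
  have "{x. f x * g x \<noteq> 0} \<subseteq> {x. f x \<noteq> 0}" by auto
  with assms show ?thesis
    by (auto simp: test_function_iff intro: smooth_mult bounded_subset)
qed

lemma test_function_diff:
  assumes "test_function f" "test_function g" shows "test_function (\<lambda>x. f x - g x)"
proof -
  have "{x. f x - g x \<noteq> 0} \<subseteq> {x. f x \<noteq> 0} \<union> {x. g x \<noteq> 0}" by auto
  from bounded_subset[OF _ this] assms show ?thesis
    by (simp add: test_function_iff smooth_diff)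
qed

lemma test_function_sum:
  assumes "\<And>i. i \<in> I \<Longrightarrow> test_function (f i)"
  shows "test_function (\<lambda>x. \<Sum>i\<in>I. f i x)"
  using assms
proof (induction I rule: infinite_finite_induct)
  case (insert i I)
  then have "test_function (f i)" "test_function (\<lambda>x. \<Sum>i\<in>I. f i x)" by auto
  moreover have "{x. f i x + (\<Sum>i\<in>I. f i x) \<noteq> 0} \<subseteq> {x. f i x \<noteq> 0} \<union> {x. (\<Sum>i\<in>I. f i x) \<noteq> 0}"
    by auto
  ultimately show ?case
    unfolding test_function_iff sum.insert[OF insert.hyps]
    using bounded_subset[of "{x. f i x \<noteq> 0} \<union> {x. (\<Sum>i\<in>I. f i x) \<noteq> 0}" "{x. f i x + (\<Sum>i\<in>I. f i x) \<noteq> 0}"]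
    by (simp add: smooth_add)
qed (auto simp: test_function_iff smooth_const)

lemma test_function_laplacian: "test_function f \<Longrightarrow> test_function (laplacian f)"
  unfolding laplacian_def by (intro test_function_sum test_function_partial)

lemma bounded_support_integrable:
  fixes f :: "'a::euclidean_space \<Rightarrow> real"
  assumes "continuous_on UNIV f" "bounded {x. f x \<noteq> 0}"
  shows "integrable lebesgue f"
proof -
  have "integrable lborel (\<lambda>x. indicator (closure {x. f x \<noteq> 0}) x *\<^sub>R f x)"
    using assms by (intro borel_integrable_compact) (auto simp: compact_closure intro: continuous_on_subset)
  also have "(\<lambda>x. indicator (closure {x. f x \<noteq> 0}) x *\<^sub>R f x) = f"
    using closure_subset[of "{x. f x \<noteq> 0}"] by (auto simp: fun_eq_iff indicator_def)
  finally show ?thesis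
    using assms by (simp add: integrable_completion borel_measurable_continuous_onI)
qed

lemma test_function_integrable: "test_function f \<Longrightarrow> integrable lebesgue f"
  by (simp add: bounded_support_integrable smooth_continuous test_function_iff)

lemma test_function_L2: "test_function f \<Longrightarrow> L2 lebesgue f"
  using test_function_integrable[OF test_function_mult[of f f]]
  by (auto simp: L2_def test_function_smooth smooth_measurable power2_eq_square)

lemma bounded_support_bounded:
  fixes f :: "'a::euclidean_space \<Rightarrow> real"
  assumes "continuous_on UNIV f" "bounded {x. f x \<noteq> 0}"
  shows "\<exists>B>0. \<forall>x. \<bar>f x\<bar> \<le> B"
proof -
  have "bounded (f ` closure {x. f x \<noteq> 0})"
    using assms by (intro compact_imp_bounded compact_continuous_image) (auto simp: compact_closure intro: continuous_on_subset)
  then obtain B where "B > 0" "\<And>x. x \<in> closure {x. f x \<noteq> 0} \<Longrightarrow> \<bar>f x\<bar> \<le> B"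
    by (auto simp: bounded_pos)
  then have "\<bar>f x\<bar> \<le> B" for x
    using closure_subset[of "{x. f x \<noteq> 0}"] by (cases "f x = 0") auto
  with \<open>B > 0\<close> show ?thesis by auto
qed

lemma test_function_bound: "test_function f \<Longrightarrow> \<exists>B>0. \<forall>x. \<bar>f x\<bar> \<le> B"
  by (simp add: bounded_support_bounded smooth_continuous test_function_iff)

section \<open>Translation invariance and integration by parts\<close>

lemma lborel_integral_translation:
  fixes f :: "'a::euclidean_space \<Rightarrow> real"
  assumes [measurable]: "f \<in> borel_measurable borel"
  shows "(LINT x|lborel. f (x + c)) = (LINT x|lborel. f x)"
proof -
  have "(LINT x|lborel. f x) = (LINT x|distr lborel borel ((+) c). f x)"
    by (simp add: lborel_distr_plus)
  also have "\<dots> = (LINT x|lborel. f (c + x))"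
    by (rule integral_distr) auto
  finally show ?thesis by (simp add: add.commute)
qed

text \<open>The difference quotients of \<open>f\<close> have integral zero by translation invariance.\<close>

lemma integral_partial:
  fixes f :: "'a::euclidean_space \<Rightarrow> real"
  assumes f: "test_function f" and b: "b \<in> Basis"
  shows "(LINT x|lebesgue. partial b f x) = 0"
proof -
  define h where "h n = inverse (real (Suc n))" for n
  have h: "0 < h n" "h n \<le> 1" for n by (auto simp: h_def field_simps)
  have hlim: "h \<longlonglongrightarrow> 0"
    unfolding h_def by (rule LIMSEQ_inverse_real_of_nat)
  define q where "q n x = (f (x + h n *\<^sub>R b) - f x) / h n" for n x
  note s = test_function_smooth[OF f]
  have [measurable]: "f \<in> borel_measurable borel" "partial b f \<in> borel_measurable borel"
    using s b by (auto intro!: borel_measurable_continuous_onI smooth_continuous smooth_partial)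
  obtain B where B: "B > 0" "\<bar>partial b f x\<bar> \<le> B" for x
    using test_function_bound[OF test_function_partial[OF f b]] by auto
  obtain R where R: "f x \<noteq> 0 \<Longrightarrow> norm x \<le> R" for x
    using test_function_bounded[OF f] by (auto simp: bounded_iff)
  \<comment> \<open>Steps of length at most 1 keep the quotients supported in the ball of radius R +
    1, and the mean value theorem bounds them by B: an integrable majorant.\<close>
  have q_bound: "\<bar>q n x\<bar> \<le> B * indicator (cball 0 (R + 1)) x" for n x
  proof (cases "norm x \<le> R + 1")
    case True
    obtain t where "f (x + h n *\<^sub>R b) - f x = h n * partial b f (x + t *\<^sub>R b)"
      using smooth_MVT[OF s h(1)] by metis
    then have "q n x = partial b f (x + t *\<^sub>R b)"
      using h(1)[of n] by (simp add: q_def)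
    with B(2) True show ?thesis by simp
  next
    case False
    have "norm x \<le> norm (x + h n *\<^sub>R b) + norm (h n *\<^sub>R b)"
      using norm_triangle_ineq4[of "x + h n *\<^sub>R b" "h n *\<^sub>R b"] by simp
    then have "norm x \<le> norm (x + h n *\<^sub>R b) + 1"
      using h[of n] b by simp
    with False R have "f (x + h n *\<^sub>R b) = 0" "f x = 0" by force+
    then show ?thesis using False by (simp add: q_def)
  qed
  have "(\<lambda>n. LINT x|lborel. q n x) \<longlonglongrightarrow> (LINT x|lborel. partial b f x)"
  proof (rule integral_dominated_convergence)
    show "partial b f \<in> borel_measurable lborel" "q n \<in> borel_measurable lborel" for n
      by (simp_all add: q_def[abs_def])
    show "integrable lborel (\<lambda>x. B * indicator (cball 0 (R + 1)) x :: real)"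
      by (auto intro!: integrable_mult_right emeasure_compact_finite)
    show "AE x in lborel. norm (q n x) \<le> B * indicator (cball 0 (R + 1)) x" for n
      using q_bound by simp
    show "AE x in lborel. (\<lambda>n. q n x) \<longlonglongrightarrow> partial b f x"
    proof (rule AE_I2)
      fix x
      have "((\<lambda>t. (f (x + t *\<^sub>R b) - f x) / t) \<longlongrightarrow> partial b f x) (at 0)"
        using smooth_DERIV_line[OF s, of x b 0] by (simp add: DERIV_def)
      moreover have "filterlim h (at 0) sequentially"
        using hlim h(1) by (intro filterlim_atI) (auto intro: always_eventually simp: less_imp_neq[symmetric])
      ultimately show "(\<lambda>n. q n x) \<longlonglongrightarrow> partial b f x"
        unfolding q_def by (rule filterlim_compose)
    qed
  qed
  moreover have "(LINT x|lborel. q n x) = 0" for n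
  proof -
    have "integrable lborel f"
      using test_function_integrable[OF f] by (simp add: integrable_completion)
    moreover from this have "integrable lborel (\<lambda>x. f (h n *\<^sub>R b + x))"
      by (subst (asm) lborel_distr_plus[of "h n *\<^sub>R b", symmetric], subst (asm) integrable_distr_eq) auto
    ultimately show ?thesis
      using lborel_integral_translation[of f "h n *\<^sub>R b"] by (simp add: q_def add.commute)
  qed
  ultimately have "(LINT x|lborel. partial b f x) = 0"
    using LIMSEQ_unique[OF tendsto_const[of 0 sequentially]] by simp
  then show ?thesis
    by (simp add: integral_completion)
qed

text \<open>The support of \<open>f\<close> localises the product, so \<open>g\<close> may be any
  smooth function, in particular a coordinate times a derivative.\<close>

lemma integral_by_parts:
  fixes f :: "'a::euclidean_space \<Rightarrow> real"
  assumes f: "test_function f" and g: "smooth g" and b: "b \<in> Basis"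
  shows "(LINT x|lebesgue. partial b f x * g x) = - (LINT x|lebesgue. f x * partial b g x)"
proof -
  have "0 = (LINT x|lebesgue. partial b (\<lambda>x. f x * g x) x)"
    by (rule integral_partial[OF test_function_mult[OF f g] b, symmetric])
  also have "\<dots> = (LINT x|lebesgue. partial b f x * g x + f x * partial b g x)"
    using f g by (simp add: partial_mult test_function_smooth smooth_differentiable)
  also have "\<dots> = (LINT x|lebesgue. partial b f x * g x) + (LINT x|lebesgue. f x * partial b g x)"
    using assms by (intro Bochner_Integration.integral_add test_function_integrable
        test_function_mult test_function_partial smooth_partial)
  finally show ?thesis by simp
qed

section \<open>Identities for the gradient, the Laplacian and the radial derivative\<close>

lemma grad_inner: "b \<in> Basis \<Longrightarrow> grad f x \<bullet> b = partial b f x"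
  by (simp add: grad_def inner_sum_left inner_Basis if_distrib sum.delta cong: if_cong)

lemma grad_inner_grad: "grad f x \<bullet> grad g x = (\<Sum>b\<in>Basis. partial b f x * partial b g x)"
  by (subst euclidean_inner) (simp add: grad_inner)

lemma norm_grad: "(norm (grad f x))\<^sup>2 = (\<Sum>b\<in>Basis. (partial b f x)\<^sup>2)"
  by (simp add: power2_norm_eq_inner grad_inner_grad power2_eq_square[of "partial _ _ _"])

lemma grad_inner_sum: "grad f x \<bullet> y = (\<Sum>b\<in>Basis. partial b f x * (y \<bullet> b))"
  by (simp add: grad_def inner_sum_left inner_commute)
    (simp add: inner_sum_right inner_commute)

lemma integral_mult_laplacian:
  assumes f: "test_function f" and g: "smooth g"
  shows "(LINT x|lebesgue. f x * laplacian g x) = - (LINT x|lebesgue. grad f x \<bullet> grad g x)"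
proof -
  have "(LINT x|lebesgue. f x * laplacian g x) = (\<Sum>b\<in>Basis. LINT x|lebesgue. f x * partial b (partial b g) x)"
    unfolding laplacian_def sum_distrib_left
    using assms by (intro Bochner_Integration.integral_sum test_function_integrable test_function_mult smooth_partial)
  also have "\<dots> = - (\<Sum>b\<in>Basis. LINT x|lebesgue. partial b f x * partial b g x)"
    using assms by (simp add: integral_by_parts smooth_partial sum_negf)
  also have "(\<Sum>b\<in>Basis. LINT x|lebesgue. partial b f x * partial b g x)
      = (LINT x|lebesgue. (\<Sum>b\<in>Basis. partial b f x * partial b g x))"
    using assms by (intro Bochner_Integration.integral_sum[symmetric] test_function_integrable
        test_function_mult test_function_partial smooth_partial)
  also have "\<dots> = (LINT x|lebesgue. grad f x \<bullet> grad g x)"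
    by (simp only: grad_inner_grad)
  finally show ?thesis .
qed

text \<open>The integrand is x_c times half the derivative of f^2, and x_c has derivative 1 in
  direction c. The identity is stated per coordinate because it serves both \<open>f\<close> itself
  and each of its first derivatives.\<close>

lemma integral_dilation:
  assumes f: "test_function f" and c: "c \<in> Basis"
  shows "(LINT x|lebesgue. (x \<bullet> c) * (f x * partial c f x)) = - (LINT x|lebesgue. (f x)\<^sup>2) / 2"
proof -
  note s = test_function_smooth[OF f]
  have 1: "partial c (\<lambda>x. f x * f x) = (\<lambda>x. 2 * (f x * partial c f x))"
    using s by (simp add: partial_mult smooth_differentiable algebra_simps)
  have 2: "partial c (\<lambda>x. x \<bullet> c) = (\<lambda>x. 1)"
    using c by (simp add: partial_inner)
  have "(LINT x|lebesgue. partial c (\<lambda>x. f x * f x) x * (x \<bullet> c))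
      = - (LINT x|lebesgue. (f x * f x) * partial c (\<lambda>x. x \<bullet> c) x)"
    by (rule integral_by_parts[OF test_function_mult[OF f s] smooth_inner c])
  then have "2 * (LINT x|lebesgue. (x \<bullet> c) * (f x * partial c f x)) = - (LINT x|lebesgue. (f x)\<^sup>2)"
    unfolding 1 2 by (simp add: power2_eq_square mult_ac flip: Bochner_Integration.integral_mult_right_zero)
  then show ?thesis by simp
qed

lemma integral_mult_radial_derivative:
  fixes f :: "'a::euclidean_space \<Rightarrow> real"
  assumes f: "test_function f"
  shows "(LINT x|lebesgue. f x * (grad f x \<bullet> x)) = - (real DIM('a) / 2) * (LINT x|lebesgue. (f x)\<^sup>2)"
proof -
  have "(LINT x|lebesgue. f x * (grad f x \<bullet> x)) = (LINT x|lebesgue. (\<Sum>c\<in>Basis. (x \<bullet> c) * (f x * partial c f x)))"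
    by (simp add: grad_inner_sum sum_distrib_left mult_ac)
  also have "\<dots> = (\<Sum>c\<in>Basis. LINT x|lebesgue. (x \<bullet> c) * (f x * partial c f x))"
    using test_function_integrable[OF test_function_mult[OF f smooth_mult[OF smooth_inner smooth_partial]]]
      test_function_smooth[OF f]
    by (intro Bochner_Integration.integral_sum) (simp add: mult_ac)
  also have "\<dots> = - (real DIM('a) / 2) * (LINT x|lebesgue. (f x)\<^sup>2)"
    using f by (simp add: integral_dilation)
  finally show ?thesis .
qed

text \<open>An identity of Rellich-Pohozaev type. Once one derivative is moved off \<partial>_b
  \<partial>_b f, differentiating the coordinate x_c contributes -\<integral> (\<partial>_b f)^2 for
  c = b only, while the remaining term is the dilation identity for \<partial>_b f and contributes
  half of \<integral> (\<partial>_b f)^2 for each c. Summation over c gives the factor n/2 -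
  1.\<close>

lemma integral_laplacian_radial_derivative:
  fixes f :: "'a::euclidean_space \<Rightarrow> real"
  assumes f: "test_function f"
  shows "(LINT x|lebesgue. laplacian f x * (grad f x \<bullet> x))
    = (real DIM('a) - 2) / 2 * (LINT x|lebesgue. (norm (grad f x))\<^sup>2)"
proof -
  note s = test_function_smooth[OF f]
  note intros = test_function_integrable test_function_mult test_function_partial[OF f]
    smooth_mult smooth_inner smooth_partial s
  have inner: "(LINT x|lebesgue. partial b (partial b f) x * ((x \<bullet> c) * partial c f x))
      = - (b \<bullet> c) * (LINT x|lebesgue. (partial b f x)\<^sup>2) + (LINT x|lebesgue. (partial b f x)\<^sup>2) / 2"
    if b: "b \<in> Basis" and c: "c \<in> Basis" for b c
  proof -
    \<comment> \<open>Symmetry of second derivatives turns the last term into a radial term of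
      \<open>partial b f\<close>.\<close>
    have p: "partial b (\<lambda>x. (x \<bullet> c) * partial c f x) x
        = (b \<bullet> c) * partial b f x + (x \<bullet> c) * partial c (partial b f) x" for x
      using s b c by (auto simp: partial_mult smooth_differentiable smooth_inner smooth_partial
          partial_inner partial_commute[of f b c] inner_Basis)
    have "(LINT x|lebesgue. partial b (partial b f) x * ((x \<bullet> c) * partial c f x))
      = - (LINT x|lebesgue. partial b f x * partial b (\<lambda>x. (x \<bullet> c) * partial c f x) x)"
      using b c by (intro integral_by_parts intros)
    also have "\<dots> = - (LINT x|lebesgue. (b \<bullet> c) * (partial b f x * partial b f x)
        + partial b f x * ((x \<bullet> c) * partial c (partial b f) x))"
      by (simp add: p algebra_simps)
    also have "\<dots> = - ((b \<bullet> c) * (LINT x|lebesgue. partial b f x * partial b f x)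
        + (LINT x|lebesgue. partial b f x * ((x \<bullet> c) * partial c (partial b f) x)))"
      using b c by (subst Bochner_Integration.integral_add) (auto intro!: intros integrable_mult_right)
    also have "(LINT x|lebesgue. partial b f x * ((x \<bullet> c) * partial c (partial b f) x))
        = - (LINT x|lebesgue. (partial b f x)\<^sup>2) / 2"
      using integral_dilation[OF test_function_partial[OF f b] c] by (simp add: mult_ac)
    finally show ?thesis by (simp add: power2_eq_square)
  qed
  have "(LINT x|lebesgue. laplacian f x * (grad f x \<bullet> x))
      = (LINT x|lebesgue. (\<Sum>b\<in>Basis. \<Sum>c\<in>Basis. partial b (partial b f) x * ((x \<bullet> c) * partial c f x)))"
    by (simp add: laplacian_def grad_inner_sum sum_product mult_ac)
  also have "\<dots> = (\<Sum>b\<in>Basis. \<Sum>c\<in>Basis. LINT x|lebesgue. partial b (partial b f) x * ((x \<bullet> c) * partial c f x))"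
    by (subst Bochner_Integration.integral_sum; (intro sum.cong Bochner_Integration.integrable_sum refl Bochner_Integration.integral_sum)?)
      (auto intro!: test_function_integrable test_function_mult test_function_partial f smooth_mult smooth_inner smooth_partial s)
  also have "\<dots> = (\<Sum>b\<in>Basis. \<Sum>c\<in>Basis. - (b \<bullet> c) * (LINT x|lebesgue. (partial b f x)\<^sup>2)
      + (LINT x|lebesgue. (partial b f x)\<^sup>2) / 2)"
    by (intro sum.cong refl inner)
  also have "\<dots> = (\<Sum>b\<in>Basis. (real DIM('a) / 2 - 1) * (LINT x|lebesgue. (partial b f x)\<^sup>2))"
  proof (intro sum.cong refl)
    fix b :: 'a assume b: "b \<in> Basis"
    let ?I = "LINT x|lebesgue. (partial b f x)\<^sup>2"
    have "(\<Sum>c\<in>Basis. - (b \<bullet> c) * ?I + ?I / 2) = - (\<Sum>c\<in>Basis. b \<bullet> c) * ?I + real DIM('a) * (?I / 2)"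
      by (simp add: sum_subtractf sum_distrib_right)
    also have "(\<Sum>c\<in>Basis. b \<bullet> c) = 1"
      using b by (simp add: inner_Basis)
    finally show "(\<Sum>c\<in>Basis. - (b \<bullet> c) * ?I + ?I / 2) = (real DIM('a) / 2 - 1) * ?I"
      by (simp add: algebra_simps)
  qed
  also have "\<dots> = (real DIM('a) / 2 - 1) * (\<Sum>b\<in>Basis. LINT x|lebesgue. (partial b f x)\<^sup>2)"
    by (rule sum_distrib_left[symmetric])
  also have "(\<Sum>b\<in>Basis. LINT x|lebesgue. (partial b f x)\<^sup>2) = (LINT x|lebesgue. (\<Sum>b\<in>Basis. (partial b f x)\<^sup>2))"
    using L2_integrable[OF test_function_L2[OF test_function_partial[OF f]]]
    by (rule Bochner_Integration.integral_sum[symmetric])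
  finally show ?thesis
    by (simp add: norm_grad diff_divide_distrib)
qed

section \<open>Bump functions and the fundamental lemma of the calculus of variations\<close>

text \<open>All derivatives of \<open>exp (-1/t)\<close> have the form \<open>p (1/t) exp (-1/t)\<close> with a
  polynomial \<open>p\<close>.\<close>

definition flat :: "real poly \<Rightarrow> real \<Rightarrow> real" where
  "flat p t = (if t > 0 then poly p (1 / t) * exp (- (1 / t)) else 0)"

lemma poly_exp_tendsto_0: "((\<lambda>y. poly p y * exp (- y)) \<longlongrightarrow> (0::real)) at_top"
proof -
  have "((\<lambda>y. \<Sum>i\<le>degree p. coeff p i * (y ^ i / exp y)) \<longlongrightarrow> (\<Sum>i\<le>degree p. coeff p i * 0)) at_top"
    by (intro tendsto_intros tendsto_power_div_exp_0)
  then show ?thesis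
    by (simp add: poly_altdef sum_divide_distrib exp_minus field_simps)
qed

lemma flat_tendsto_0: "(flat p \<longlongrightarrow> 0) (at 0)"
proof -
  have "((\<lambda>t. poly p (inverse t) * exp (- inverse t)) \<longlongrightarrow> 0) (at_right (0::real))"
    by (rule filterlim_compose[OF poly_exp_tendsto_0 filterlim_inverse_at_top_right])
  moreover have "\<forall>\<^sub>F t in at_right 0. poly p (inverse t) * exp (- inverse t) = flat p t"
    using eventually_at_right_less by eventually_elim (simp add: flat_def inverse_eq_divide)
  ultimately have "(flat p \<longlongrightarrow> 0) (at_right 0)"
    by (rule Lim_transform_eventually)
  moreover have "(flat p \<longlongrightarrow> 0) (at_left 0)"
    using eventually_at_left_real[of "-1" "0::real"] by (intro tendsto_eventually) (auto elim: eventually_mono simp: flat_def)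
  ultimately show ?thesis
    by (simp add: filterlim_split_at_real)
qed

text \<open>With y = 1/t the chain rule gives y^2 (p - p')(y) exp(-y), and
  \<open>[:0, 0, 1:]\<close> is the polynomial y^2.\<close>

lemma flat_DERIV: "(flat p has_real_derivative flat ([:0, 0, 1:] * (p - pderiv p)) t) (at t)"
proof -
  consider "t > 0" | "t < 0" | "t = 0" by linarith
  then show ?thesis
  proof cases
    case 1
    have "((\<lambda>t. poly p (1 / t) * exp (- (1 / t))) has_real_derivative
        flat ([:0, 0, 1:] * (p - pderiv p)) t) (at t)"
      using 1 by (auto intro!: derivative_eq_intros DERIV_chain2[OF poly_DERIV]
          simp: flat_def field_simps power2_eq_square)
    moreover have "\<forall>\<^sub>F s in nhds t. poly p (1 / s) * exp (- (1 / s)) = flat p s"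
      using eventually_nhds_in_open[of "{0<..}" t] 1 by (auto elim!: eventually_mono simp: flat_def)
    ultimately show ?thesis
      by (rule iffD1[OF DERIV_cong_ev[OF refl _ refl], rotated])
  next
    case 2
    have "((\<lambda>t. 0) has_real_derivative flat ([:0, 0, 1:] * (p - pderiv p)) t) (at t)"
      using 2 by (simp add: flat_def)
    moreover have "\<forall>\<^sub>F s in nhds t. 0 = flat p s"
      using eventually_nhds_in_open[of "{..<0}" t] 2 by (auto elim!: eventually_mono simp: flat_def)
    ultimately show ?thesis
      by (rule iffD1[OF DERIV_cong_ev[OF refl _ refl], rotated])
  next
    case 3
    \<comment> \<open>At 0 the difference quotient has an additional factor 1/h, that is, one more
      power of y, so its limit is again that of a flat function.\<close>
    have "(\<lambda>h. (flat p (0 + h) - flat p 0) / h) = flat ([:0, 1:] * p)"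
      by (auto simp: fun_eq_iff flat_def field_simps)
    then show ?thesis
      using 3 flat_tendsto_0[of "[:0, 1:] * p"] by (simp add: DERIV_def flat_def)
  qed
qed

text \<open>The induction treats all polynomials at once because differentiation changes p.\<close>

lemma smooth_flat: "smooth (flat p)"
proof -
  have "C_k k (flat p)" for k
  proof (induction k arbitrary: p)
    case 0
    have "isCont (flat p) t" for t
      using flat_DERIV by (rule DERIV_isCont)
    then show ?case by (simp add: continuous_on_eq_continuous_at)
  next
    case (Suc k)
    have d: "(flat p has_derivative (\<lambda>h. h * flat ([:0, 0, 1:] * (p - pderiv p)) t)) (at t)" for t
      using flat_DERIV[of p t] by (simp add: has_field_derivative_def mult_commute_abs)
    have "partial 1 (flat p) = flat ([:0, 0, 1:] * (p - pderiv p))"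
      by (rule ext) (simp add: partial_eqI[OF d])
    moreover have "flat p differentiable (at t)" for t
      using d by (auto simp: differentiable_def)
    ultimately show ?case using Suc.IH by simp
  qed
  then show ?thesis by (simp add: smooth_def)
qed

section \<open>Smooth approximation of the indicator of a box\<close>

definition step :: "real \<Rightarrow> real" where
  "step = flat 1"

lemma smooth_step: "smooth step"
  by (simp add: step_def smooth_flat)

lemma step_eq: "step t = (if t > 0 then exp (- (1 / t)) else 0)"
  by (simp add: step_def flat_def)

lemma step_bounds: "0 \<le> step t" "step t \<le> 1"
  by (auto simp: step_eq)

lemma step_tendsto: "(\<lambda>k. step (real k * t)) \<longlonglongrightarrow> (if t > 0 then 1 else 0)"
proof (cases "t > 0")
  case True
  have "(\<lambda>k. exp (- (inverse (real (Suc k)) * inverse t))) \<longlonglongrightarrow> exp (- (0 * inverse t))"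
    by (intro tendsto_intros LIMSEQ_inverse_real_of_nat)
  moreover have "step (real (Suc k) * t) = exp (- (inverse (real (Suc k)) * inverse t))" for k
    using True mult_pos_pos[of "real (Suc k)" t] by (simp only: step_eq if_True of_nat_0_less_iff zero_less_Suc
        inverse_eq_divide[symmetric] inverse_mult_distrib)
  ultimately have "(\<lambda>k. step (real (Suc k) * t)) \<longlonglongrightarrow> 1"
    by simp
  with True show ?thesis
    by (simp only: filterlim_sequentially_Suc[of "\<lambda>k. step (real k * t)"] if_True)
next
  case False
  then have "step (real k * t) = 0" for k
    by (auto simp: step_eq zero_less_mult_iff)
  with False show ?thesis by simp
qed

text \<open>One factor for each face, vanishing beyond that face. Enlarging \<open>k\<close>
  sharpens the transition inside the box, so that the bumps tend to the indicator of the open box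
  while staying below it.\<close>

definition box_bump :: "'a::euclidean_space \<Rightarrow> 'a \<Rightarrow> nat \<Rightarrow> 'a \<Rightarrow> real" where
  "box_bump l u k x =
    (\<Prod>b\<in>Basis. step (real k * (x \<bullet> b - l \<bullet> b)) * step (real k * (u \<bullet> b - x \<bullet> b)))"

lemma box_bump_nonzero: "box_bump l u k x \<noteq> 0 \<Longrightarrow> x \<in> box l u"
  by (auto simp: box_bump_def mem_box step_eq zero_less_mult_iff split: if_splits)

lemma test_function_box_bump: "test_function (box_bump l u k)"
proof -
  have "smooth (\<lambda>x. step (real k * (x \<bullet> b - l \<bullet> b)))" for b :: 'a
    by (rule smooth_compose[OF smooth_step]) (intro smooth_cmult smooth_diff smooth_inner smooth_const)
  moreover have "smooth (\<lambda>x. step (real k * (u \<bullet> b - x \<bullet> b)))" for b :: 'a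
    by (rule smooth_compose[OF smooth_step]) (intro smooth_cmult smooth_diff smooth_inner smooth_const)
  ultimately have "smooth (box_bump l u k)"
    unfolding box_bump_def by (intro smooth_prod smooth_mult)
  moreover have "bounded {x. box_bump l u k x \<noteq> 0}"
    by (rule bounded_subset[OF bounded_box[of l u]]) (auto dest: box_bump_nonzero)
  ultimately show ?thesis by (simp add: test_function_iff)
qed

lemma box_bump_bounds: "0 \<le> box_bump l u k x" "box_bump l u k x \<le> indicator (box l u) x"
proof -
  show *: "0 \<le> box_bump l u k x"
    unfolding box_bump_def by (intro prod_nonneg mult_nonneg_nonneg step_bounds ballI)
  have "box_bump l u k x \<le> 1"
    unfolding box_bump_def by (intro prod_le_1 conjI mult_nonneg_nonneg mult_le_one step_bounds)
  then show "box_bump l u k x \<le> indicator (box l u) x"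
    using box_bump_nonzero[of l u k x] by (cases "box_bump l u k x = 0") auto
qed

lemma box_bump_tendsto: "(\<lambda>k. box_bump l u k x) \<longlonglongrightarrow> indicator (box l u) x"
proof -
  have "(\<lambda>k. box_bump l u k x) \<longlonglongrightarrow> (\<Prod>b\<in>Basis.
      (if x \<bullet> b - l \<bullet> b > 0 then 1 else 0) * (if u \<bullet> b - x \<bullet> b > 0 then 1 else 0))"
    unfolding box_bump_def by (intro tendsto_prod tendsto_mult step_tendsto)
  also have "(\<Prod>b\<in>Basis. (if x \<bullet> b - l \<bullet> b > 0 then 1 else 0) *
      (if u \<bullet> b - x \<bullet> b > 0 then 1 else (0::real))) = indicator (box l u) x"
    by (auto simp: indicator_def mem_box intro!: prod.neutral prod_zero)
  finally show ?thesis .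
qed

section \<open>Functions whose integrals against all test functions vanish\<close>

lemma locally_integrableD_box:
  fixes g :: "'a::euclidean_space \<Rightarrow> 'b::{banach,second_countable_topology}"
  assumes "locally_integrable g"
  shows "integrable lebesgue (\<lambda>x. indicator (box l u) x *\<^sub>R g x)"
proof -
  have "set_integrable lebesgue (cbox l u) g"
    using assms by (simp add: locally_integrable_def)
  then have "set_integrable lebesgue (box l u) g"
    by (rule set_integrable_subset) (auto simp: box_subset_cbox)
  then show ?thesis by (simp add: set_integrable_def)
qed

text \<open>Local integrability speaks only of products with indicators of compact sets;
  \<open>g\<close> is the pointwise limit of its restrictions to growing cubes.\<close>

lemma locally_integrable_measurable:
  fixes g :: "'a::euclidean_space \<Rightarrow> 'b::{banach,second_countable_topology}"
  assumes "locally_integrable g"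
  shows "g \<in> borel_measurable lebesgue"
proof (rule borel_measurable_LIMSEQ_metric)
  let ?B = "\<lambda>k. box (- (real k *\<^sub>R One)) (real k *\<^sub>R One) :: 'a set"
  show "(\<lambda>x. indicator (?B k) x *\<^sub>R g x) \<in> borel_measurable lebesgue" for k
    by (rule borel_measurable_integrable[OF locally_integrableD_box[OF assms]])
  fix x :: 'a
  obtain N where N: "x \<in> ?B N"
    using UN_box_eq_UNIV by blast
  have "\<forall>\<^sub>F k in sequentially. indicator (?B k) x *\<^sub>R g x = g x"
    using eventually_ge_at_top[of N]
  proof eventually_elim
    case (elim k)
    have "x \<in> ?B k"
      using N elim by (force simp: mem_box)
    then show ?case by simp
  qed
  then show "(\<lambda>k. indicator (?B k) x *\<^sub>R g x) \<longlonglongrightarrow> g x"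
    by (rule tendsto_eventually)
qed

text \<open>The sets over which g has integral zero form a Dynkin system containing the boxes, an
  intersection-stable generator, hence all Borel sets. Closure under complements uses the integral
  over the whole space, obtained as a limit over growing cubes.\<close>

lemma borel_AE_zero_of_box_integrals:
  fixes g :: "'a::euclidean_space \<Rightarrow> real"
  assumes g: "integrable lborel g" and zero: "\<And>l u. (LINT x:box l u|lborel. g x) = 0"
  shows "AE x in lborel. g x = 0"
proof (rule sigma_finite_measure.density_zero[OF sigma_finite_lborel g])
  have UNIV_zero: "(LINT x|lborel. g x) = 0"
  proof -
    let ?B = "\<lambda>k. box (- (real k *\<^sub>R One)) (real k *\<^sub>R One) :: 'a set"
    have "(\<lambda>k. LINT x:?B k|lborel. g x) \<longlonglongrightarrow> (LINT x:(\<Union>k. ?B k)|lborel. g x)"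
    proof (rule set_integral_cont_up)
      show "incseq ?B"
        by (force simp: incseq_def mem_box)
      show "set_integrable lborel (\<Union>k. ?B k) g"
        using g by (simp add: UN_box_eq_UNIV set_integrable_def)
    qed auto
    then have "(\<lambda>k. 0::real) \<longlonglongrightarrow> (LINT x|lborel. g x)"
      by (simp only: zero UN_box_eq_UNIV) (simp add: set_lebesgue_integral_def)
    from LIMSEQ_unique[OF tendsto_const this] show ?thesis by simp
  qed
  have si: "set_integrable lborel A g" if "A \<in> sets borel" for A
    unfolding set_integrable_def using that by (intro integrable_mult_indicator g) simp
  fix A :: "'a set" assume "A \<in> sets lborel"
  then have A: "A \<in> sigma_sets UNIV (range (\<lambda>(a, b). box a b))"
    by (simp add: borel_eq_box)
  have G: "Int_stable (range (\<lambda>(a, b). box a b) :: 'a set set)"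
      "(range (\<lambda>(a, b). box a b) :: 'a set set) \<subseteq> Pow UNIV"
    by (auto simp: Int_stable_def box_Int_box)
  have sets: "sigma_sets UNIV (range (\<lambda>(a, b). box a b)) = (sets borel :: 'a set set)"
    by (simp add: borel_eq_box)
  from G A show "(LINT x:A|lborel. g x) = 0"
  proof (induction rule: sigma_sets_induct_disjoint)
    case (compl A)
    then have A: "A \<in> sets borel" using sets by auto
    have "(LINT x:UNIV - A|lborel. g x) + (LINT x:A|lborel. g x) = (LINT x:(UNIV - A) \<union> A|lborel. g x)"
      using A by (intro set_integral_Un[symmetric] si) auto
    also have "\<dots> = 0" using UNIV_zero by (simp add: set_lebesgue_integral_def)
    finally show ?case using compl by simp
  next
    case (union A)
    then have A: "A i \<in> sets borel" for i using sets by auto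
    have "(LINT x:(\<Union>i. A i)|lborel. g x) = (\<Sum>i. LINT x:A i|lborel. g x)"
      using A union(1) by (intro lebesgue_integral_countable_add si) (auto simp: disjoint_family_on_def)
    then show ?case using union by simp
  qed (use zero in \<open>auto simp: set_lebesgue_integral_def\<close>)
qed

text \<open>Bumps tend to the indicator of a box under the majorant |g| on that box, so integrals
  over boxes vanish. The argument over Borel sets requires a globally integrable Borel function;
  hence the passage to a Borel version \<open>h\<close> and to its restrictions to cubes, where a
  box meets a cube in a box.\<close>

lemma AE_zero_of_test_integrals:
  fixes g :: "'a::euclidean_space \<Rightarrow> real"
  assumes g: "locally_integrable g"
    and zero: "\<And>\<psi>. test_function \<psi> \<Longrightarrow> (LINT x|lebesgue. \<psi> x * g x) = 0"
  shows "AE x in lebesgue. g x = 0"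
proof -
  have box_zero: "(LINT x|lebesgue. indicator (box l u) x *\<^sub>R g x) = 0" for l u
  proof -
    have "(\<lambda>k. LINT x|lebesgue. box_bump l u k x * g x) \<longlonglongrightarrow> (LINT x|lebesgue. indicator (box l u) x *\<^sub>R g x)"
    proof (rule integral_dominated_convergence)
      show "(\<lambda>x. indicator (box l u) x *\<^sub>R g x) \<in> borel_measurable lebesgue"
        by (rule borel_measurable_integrable[OF locally_integrableD_box[OF g]])
      show "(\<lambda>x. box_bump l u k x * g x) \<in> borel_measurable lebesgue" for k
        by (intro borel_measurable_times locally_integrable_measurable g smooth_measurable
            test_function_smooth test_function_box_bump)
      show "integrable lebesgue (\<lambda>x. \<bar>indicator (box l u) x *\<^sub>R g x\<bar>)"
        by (intro integrable_abs locally_integrableD_box g)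
      show "AE x in lebesgue. (\<lambda>k. box_bump l u k x * g x) \<longlonglongrightarrow> indicator (box l u) x *\<^sub>R g x"
        by (intro AE_I2) (simp add: tendsto_mult_right box_bump_tendsto)
      show "AE x in lebesgue. norm (box_bump l u k x * g x) \<le> \<bar>indicator (box l u) x *\<^sub>R g x\<bar>" for k
        using box_bump_bounds[of l u k] by (auto simp: abs_mult intro!: mult_right_mono)
    qed
    then have "(\<lambda>k. 0::real) \<longlonglongrightarrow> (LINT x|lebesgue. indicator (box l u) x *\<^sub>R g x)"
      by (simp add: zero test_function_box_bump)
    from LIMSEQ_unique[OF tendsto_const this] show ?thesis by simp
  qed
  obtain h where [measurable]: "h \<in> borel_measurable lborel" and gh: "AE x in lborel. g x = h x"
    using completion_ex_borel_measurable_real[OF locally_integrable_measurable[OF g]] by auto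
  note gh' = AE_completion[OF gh]
  let ?B = "\<lambda>k. box (- (real k *\<^sub>R One)) (real k *\<^sub>R One) :: 'a set"
  have "AE x in lborel. indicator (?B k) x * h x = 0" for k
  proof (rule borel_AE_zero_of_box_integrals)
    have [measurable]: "h \<in> borel_measurable lebesgue"
      by (rule measurable_completion) simp
    have eq: "AE x in lebesgue. indicator (box l u) x * h x = indicator (box l u) x *\<^sub>R g x" for l u :: 'a
      using gh' by eventually_elim simp
    have meas: "(\<lambda>x. indicator (box l u) x * h x) \<in> borel_measurable lebesgue" for l u
      by (intro borel_measurable_times borel_measurable_indicator) simp_all
    have "AE x in lebesgue. indicator (?B k) x *\<^sub>R g x = indicator (?B k) x * h x"
      using gh' by eventually_elim simp
    then have "integrable lebesgue (\<lambda>x. indicator (?B k) x * h x)"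
      by (rule integrable_cong_AE_imp[OF locally_integrableD_box[OF g] meas])
    then show "integrable lborel (\<lambda>x. indicator (?B k) x * h x)"
      by (simp add: integrable_completion)
    fix l u :: 'a
    obtain l' u' where lu: "box l u \<inter> ?B k = box l' u'"
      unfolding box_Int_box by blast
    have "(LINT x:box l u|lborel. indicator (?B k) x * h x) = (LINT x|lborel. indicator (box l' u') x * h x)"
      unfolding set_lebesgue_integral_def
      by (simp add: lu[symmetric] indicator_inter_arith mult.assoc)
    also have "\<dots> = (LINT x|lebesgue. indicator (box l' u') x * h x)"
      by (simp add: integral_completion)
    also have "\<dots> = (LINT x|lebesgue. indicator (box l' u') x *\<^sub>R g x)"
      by (rule integral_cong_AE[OF meas borel_measurable_integrable[OF locally_integrableD_box[OF g]] eq])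
    finally show "(LINT x:box l u|lborel. indicator (?B k) x * h x) = 0"
      by (simp only: box_zero)
  qed
  then have "AE x in lborel. \<forall>k. indicator (?B k) x * h x = 0"
    unfolding AE_all_countable by blast
  then have "AE x in lborel. h x = 0"
  proof eventually_elim
    case (elim x)
    obtain N where "x \<in> ?B N"
      using UN_box_eq_UNIV by blast
    with spec[OF elim, of N] show ?case by simp
  qed
  from AE_completion[OF this] gh' show ?thesis
    by eventually_elim simp
qed

section \<open>Limits of norm-Cauchy sequences\<close>

lemma continuous_lebesgue_measurable:
  "continuous_on UNIV f \<Longrightarrow> f \<in> borel_measurable (lebesgue :: 'a::euclidean_space measure)"
  by (intro measurable_completion) (simp add: borel_measurable_continuous_onI)

lemma lebesgue_measurable_ident: "(\<lambda>x. x) \<in> borel_measurable (lebesgue :: 'a::euclidean_space measure)"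
  by (intro continuous_lebesgue_measurable continuous_intros)

lemma partial_diff:
  assumes "smooth f" "smooth g"
  shows "partial b (\<lambda>x. f x - g x) = (\<lambda>x. partial b f x - partial b g x)"
proof
  fix x
  have "(f has_derivative frechet_derivative f (at x)) (at x)" "(g has_derivative frechet_derivative g (at x)) (at x)"
    using assms by (simp_all add: frechet_derivative_works[symmetric] smooth_differentiable)
  from partial_eqI[OF has_derivative_diff[OF this]]
  show "partial b (\<lambda>x. f x - g x) x = partial b f x - partial b g x"
    by (simp add: partial_def)
qed

lemma laplacian_diff:
  assumes "smooth f" "smooth g"
  shows "laplacian (\<lambda>x. f x - g x) x = laplacian f x - laplacian g x"
  unfolding laplacian_def using assms
  by (simp add: partial_diff smooth_partial sum_subtractf)

lemma test_function_sqr_integral_le: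
  assumes f: "test_function f" and w: "smooth w" "\<And>x. 0 \<le> w x"
  shows "integrable lebesgue (\<lambda>x. w x * (norm (grad f x))\<^sup>2)"
    and "b \<in> Basis \<Longrightarrow> (LINT x|lebesgue. w x * (partial b f x)\<^sup>2) \<le> (LINT x|lebesgue. w x * (norm (grad f x))\<^sup>2)"
    and "b \<in> Basis \<Longrightarrow> integrable lebesgue (\<lambda>x. w x * (partial b f x)\<^sup>2)"
proof -
  have i: "integrable lebesgue (\<lambda>x. w x * (partial b f x)\<^sup>2)" if "b \<in> Basis" for b
  proof -
    have "test_function (\<lambda>x. partial b f x * (partial b f x * w x))"
      using that by (intro test_function_mult test_function_partial f smooth_mult w smooth_partial
          test_function_smooth[OF f])
    from test_function_integrable[OF this] show ?thesis
      by (simp add: power2_eq_square mult_ac)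
  qed
  then show g: "integrable lebesgue (\<lambda>x. w x * (norm (grad f x))\<^sup>2)"
    unfolding norm_grad sum_distrib_left by (rule Bochner_Integration.integrable_sum)
  show "integrable lebesgue (\<lambda>x. w x * (partial b f x)\<^sup>2)" if "b \<in> Basis"
    by (rule i[OF that])
  show "(LINT x|lebesgue. w x * (partial b f x)\<^sup>2) \<le> (LINT x|lebesgue. w x * (norm (grad f x))\<^sup>2)"
    if "b \<in> Basis"
    using that w(2) by (intro integral_mono i g mult_left_mono) (auto simp: norm_grad intro: member_le_sum)
qed

lemma test_function_radial_L2:
  assumes "test_function f" shows "L2 lebesgue (\<lambda>x. grad f x \<bullet> x)"
  unfolding grad_inner_sum
  by (intro L2_sum test_function_L2 test_function_mult test_function_partial assms smooth_inner)

section \<open>Quantities controlled by the norm\<close>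

lemma H2_norm_square:
  "(H2_norm f)\<^sup>2 = (LINT x|lebesgue. (laplacian f x)\<^sup>2) + (LINT x|lebesgue. (norm x)\<^sup>2 * (norm (grad f x))\<^sup>2)"
proof -
  have "0 \<le> (LINT x|lebesgue. (laplacian f x)\<^sup>2) + (LINT x|lebesgue. (norm (grad f x))\<^sup>2 * (norm x)\<^sup>2)"
    by (intro add_nonneg_nonneg integral_nonneg_AE) auto
  then show ?thesis
    by (simp add: H2_norm_def mult.commute)
qed

lemma H2_norm_laplacian: "(LINT x|lebesgue. (laplacian f x)\<^sup>2) \<le> (H2_norm f)\<^sup>2"
  and H2_norm_weighted_grad: "(LINT x|lebesgue. (norm x)\<^sup>2 * (norm (grad f x))\<^sup>2) \<le> (H2_norm f)\<^sup>2"
  by (simp_all add: H2_norm_square)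

text \<open>Cauchy-Schwarz in the identity for \<integral> f (x \<cdot> \<nabla>f), followed by
  cancelling \<integral> f^2. The constant 4 is (2/n)^2 at n = 1 and dominates (2/n)^2 in every
  dimension, which keeps the later estimates free of n.\<close>

lemma Hardy_test_function:
  fixes f :: "'a::euclidean_space \<Rightarrow> real"
  assumes f: "test_function f"
  shows "(LINT x|lebesgue. (f x)\<^sup>2) \<le> 4 * (LINT x|lebesgue. (grad f x \<bullet> x)\<^sup>2)"
proof -
  let ?A = "LINT x|lebesgue. (f x)\<^sup>2" and ?B = "LINT x|lebesgue. (grad f x \<bullet> x)\<^sup>2"
  have n: "1 \<le> real DIM('a)" using DIM_positive[where 'a = 'a] by linarith
  have "((real DIM('a) / 2) * ?A)\<^sup>2 \<le> ?A * ?B"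
    using L2_Cauchy_Schwarz[OF test_function_L2[OF f] test_function_radial_L2[OF f]]
    by (simp add: integral_mult_radial_derivative[OF f])
  moreover have "(1 / 2 * ?A)\<^sup>2 \<le> ((real DIM('a) / 2) * ?A)\<^sup>2"
    using n by (intro power_mono mult_right_mono) auto
  ultimately have "?A * ?A \<le> ?A * (4 * ?B)"
    by (simp add: power2_eq_square)
  moreover have "0 \<le> ?A" "0 \<le> ?B" by simp_all
  ultimately show ?thesis
    by (cases "?A = 0") (auto simp: mult_le_cancel_left)
qed

lemma H2_norm_function:
  assumes f: "test_function f" shows "(LINT x|lebesgue. (f x)\<^sup>2) \<le> 4 * (H2_norm f)\<^sup>2"
proof -
  have "(LINT x|lebesgue. (grad f x \<bullet> x)\<^sup>2) \<le> (LINT x|lebesgue. (norm x)\<^sup>2 * (norm (grad f x))\<^sup>2)"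
  proof (rule integral_mono)
    show "integrable lebesgue (\<lambda>x. (grad f x \<bullet> x)\<^sup>2)"
      using test_function_radial_L2[OF f] by (rule L2_integrable)
    show "integrable lebesgue (\<lambda>x. (norm x)\<^sup>2 * (norm (grad f x))\<^sup>2)"
      by (intro test_function_sqr_integral_le f smooth_norm_square) simp
    show "(grad f x \<bullet> x)\<^sup>2 \<le> (norm x)\<^sup>2 * (norm (grad f x))\<^sup>2" for x
      using Cauchy_Schwarz_ineq[of "grad f x" x] by (simp add: power2_norm_eq_inner mult.commute)
  qed
  then show ?thesis
    using Hardy_test_function[OF f] H2_norm_weighted_grad[of f] by linarith
qed

text \<open>The weight |x|^2 degenerates at the origin, so the unweighted gradient is reached
  through \<integral> f \<Delta>f; the factor 2 is the square root of the Hardy constant 4.\<close>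

lemma H2_norm_grad:
  assumes f: "test_function f" shows "(LINT x|lebesgue. (norm (grad f x))\<^sup>2) \<le> 2 * (H2_norm f)\<^sup>2"
proof (rule power2_le_imp_le)
  have "(LINT x|lebesgue. (norm (grad f x))\<^sup>2)\<^sup>2 = (LINT x|lebesgue. f x * laplacian f x)\<^sup>2"
    using integral_mult_laplacian[OF f test_function_smooth[OF f]] by (simp add: power2_norm_eq_inner)
  also have "\<dots> \<le> (LINT x|lebesgue. (f x)\<^sup>2) * (LINT x|lebesgue. (laplacian f x)\<^sup>2)"
    by (intro L2_Cauchy_Schwarz test_function_L2 test_function_laplacian f)
  also have "\<dots> \<le> (4 * (H2_norm f)\<^sup>2) * (H2_norm f)\<^sup>2"
    by (intro mult_mono H2_norm_function H2_norm_laplacian f) auto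
  finally show "(LINT x|lebesgue. (norm (grad f x))\<^sup>2)\<^sup>2 \<le> (2 * (H2_norm f)\<^sup>2)\<^sup>2"
    by (simp add: power2_eq_square)
qed simp

text \<open>The completeness argument shared by the identity, the Laplacian and the weighted partial
  derivatives in the role of \<open>T\<close>. Compatibility with differences turns the bound by the
  norm into the Cauchy property in L2.\<close>

lemma H2_Cauchy_L2_limit:
  assumes \<phi>: "H2_Cauchy \<phi>"
    and L: "\<And>f. test_function f \<Longrightarrow> L2 lebesgue (T f)"
    and le: "\<And>f. test_function f \<Longrightarrow> (LINT x|lebesgue. (T f x)\<^sup>2) \<le> C * (H2_norm f)\<^sup>2"
    and diff: "\<And>f g x. test_function f \<Longrightarrow> test_function g \<Longrightarrow> T (\<lambda>x. f x - g x) x = T f x - T g x"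
    and C: "C > 0"
  shows "\<exists>F. L2_tendsto lebesgue (\<lambda>k. T (\<phi> k)) F"
proof (rule L2_complete)
  have t: "test_function (\<phi> k)" for k
    using \<phi> by (simp add: H2_Cauchy_def)
  then show "L2 lebesgue (T (\<phi> k))" for k
    by (rule L)
  fix e :: real assume e: "e > 0"
  then have "sqrt (e / C) > 0" using C by simp
  then obtain N where N: "\<And>j k. j \<ge> N \<Longrightarrow> k \<ge> N \<Longrightarrow> H2_norm (\<lambda>x. \<phi> j x - \<phi> k x) < sqrt (e / C)"
    using \<phi> unfolding H2_Cauchy_def by blast
  have "(LINT x|lebesgue. (T (\<phi> j) x - T (\<phi> k) x)\<^sup>2) < e" if "j \<ge> N" "k \<ge> N" for j k
  proof -
    let ?n = "H2_norm (\<lambda>x. \<phi> j x - \<phi> k x)"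
    have "0 \<le> ?n"
      by (simp add: H2_norm_def add_nonneg_nonneg)
    then have "?n\<^sup>2 < (sqrt (e / C))\<^sup>2"
      using N[OF that] by (intro power_strict_mono) auto
    then have "C * ?n\<^sup>2 < e"
      using C e by (simp add: field_simps)
    moreover have "(LINT x|lebesgue. (T (\<phi> j) x - T (\<phi> k) x)\<^sup>2) \<le> C * ?n\<^sup>2"
      using le[OF test_function_diff[OF t t]] by (simp add: diff[OF t t])
    ultimately show ?thesis by linarith
  qed
  then show "\<exists>N. \<forall>j\<ge>N. \<forall>k\<ge>N. (LINT x|lebesgue. (T (\<phi> j) x - T (\<phi> k) x)\<^sup>2) < e"
    by blast
qed

text \<open>Convergence of the radial derivative is a clause of its own: because of the unbounded
  factor x it does not follow from that of the components. Using the same \<open>G\<close> in both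
  clauses ties the two limits together.\<close>

definition H2_limit :: "(nat \<Rightarrow> 'a::euclidean_space \<Rightarrow> real) \<Rightarrow> ('a \<Rightarrow> real) \<Rightarrow> ('a \<Rightarrow> 'a) \<Rightarrow> ('a \<Rightarrow> real) \<Rightarrow> bool" where
  "H2_limit \<phi> v G L \<longleftrightarrow> (\<forall>k. test_function (\<phi> k)) \<and> L2_tendsto lebesgue \<phi> v \<and>
    (\<forall>b\<in>Basis. L2_tendsto lebesgue (\<lambda>k. partial b (\<phi> k)) (\<lambda>x. G x \<bullet> b)) \<and>
    L2_tendsto lebesgue (\<lambda>k x. grad (\<phi> k) x \<bullet> x) (\<lambda>x. G x \<bullet> x) \<and>
    L2_tendsto lebesgue (\<lambda>k. laplacian (\<phi> k)) L"

text \<open>The limits of \<open>\<nabla>\<phi>\<close> and of \<open>x \<cdot> \<nabla>\<phi>\<close> are read off the same limit, that of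
  \<open>(1 + |x|\<^sup>2)\<^sup>1\<^sup>/\<^sup>2 \<nabla>\<phi>\<close>, which makes them compatible.\<close>

lemma H2_limitI:
  fixes \<phi> :: "nat \<Rightarrow> 'a::euclidean_space \<Rightarrow> real"
  assumes t: "\<And>k. test_function (\<phi> k)" and v: "L2_tendsto lebesgue \<phi> v"
    and L: "L2_tendsto lebesgue (\<lambda>k. laplacian (\<phi> k)) L"
    and H: "\<And>b. b \<in> Basis \<Longrightarrow> L2_tendsto lebesgue (\<lambda>k x. sqrt (1 + (norm x)\<^sup>2) * partial b (\<phi> k) x) (H b)"
  shows "H2_limit \<phi> v (\<lambda>x. \<Sum>b\<in>Basis. (H b x / sqrt (1 + (norm x)\<^sup>2)) *\<^sub>R b) L"
proof -
  define w :: "'a \<Rightarrow> real" where "w x = sqrt (1 + (norm x)\<^sup>2)" for x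
  define G where "G x = (\<Sum>b\<in>Basis. (H b x / w x) *\<^sub>R b)" for x
  have w: "1 \<le> w x" "norm x \<le> w x" for x
    by (auto simp: w_def intro: real_le_rsqrt)
  have w_pos: "0 < w x" for x using w(1)[of x] by linarith
  have [measurable]: "w \<in> borel_measurable lebesgue"
    unfolding w_def[abs_def] by (intro continuous_lebesgue_measurable continuous_intros)
  have Gb: "G x \<bullet> b = H b x / w x" if "b \<in> Basis" for b x
    using that by (simp add: G_def inner_sum_left inner_Basis if_distrib sum.delta cong: if_cong)
  have H': "L2_tendsto lebesgue (\<lambda>k x. w x * partial b (\<phi> k) x) (H b)" if "b \<in> Basis" for b
    using H[OF that] by (simp add: w_def)
  then have HL: "L2 lebesgue (H b)" "H b \<in> borel_measurable lebesgue" if "b \<in> Basis" for b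
    using that by (auto simp: L2_tendsto_def L2_def)
  \<comment> \<open>A factor a of size at most \<open>w x\<close> is absorbed by the weight. The
    case c = 0 gives square integrability of the limit, the general case gives convergence.\<close>
  have bound: "\<bar>a * (c - h / w x)\<bar> \<le> 1 * \<bar>w x * c - h\<bar>" if "\<bar>a\<bar> \<le> w x" for a c h x
  proof -
    have "\<bar>a * (c - h / w x)\<bar> \<le> w x * \<bar>c - h / w x\<bar>"
      using that by (simp add: abs_mult mult_right_mono)
    also have "\<dots> = \<bar>w x * (c - h / w x)\<bar>" using w_pos[of x] by (simp add: abs_mult)
    also have "w x * (c - h / w x) = w x * c - h" using w_pos[of x] by (simp add: field_simps)
    finally show ?thesis by simp
  qed
  \<comment> \<open>To be used with a = 1 for the gradient and with a coordinate for the radial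
    derivative; both are bounded by \<open>w\<close>.\<close>
  have weighted: "L2_tendsto lebesgue (\<lambda>k x. a x * partial b (\<phi> k) x) (\<lambda>x. a x * (G x \<bullet> b))"
    if b: "b \<in> Basis" and a: "smooth a" "\<And>x. \<bar>a x\<bar> \<le> w x" for a b
  proof (rule L2_tendsto_dominated[OF H'[OF b], of _ _ 1])
    show "L2 lebesgue (\<lambda>x. a x * partial b (\<phi> k) x)" for k
      using test_function_L2[OF test_function_mult[OF test_function_partial[OF t b] a(1)]]
      by (simp add: mult.commute)
    have [measurable]: "a \<in> borel_measurable lebesgue" "H b \<in> borel_measurable lebesgue"
      using a(1) HL[OF b] by (auto intro: smooth_measurable)
    have "(\<lambda>x. a x * (H b x / w x)) \<in> borel_measurable lebesgue"
      by measurable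
    then show "L2 lebesgue (\<lambda>x. a x * (G x \<bullet> b))"
      unfolding Gb[OF b]
    proof (rule L2_dominated[OF HL(1)[OF b]])
      show "\<bar>a x * (H b x / w x)\<bar> \<le> 1 * \<bar>H b x\<bar>" for x
        using bound[OF a(2)[of x], of 0 "H b x"] by simp
    qed
    show "\<bar>a x * partial b (\<phi> k) x - a x * (G x \<bullet> b)\<bar> \<le> 1 * \<bar>w x * partial b (\<phi> k) x - H b x\<bar>" for k x
      using bound[OF a(2)[of x], of "partial b (\<phi> k) x" "H b x"] by (simp add: Gb[OF b] right_diff_distrib)
  qed
  have "L2_tendsto lebesgue (\<lambda>k. partial b (\<phi> k)) (\<lambda>x. G x \<bullet> b)" if "b \<in> Basis" for b
    using weighted[OF that, of "\<lambda>_. 1"] w(1) by (simp add: smooth_const)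
  moreover have "L2_tendsto lebesgue (\<lambda>k x. grad (\<phi> k) x \<bullet> x) (\<lambda>x. G x \<bullet> x)"
  proof -
    have "L2_tendsto lebesgue (\<lambda>k x. \<Sum>b\<in>Basis. (x \<bullet> b) * partial b (\<phi> k) x) (\<lambda>x. \<Sum>b\<in>Basis. (x \<bullet> b) * (G x \<bullet> b))"
      using order_trans[OF Basis_le_norm w(2)] by (intro L2_tendsto_sum weighted smooth_inner) auto
    moreover have "G x \<bullet> x = (\<Sum>b\<in>Basis. (x \<bullet> b) * (G x \<bullet> b))" for x
      by (subst euclidean_inner) (simp add: mult.commute)
    ultimately show ?thesis
      by (simp add: grad_inner_sum mult.commute)
  qed
  ultimately show ?thesis
    using t v L by (simp add: H2_limit_def G_def[abs_def] w_def)
qed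

lemma H2_Cauchy_limit:
  fixes \<phi> :: "nat \<Rightarrow> 'a::euclidean_space \<Rightarrow> real"
  assumes \<phi>: "H2_Cauchy \<phi>"
  shows "\<exists>v G L. H2_limit \<phi> v G L"
proof -
  obtain v where v: "L2_tendsto lebesgue \<phi> v"
    using H2_Cauchy_L2_limit[OF \<phi>, of "\<lambda>f. f" 4] H2_norm_function test_function_L2 by auto
  obtain L where L: "L2_tendsto lebesgue (\<lambda>k. laplacian (\<phi> k)) L"
    using H2_Cauchy_L2_limit[OF \<phi>, of laplacian 1] H2_norm_laplacian
    by (auto simp: laplacian_diff test_function_smooth test_function_L2 test_function_laplacian)
  have "\<exists>H. L2_tendsto lebesgue (\<lambda>k x. sqrt (1 + (norm x)\<^sup>2) * partial b (\<phi> k) x) H"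
    if b: "b \<in> Basis" for b
  proof (rule H2_Cauchy_L2_limit[OF \<phi>, of "\<lambda>f x. sqrt (1 + (norm x)\<^sup>2) * partial b f x" 3])
    fix f :: "'a \<Rightarrow> real" assume f: "test_function f"
    have w: "smooth (\<lambda>x::'a. 1 + (norm x)\<^sup>2)"
      by (intro smooth_add smooth_const smooth_norm_square)
    have eq: "(\<lambda>x. (sqrt (1 + (norm x)\<^sup>2) * partial b f x)\<^sup>2) = (\<lambda>x. (1 + (norm x)\<^sup>2) * (partial b f x)\<^sup>2)"
      by (simp add: power_mult_distrib add_nonneg_nonneg)
    have "(\<lambda>x. sqrt (1 + (norm x)\<^sup>2) * partial b f x) \<in> borel_measurable lebesgue"
      by (intro borel_measurable_times smooth_measurable smooth_partial test_function_smooth f b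
          continuous_lebesgue_measurable continuous_intros)
    then show "L2 lebesgue (\<lambda>x. sqrt (1 + (norm x)\<^sup>2) * partial b f x)"
      unfolding L2_def eq using test_function_sqr_integral_le(3)[OF f w _ b] by simp
    have "(LINT x|lebesgue. (1 + (norm x)\<^sup>2) * (partial b f x)\<^sup>2)
        \<le> (LINT x|lebesgue. (1 + (norm x)\<^sup>2) * (norm (grad f x))\<^sup>2)"
      by (rule test_function_sqr_integral_le(2)[OF f w _ b]) simp
    also have "\<dots> = (LINT x|lebesgue. (norm (grad f x))\<^sup>2) + (LINT x|lebesgue. (norm x)\<^sup>2 * (norm (grad f x))\<^sup>2)"
      using test_function_sqr_integral_le(1)[OF f smooth_norm_square]
        test_function_sqr_integral_le(1)[OF f smooth_const[of 1]]
      by (simp add: distrib_right)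
    \<comment> \<open>The constant 3 is 2 from the unweighted gradient plus 1 from the weighted
      one.\<close>
    also have "\<dots> \<le> 3 * (H2_norm f)\<^sup>2"
      using H2_norm_grad[OF f] H2_norm_weighted_grad[of f] by linarith
    finally show "(LINT x|lebesgue. (sqrt (1 + (norm x)\<^sup>2) * partial b f x)\<^sup>2) \<le> 3 * (H2_norm f)\<^sup>2"
      unfolding eq .
  qed (simp_all add: partial_diff test_function_smooth right_diff_distrib)
  then obtain H where "\<And>b. b \<in> Basis \<Longrightarrow> L2_tendsto lebesgue (\<lambda>k x. sqrt (1 + (norm x)\<^sup>2) * partial b (\<phi> k) x) (H b)"
    by metis
  from H2_limitI[OF _ v L this] \<phi> show ?thesis
    by (auto simp: H2_Cauchy_def)
qed

section \<open>Identities and the inequality for limits of norm-Cauchy sequences\<close>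

context
  fixes \<phi> :: "nat \<Rightarrow> 'a::euclidean_space \<Rightarrow> real" and v G L
  assumes lim: "H2_limit \<phi> v G L"
begin

lemma H2_limit_test: "test_function (\<phi> k)"
  and H2_limit_function: "L2_tendsto lebesgue \<phi> v"
  and H2_limit_partial: "b \<in> Basis \<Longrightarrow> L2_tendsto lebesgue (\<lambda>k. partial b (\<phi> k)) (\<lambda>x. G x \<bullet> b)"
  and H2_limit_radial: "L2_tendsto lebesgue (\<lambda>k x. grad (\<phi> k) x \<bullet> x) (\<lambda>x. G x \<bullet> x)"
  and H2_limit_laplacian: "L2_tendsto lebesgue (\<lambda>k. laplacian (\<phi> k)) L"
  using lim by (auto simp: H2_limit_def)

lemma H2_limit_L2:
  "L2 lebesgue v" "b \<in> Basis \<Longrightarrow> L2 lebesgue (\<lambda>x. G x \<bullet> b)" "L2 lebesgue (\<lambda>x. G x \<bullet> x)" "L2 lebesgue L"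
  using H2_limit_function H2_limit_partial H2_limit_radial H2_limit_laplacian
  by (auto simp: L2_tendsto_def)

lemma H2_limit_norm_grad:
  "integrable lebesgue (\<lambda>x. (norm (G x))\<^sup>2)"
  "(LINT x|lebesgue. (norm (G x))\<^sup>2) = (\<Sum>b\<in>Basis. LINT x|lebesgue. (G x \<bullet> b)\<^sup>2)"
proof -
  have eq: "(norm (G x))\<^sup>2 = (\<Sum>b\<in>Basis. (G x \<bullet> b)\<^sup>2)" for x
    unfolding power2_norm_eq_inner by (subst euclidean_inner) (simp add: power2_eq_square)
  show "integrable lebesgue (\<lambda>x. (norm (G x))\<^sup>2)"
    "(LINT x|lebesgue. (norm (G x))\<^sup>2) = (\<Sum>b\<in>Basis. LINT x|lebesgue. (G x \<bullet> b)\<^sup>2)"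
    unfolding eq using H2_limit_L2(2)
    by (auto intro!: Bochner_Integration.integral_sum Bochner_Integration.integrable_sum L2_integrable)
qed

lemma H2_limit_norm_grad_tendsto:
  "(\<lambda>k. LINT x|lebesgue. (norm (grad (\<phi> k) x))\<^sup>2) \<longlonglongrightarrow> (LINT x|lebesgue. (norm (G x))\<^sup>2)"
proof -
  have "(\<lambda>k. \<Sum>b\<in>Basis. LINT x|lebesgue. partial b (\<phi> k) x * partial b (\<phi> k) x)
      \<longlonglongrightarrow> (\<Sum>b\<in>Basis. LINT x|lebesgue. (G x \<bullet> b) * (G x \<bullet> b))"
    by (intro tendsto_sum L2_tendsto_inner H2_limit_partial)
  moreover have "(LINT x|lebesgue. (norm (grad (\<phi> k) x))\<^sup>2)
      = (\<Sum>b\<in>Basis. LINT x|lebesgue. partial b (\<phi> k) x * partial b (\<phi> k) x)" for k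
    unfolding power2_norm_eq_inner grad_inner_grad
    by (intro Bochner_Integration.integral_sum L2_mult_integrable test_function_L2 test_function_partial H2_limit_test)
  ultimately show ?thesis
    by (simp add: H2_limit_norm_grad(2) power2_eq_square[of "_ \<bullet> _"])
qed

lemma H2_limit_laplacian_radial:
  "(LINT x|lebesgue. L x * (G x \<bullet> x)) = (real DIM('a) - 2) / 2 * (LINT x|lebesgue. (norm (G x))\<^sup>2)"
proof (rule LIMSEQ_unique[OF L2_tendsto_inner[OF H2_limit_laplacian H2_limit_radial]])
  show "(\<lambda>k. LINT x|lebesgue. laplacian (\<phi> k) x * (grad (\<phi> k) x \<bullet> x))
      \<longlonglongrightarrow> (real DIM('a) - 2) / 2 * (LINT x|lebesgue. (norm (G x))\<^sup>2)"
    unfolding integral_laplacian_radial_derivative[OF H2_limit_test]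
    by (intro tendsto_mult tendsto_const H2_limit_norm_grad_tendsto)
qed

lemma H2_limit_laplacian_function:
  "(LINT x|lebesgue. L x * v x) = - (LINT x|lebesgue. (norm (G x))\<^sup>2)"
proof (rule LIMSEQ_unique[OF L2_tendsto_inner[OF H2_limit_laplacian H2_limit_function]])
  show "(\<lambda>k. LINT x|lebesgue. laplacian (\<phi> k) x * \<phi> k x) \<longlonglongrightarrow> - (LINT x|lebesgue. (norm (G x))\<^sup>2)"
    using integral_mult_laplacian[OF H2_limit_test test_function_smooth[OF H2_limit_test]]
      tendsto_minus[OF H2_limit_norm_grad_tendsto]
    by (simp add: power2_norm_eq_inner mult.commute)
qed

lemma H2_limit_function_radial:
  "(LINT x|lebesgue. v x * (G x \<bullet> x)) = - (real DIM('a) / 2) * (LINT x|lebesgue. (v x)\<^sup>2)"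
proof (rule LIMSEQ_unique[OF L2_tendsto_inner[OF H2_limit_function H2_limit_radial]])
  have "(\<lambda>k. LINT x|lebesgue. (\<phi> k x)\<^sup>2) \<longlonglongrightarrow> (LINT x|lebesgue. (v x)\<^sup>2)"
    using L2_tendsto_inner[OF H2_limit_function H2_limit_function] by (simp add: power2_eq_square)
  then show "(\<lambda>k. LINT x|lebesgue. \<phi> k x * (grad (\<phi> k) x \<bullet> x))
      \<longlonglongrightarrow> - (real DIM('a) / 2) * (LINT x|lebesgue. (v x)\<^sup>2)"
    unfolding integral_mult_radial_derivative[OF H2_limit_test] by (intro tendsto_mult tendsto_const)
qed

lemma H2_limit_shifted_L2: "L2 lebesgue (\<lambda>x. G x \<bullet> x + real DIM('a) * v x)"
  by (intro L2_add L2_cmult H2_limit_L2)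

text \<open>The coefficients combine as (n-2)/2 - n = -(n+2)/2.\<close>

lemma H2_limit_laplacian_shifted:
  "(LINT x|lebesgue. L x * (G x \<bullet> x + real DIM('a) * v x))
    = - ((real DIM('a) + 2) / 2) * (LINT x|lebesgue. (norm (G x))\<^sup>2)"
proof -
  have "(LINT x|lebesgue. L x * (G x \<bullet> x + real DIM('a) * v x))
      = (LINT x|lebesgue. L x * (G x \<bullet> x) + real DIM('a) * (L x * v x))"
    by (simp add: algebra_simps)
  also have "\<dots> = (LINT x|lebesgue. L x * (G x \<bullet> x)) + real DIM('a) * (LINT x|lebesgue. L x * v x)"
    using L2_mult_integrable[OF H2_limit_L2(4,3)] L2_mult_integrable[OF H2_limit_L2(4,1)] by simp
  finally show ?thesis
    by (simp add: H2_limit_laplacian_radial H2_limit_laplacian_function field_simps)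
qed

text \<open>The cross term has coefficient 2n (-n/2) = -n^2, which cancels the coefficient n^2 of
  \<integral> v^2.\<close>

lemma H2_limit_shifted_norm:
  "(LINT x|lebesgue. (G x \<bullet> x + real DIM('a) * v x)\<^sup>2) = (LINT x|lebesgue. (G x \<bullet> x)\<^sup>2)"
proof -
  have "(LINT x|lebesgue. (G x \<bullet> x + real DIM('a) * v x)\<^sup>2)
      = (LINT x|lebesgue. (G x \<bullet> x)\<^sup>2 + 2 * real DIM('a) * (v x * (G x \<bullet> x)) + (real DIM('a))\<^sup>2 * (v x)\<^sup>2)"
    by (simp add: power2_eq_square algebra_simps)
  also have "\<dots> = (LINT x|lebesgue. (G x \<bullet> x)\<^sup>2) + 2 * real DIM('a) * (LINT x|lebesgue. v x * (G x \<bullet> x))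
      + (real DIM('a))\<^sup>2 * (LINT x|lebesgue. (v x)\<^sup>2)"
    using L2_mult_integrable[OF H2_limit_L2(1,3)] L2_integrable[OF H2_limit_L2(1)] L2_integrable[OF H2_limit_L2(3)]
    by simp
  finally show ?thesis
    by (simp add: H2_limit_function_radial power2_eq_square)
qed

lemma H2_limit_inequality:
  "((real DIM('a) + 2) / 2)\<^sup>2 * (LINT x|lebesgue. (norm (G x))\<^sup>2)\<^sup>2
    \<le> (LINT x|lebesgue. (L x)\<^sup>2) * (LINT x|lebesgue. (G x \<bullet> x)\<^sup>2)"
  using L2_Cauchy_Schwarz[OF H2_limit_L2(4) H2_limit_shifted_L2]
  by (simp only: H2_limit_laplacian_shifted H2_limit_shifted_norm power_mult_distrib power2_minus)

end

section \<open>Weak derivatives\<close>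

lemma L2_indicator_compact:
  assumes "compact K" shows "L2 lebesgue (indicator K :: 'a::euclidean_space \<Rightarrow> real)"
  using assms emeasure_compact_finite[OF assms]
  by (auto simp: L2_def power2_eq_square lmeasurable_compact lmeasurable_iff_integrable[symmetric]
      simp flip: indicator_inter_arith intro!: borel_measurable_indicator fmeasurableD)

lemma L2_locally_integrable:
  assumes f: "L2 lebesgue f" shows "locally_integrable (f :: 'a::euclidean_space \<Rightarrow> real)"
  unfolding locally_integrable_def set_integrable_def
proof (intro allI impI)
  fix K :: "'a set" assume K: "compact K"
  from L2_mult_integrable[OF L2_indicator_compact[OF this] f] show "integrable lebesgue (\<lambda>x. indicator K x *\<^sub>R f x)"
    by simp
qed

lemma locally_integrable_components:
  fixes G :: "'a::euclidean_space \<Rightarrow> 'a"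
  assumes "\<And>b. b \<in> Basis \<Longrightarrow> locally_integrable (\<lambda>x. G x \<bullet> b)"
  shows "locally_integrable G"
  unfolding locally_integrable_def set_integrable_def
proof (intro allI impI)
  fix K :: "'a set" assume K: "compact K"
  have "integrable lebesgue (\<lambda>x. \<Sum>b\<in>Basis. (indicator K x *\<^sub>R (G x \<bullet> b)) *\<^sub>R b)"
    using assms K by (intro Bochner_Integration.integrable_sum integrable_scaleR_left)
      (auto simp: locally_integrable_def set_integrable_def)
  moreover have "(\<Sum>b\<in>Basis. (indicator K x *\<^sub>R (G x \<bullet> b)) *\<^sub>R b) = indicator K x *\<^sub>R G x" for x
    by (simp add: euclidean_representation flip: scaleR_scaleR scaleR_sum_right)
  ultimately show "integrable lebesgue (\<lambda>x. indicator K x *\<^sub>R G x)"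
    by simp
qed

lemma test_function_mult_integrable:
  fixes g :: "'a::euclidean_space \<Rightarrow> 'b::{banach,second_countable_topology}"
  assumes \<psi>: "test_function \<psi>" and g: "locally_integrable g"
  shows "integrable lebesgue (\<lambda>x. \<psi> x *\<^sub>R g x)"
proof -
  let ?K = "closure {x. \<psi> x \<noteq> 0}"
  obtain B where B: "\<bar>\<psi> x\<bar> \<le> B" for x
    using test_function_bound[OF \<psi>] by auto
  show ?thesis
  proof (rule Bochner_Integration.integrable_bound)
    show "integrable lebesgue (\<lambda>x. B *\<^sub>R (indicator ?K x *\<^sub>R g x))"
      using g \<psi> by (intro integrable_scaleR_right)
        (simp add: locally_integrable_def set_integrable_def test_function_def)
    show "(\<lambda>x. \<psi> x *\<^sub>R g x) \<in> borel_measurable lebesgue"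
      by (intro borel_measurable_scaleR smooth_measurable test_function_smooth \<psi> locally_integrable_measurable g)
    show "AE x in lebesgue. norm (\<psi> x *\<^sub>R g x) \<le> norm (B *\<^sub>R (indicator ?K x *\<^sub>R g x))"
    proof (rule AE_I2)
      fix x
      show "norm (\<psi> x *\<^sub>R g x) \<le> norm (B *\<^sub>R (indicator ?K x *\<^sub>R g x))"
        using B[of x] closure_subset[of "{x. \<psi> x \<noteq> 0}"]
        by (cases "\<psi> x = 0") (auto simp: mult_right_mono)
    qed
  qed
qed

lemma locally_integrable_diff:
  fixes f g :: "'a::euclidean_space \<Rightarrow> 'b::{banach,second_countable_topology}"
  assumes "locally_integrable f" "locally_integrable g"
  shows "locally_integrable (\<lambda>x. f x - g x)"
  using assms by (auto simp: locally_integrable_def)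

lemma locally_integrable_inner:
  fixes G :: "'a::euclidean_space \<Rightarrow> 'a"
  assumes "locally_integrable G"
  shows "locally_integrable (\<lambda>x. G x \<bullet> b)"
  unfolding locally_integrable_def set_integrable_def
proof (intro allI impI)
  fix K :: "'a set" assume "compact K"
  then have "integrable lebesgue (\<lambda>x. (indicator K x *\<^sub>R G x) \<bullet> b)"
    using assms by (intro integrable_inner_left) (auto simp: locally_integrable_def set_integrable_def)
  then show "integrable lebesgue (\<lambda>x. indicator K x *\<^sub>R (G x \<bullet> b))"
    by simp
qed

text \<open>The difference of the two integrates to zero against every test function, so the
  fundamental lemma applies. This makes the arbitrary choice in \<open>weak_laplacian\<close>
  harmless.\<close>

lemma is_weak_laplacian_unique:
  assumes L: "is_weak_laplacian u L" and L': "is_weak_laplacian u L'"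
  shows "AE x in lebesgue. L x = L' x"
proof -
  note loc = L[unfolded is_weak_laplacian_def, THEN conjunct1] L'[unfolded is_weak_laplacian_def, THEN conjunct1]
  have "AE x in lebesgue. L x - L' x = 0"
  proof (rule AE_zero_of_test_integrals)
    show "locally_integrable (\<lambda>x. L x - L' x)"
      by (rule locally_integrable_diff[OF loc])
    fix \<psi> :: "'a \<Rightarrow> real" assume \<psi>: "test_function \<psi>"
    have "(LINT x|lebesgue. \<psi> x * L x) = (LINT x|lebesgue. \<psi> x * L' x)"
      using L L' \<psi> unfolding is_weak_laplacian_def by (metis (no_types))
    then show "(LINT x|lebesgue. \<psi> x * (L x - L' x)) = 0"
      using test_function_mult_integrable[OF \<psi> loc(1)] test_function_mult_integrable[OF \<psi> loc(2)]
      by (simp add: right_diff_distrib)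
  qed
  then show ?thesis by simp
qed

text \<open>Pairing with a fixed vector reduces to the scalar case; the null sets of the finitely
  many basis vectors are then united.\<close>

lemma is_weak_grad_unique:
  fixes u :: "'a::euclidean_space \<Rightarrow> real"
  assumes G: "is_weak_grad u G" and G': "is_weak_grad u G'"
  shows "AE x in lebesgue. G x = G' x"
proof -
  note loc = G[unfolded is_weak_grad_def, THEN conjunct1] G'[unfolded is_weak_grad_def, THEN conjunct1]
  have "AE x in lebesgue. (G x - G' x) \<bullet> b = 0" for b
  proof (rule AE_zero_of_test_integrals)
    show "locally_integrable (\<lambda>x. (G x - G' x) \<bullet> b)"
      by (intro locally_integrable_inner locally_integrable_diff loc)
    fix \<psi> :: "'a \<Rightarrow> real" assume \<psi>: "test_function \<psi>"
    have i: "integrable lebesgue (\<lambda>x. \<psi> x *\<^sub>R G x)" "integrable lebesgue (\<lambda>x. \<psi> x *\<^sub>R G' x)"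
      by (rule test_function_mult_integrable[OF \<psi> loc(1)], rule test_function_mult_integrable[OF \<psi> loc(2)])
    have "- (LINT x|lebesgue. \<psi> x *\<^sub>R G x) = - (LINT x|lebesgue. \<psi> x *\<^sub>R G' x)"
      using conjunct2[OF G[unfolded is_weak_grad_def], rule_format, OF \<psi>]
        conjunct2[OF G'[unfolded is_weak_grad_def], rule_format, OF \<psi>] by (rule trans[OF sym])
    then have "(LINT x|lebesgue. \<psi> x *\<^sub>R G x - \<psi> x *\<^sub>R G' x) \<bullet> b = 0"
      using i by simp
    moreover have "(LINT x|lebesgue. (\<psi> x *\<^sub>R G x - \<psi> x *\<^sub>R G' x) \<bullet> b)
        = (LINT x|lebesgue. \<psi> x *\<^sub>R G x - \<psi> x *\<^sub>R G' x) \<bullet> b"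
      using i by (intro integral_inner_left) simp
    ultimately show "(LINT x|lebesgue. \<psi> x * ((G x - G' x) \<bullet> b)) = 0"
      by (simp add: inner_diff_left algebra_simps)
  qed
  then have "AE x in lebesgue. \<forall>b\<in>Basis. (G x - G' x) \<bullet> b = 0"
    by (intro AE_ball_countable[THEN iffD2] ballI countable_finite) auto
  then show ?thesis
    by eventually_elim (simp add: euclidean_eq_iff[of "G _"] inner_diff_left)
qed

definition L1_loc_tendsto :: "(nat \<Rightarrow> 'a::euclidean_space \<Rightarrow> real) \<Rightarrow> ('a \<Rightarrow> real) \<Rightarrow> bool" where
  "L1_loc_tendsto \<phi> u \<longleftrightarrow>
    (\<forall>K. compact K \<longrightarrow> (\<lambda>k. LINT x:K|lebesgue. \<bar>\<phi> k x - u x\<bar>) \<longlonglongrightarrow> 0)"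

text \<open>The factor \<psi> is bounded and vanishes off a compact set, on which the convergence is
  in L1.\<close>

lemma L1_loc_tendsto_test:
  assumes lim: "L1_loc_tendsto \<phi> u" and loc: "\<And>k. locally_integrable (\<phi> k)" "locally_integrable u"
    and \<psi>: "test_function \<psi>"
  shows "(\<lambda>k. LINT x|lebesgue. \<psi> x * \<phi> k x) \<longlonglongrightarrow> (LINT x|lebesgue. \<psi> x * u x)"
proof -
  let ?K = "closure {x. \<psi> x \<noteq> 0}"
  have K: "compact ?K" using \<psi> by (simp add: test_function_def)
  obtain B where B: "\<bar>\<psi> x\<bar> \<le> B" for x
    using test_function_bound[OF \<psi>] by auto
  have "(\<lambda>k. B * (LINT x:?K|lebesgue. \<bar>\<phi> k x - u x\<bar>)) \<longlonglongrightarrow> B * 0"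
    using lim K by (intro tendsto_mult tendsto_const) (simp add: L1_loc_tendsto_def)
  then have lim0: "(\<lambda>k. B * (LINT x:?K|lebesgue. \<bar>\<phi> k x - u x\<bar>)) \<longlonglongrightarrow> 0"
    by (simp only: mult_zero_right)
  have "\<bar>(LINT x|lebesgue. \<psi> x * \<phi> k x) - (LINT x|lebesgue. \<psi> x * u x)\<bar>
      \<le> B * (LINT x:?K|lebesgue. \<bar>\<phi> k x - u x\<bar>)" for k
  proof -
    have d: "locally_integrable (\<lambda>x. \<phi> k x - u x)"
      by (rule locally_integrable_diff[OF loc])
    have i: "integrable lebesgue (\<lambda>x. indicator ?K x * \<bar>\<phi> k x - u x\<bar>)"
      using integrable_norm[of lebesgue "\<lambda>x. indicator ?K x *\<^sub>R (\<phi> k x - u x)"] d K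
      by (simp add: locally_integrable_def set_integrable_def abs_mult)
    have "(LINT x|lebesgue. \<psi> x * \<phi> k x) - (LINT x|lebesgue. \<psi> x * u x) = (LINT x|lebesgue. \<psi> x * (\<phi> k x - u x))"
      using test_function_mult_integrable[OF \<psi> loc(1)[of k]] test_function_mult_integrable[OF \<psi> loc(2)]
      by (simp add: right_diff_distrib)
    also have "\<bar>\<dots>\<bar> \<le> (LINT x|lebesgue. \<bar>\<psi> x * (\<phi> k x - u x)\<bar>)"
      using integral_norm_bound[of lebesgue "\<lambda>x. \<psi> x * (\<phi> k x - u x)"] by simp
    also have "\<dots> \<le> (LINT x|lebesgue. B * (indicator ?K x * \<bar>\<phi> k x - u x\<bar>))"
    proof (rule integral_mono)
      show "integrable lebesgue (\<lambda>x. \<bar>\<psi> x * (\<phi> k x - u x)\<bar>)"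
        using integrable_norm[OF test_function_mult_integrable[OF \<psi> d]] by simp
      show "integrable lebesgue (\<lambda>x. B * (indicator ?K x * \<bar>\<phi> k x - u x\<bar>))"
        using i by simp
      show "\<bar>\<psi> x * (\<phi> k x - u x)\<bar> \<le> B * (indicator ?K x * \<bar>\<phi> k x - u x\<bar>)" for x
        using B[of x] closure_subset[of "{x. \<psi> x \<noteq> 0}"]
        by (cases "\<psi> x = 0") (auto simp: abs_mult mult_right_mono)
    qed
    also have "\<dots> = B * (LINT x:?K|lebesgue. \<bar>\<phi> k x - u x\<bar>)"
      by (simp add: set_lebesgue_integral_def)
    finally show ?thesis .
  qed
  from tendsto_zero_bound[OF lim0 this] show ?thesis
    by (rule LIM_zero_cancel)
qed

text \<open>The two sides of \<integral> \<Delta>\<psi> \<phi>_k = \<integral> \<psi>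
  \<Delta>\<phi>_k converge in different senses: the left one because \<phi>_k tends to
  \<open>u\<close> locally in L1, the right one because \<Delta>\<phi>_k tends to \<open>L\<close>
  in L2. This attaches the limits of the derivatives to the element \<open>u\<close> of the
  space.\<close>

lemma H2_limit_weak_laplacian:
  assumes lim: "H2_limit \<phi> v G L" and u: "L1_loc_tendsto \<phi> u" "locally_integrable u"
  shows "is_weak_laplacian u L"
  unfolding is_weak_laplacian_def
proof (intro conjI allI impI)
  note t = H2_limit_test[OF lim]
  show "locally_integrable L"
    by (rule L2_locally_integrable[OF H2_limit_L2(4)[OF lim]])
  fix \<psi> :: "'a \<Rightarrow> real" assume \<psi>: "test_function \<psi>"
  have "(\<lambda>k. LINT x|lebesgue. laplacian \<psi> x * \<phi> k x) \<longlonglongrightarrow> (LINT x|lebesgue. laplacian \<psi> x * u x)"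
    by (intro L1_loc_tendsto_test u test_function_laplacian \<psi> L2_locally_integrable test_function_L2 t)
  \<comment> \<open>Green's identity twice, with the roles of \<psi> and \<phi>_k exchanged.\<close>
  moreover have "(LINT x|lebesgue. laplacian \<psi> x * \<phi> k x) = (LINT x|lebesgue. \<psi> x * laplacian (\<phi> k) x)" for k
    using integral_mult_laplacian[OF \<psi> test_function_smooth[OF t]] integral_mult_laplacian[OF t test_function_smooth[OF \<psi>]]
    by (simp add: inner_commute mult.commute)
  ultimately have "(\<lambda>k. LINT x|lebesgue. \<psi> x * laplacian (\<phi> k) x) \<longlonglongrightarrow> (LINT x|lebesgue. laplacian \<psi> x * u x)"
    by simp
  from LIMSEQ_unique[OF this L2_tendsto_inner[OF L2_tendsto_const[OF test_function_L2[OF \<psi>]] H2_limit_laplacian[OF lim]]]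
  show "(LINT x|lebesgue. u x * laplacian \<psi> x) = (LINT x|lebesgue. \<psi> x * L x)"
    by (simp add: mult.commute)
qed

lemma H2_limit_weak_grad:
  fixes u :: "'a::euclidean_space \<Rightarrow> real"
  assumes lim: "H2_limit \<phi> v G L" and u: "L1_loc_tendsto \<phi> u" "locally_integrable u"
  shows "is_weak_grad u G"
  unfolding is_weak_grad_def
proof (intro conjI allI impI)
  note t = H2_limit_test[OF lim]
  show loc: "locally_integrable G"
    by (intro locally_integrable_components L2_locally_integrable H2_limit_L2(2)[OF lim])
  fix \<psi> :: "'a \<Rightarrow> real" assume \<psi>: "test_function \<psi>"
  have comp: "(LINT x|lebesgue. partial b \<psi> x * u x) = - (LINT x|lebesgue. \<psi> x * (G x \<bullet> b))"
    if b: "b \<in> Basis" for b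
  proof (rule LIMSEQ_unique)
    show "(\<lambda>k. LINT x|lebesgue. partial b \<psi> x * \<phi> k x) \<longlonglongrightarrow> (LINT x|lebesgue. partial b \<psi> x * u x)"
      by (intro L1_loc_tendsto_test u test_function_partial \<psi> b L2_locally_integrable test_function_L2 t)
    show "(\<lambda>k. LINT x|lebesgue. partial b \<psi> x * \<phi> k x) \<longlonglongrightarrow> - (LINT x|lebesgue. \<psi> x * (G x \<bullet> b))"
      unfolding integral_by_parts[OF \<psi> test_function_smooth[OF t] b]
      by (intro tendsto_minus L2_tendsto_inner L2_tendsto_const test_function_L2 \<psi> H2_limit_partial[OF lim b])
  qed
  \<comment> \<open>Integrability of the vector-valued integrands allows the inner product with a
    basis vector to be taken under the integral, which reduces the claim to
    \<open>comp\<close>.\<close>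
  have iu: "integrable lebesgue (\<lambda>x. u x *\<^sub>R grad \<psi> x)"
    unfolding grad_def scaleR_sum_right scaleR_scaleR
    using test_function_mult_integrable[OF test_function_partial[OF \<psi>] u(2)]
    by (intro Bochner_Integration.integrable_sum integrable_scaleR_left) (simp add: mult.commute)
  have iG: "integrable lebesgue (\<lambda>x. \<psi> x *\<^sub>R G x)"
    by (rule test_function_mult_integrable[OF \<psi> loc])
  show "(LINT x|lebesgue. u x *\<^sub>R grad \<psi> x) = - (LINT x|lebesgue. \<psi> x *\<^sub>R G x)"
  proof (rule euclidean_eqI)
    fix b :: 'a assume b: "b \<in> Basis"
    have "(LINT x|lebesgue. u x *\<^sub>R grad \<psi> x) \<bullet> b = (LINT x|lebesgue. u x *\<^sub>R grad \<psi> x \<bullet> b)"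
      using iu by (intro integral_inner_left[symmetric]) simp
    also have "\<dots> = (LINT x|lebesgue. partial b \<psi> x * u x)"
      using b by (simp add: grad_inner mult.commute)
    also have "\<dots> = - (LINT x|lebesgue. \<psi> x *\<^sub>R G x \<bullet> b)"
      using comp[OF b] by simp
    also have "(LINT x|lebesgue. \<psi> x *\<^sub>R G x \<bullet> b) = (LINT x|lebesgue. \<psi> x *\<^sub>R G x) \<bullet> b"
      using iG by (intro integral_inner_left) simp
    finally show "(LINT x|lebesgue. u x *\<^sub>R grad \<psi> x) \<bullet> b = - (LINT x|lebesgue. \<psi> x *\<^sub>R G x) \<bullet> b"
      by simp
  qed
qed

lemma H2_space_limit:
  assumes "u \<in> H2_space"
  obtains \<phi> v G L where "H2_limit \<phi> v G L" "is_weak_grad u G" "is_weak_laplacian u L"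
proof -
  obtain \<phi> where \<phi>: "H2_Cauchy \<phi>" and u: "L1_loc_tendsto \<phi> u" "locally_integrable u"
    using assms by (auto simp: H2_space_def L1_loc_tendsto_def)
  from H2_Cauchy_limit[OF \<phi>] obtain v G L where "H2_limit \<phi> v G L" by blast
  with that H2_limit_weak_laplacian[OF this u] H2_limit_weak_grad[OF this u] show ?thesis by blast
qed

section \<open>Passage to the chosen representatives of the weak derivatives\<close>

lemma weak_grad_AE_eq:
  assumes "is_weak_grad u G"
  shows "is_weak_grad u (weak_grad u)" "AE x in lebesgue. weak_grad u x = G x"
proof -
  show "is_weak_grad u (weak_grad u)"
    unfolding weak_grad_def by (rule someI[of "is_weak_grad u", OF assms])
  from is_weak_grad_unique[OF this assms] show "AE x in lebesgue. weak_grad u x = G x" .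
qed

lemma weak_laplacian_AE_eq:
  assumes "is_weak_laplacian u L"
  shows "is_weak_laplacian u (weak_laplacian u)" "AE x in lebesgue. weak_laplacian u x = L x"
proof -
  show "is_weak_laplacian u (weak_laplacian u)"
    unfolding weak_laplacian_def by (rule someI[of "is_weak_laplacian u", OF assms])
  from is_weak_laplacian_unique[OF this assms] show "AE x in lebesgue. weak_laplacian u x = L x" .
qed

text \<open>The point is an extra argument of \<open>h\<close> so that the radial integrand is
  covered too. Measurability of the chosen representative comes from its local
  integrability.\<close>

lemma weak_grad_integral_cong:
  fixes u :: "'a::euclidean_space \<Rightarrow> real" and h :: "'a \<Rightarrow> 'a \<Rightarrow> real"
  assumes G: "is_weak_grad u G"
    and h: "\<And>F. F \<in> borel_measurable lebesgue \<Longrightarrow> (\<lambda>x. h x (F x)) \<in> borel_measurable lebesgue"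
  shows "integrable lebesgue (\<lambda>x. h x (weak_grad u x)) \<longleftrightarrow> integrable lebesgue (\<lambda>x. h x (G x))"
    "(LINT x|lebesgue. h x (weak_grad u x)) = (LINT x|lebesgue. h x (G x))"
proof -
  have m: "(\<lambda>x. h x (weak_grad u x)) \<in> borel_measurable lebesgue" "(\<lambda>x. h x (G x)) \<in> borel_measurable lebesgue"
    using G weak_grad_AE_eq(1)[OF G]
    by (auto simp only: is_weak_grad_def intro!: h elim!: locally_integrable_measurable)
  have ae: "AE x in lebesgue. h x (weak_grad u x) = h x (G x)"
    using weak_grad_AE_eq(2)[OF G] by eventually_elim simp
  show "integrable lebesgue (\<lambda>x. h x (weak_grad u x)) \<longleftrightarrow> integrable lebesgue (\<lambda>x. h x (G x))"
    by (rule integrable_cong_AE[OF m ae])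
  show "(LINT x|lebesgue. h x (weak_grad u x)) = (LINT x|lebesgue. h x (G x))"
    by (rule integral_cong_AE[OF m ae])
qed

lemma weak_laplacian_integral_cong:
  assumes L: "is_weak_laplacian u L"
  shows "integrable lebesgue (\<lambda>x. (weak_laplacian u x)\<^sup>2) \<longleftrightarrow> integrable lebesgue (\<lambda>x. (L x)\<^sup>2)"
    "(LINT x|lebesgue. (weak_laplacian u x)\<^sup>2) = (LINT x|lebesgue. (L x)\<^sup>2)"
proof -
  have m: "(\<lambda>x. (weak_laplacian u x)\<^sup>2) \<in> borel_measurable lebesgue" "(\<lambda>x. (L x)\<^sup>2) \<in> borel_measurable lebesgue"
    using L weak_laplacian_AE_eq(1)[OF L]
    by (auto simp only: is_weak_laplacian_def intro!: borel_measurable_power elim!: locally_integrable_measurable)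
  have ae: "AE x in lebesgue. (weak_laplacian u x)\<^sup>2 = (L x)\<^sup>2"
    using weak_laplacian_AE_eq(2)[OF L] by eventually_elim simp
  show "integrable lebesgue (\<lambda>x. (weak_laplacian u x)\<^sup>2) \<longleftrightarrow> integrable lebesgue (\<lambda>x. (L x)\<^sup>2)"
    by (rule integrable_cong_AE[OF m ae])
  show "(LINT x|lebesgue. (weak_laplacian u x)\<^sup>2) = (LINT x|lebesgue. (L x)\<^sup>2)"
    by (rule integral_cong_AE[OF m ae])
qed

lemma weak_grad_radial_cong:
  fixes u :: "'a::euclidean_space \<Rightarrow> real"
  assumes G: "is_weak_grad u G"
  shows "integrable lebesgue (\<lambda>x. (weak_grad u x \<bullet> x)\<^sup>2) \<longleftrightarrow> integrable lebesgue (\<lambda>x. (G x \<bullet> x)\<^sup>2)"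
    "(LINT x|lebesgue. (weak_grad u x \<bullet> x)\<^sup>2) = (LINT x|lebesgue. (G x \<bullet> x)\<^sup>2)"
  by (rule weak_grad_integral_cong[OF G, of "\<lambda>x y. (y \<bullet> x)\<^sup>2"];
      intro borel_measurable_power borel_measurable_inner lebesgue_measurable_ident; assumption)+

lemma weak_grad_norm_cong:
  fixes u :: "'a::euclidean_space \<Rightarrow> real"
  assumes G: "is_weak_grad u G"
  shows "integrable lebesgue (\<lambda>x. (norm (weak_grad u x))\<^sup>2) \<longleftrightarrow> integrable lebesgue (\<lambda>x. (norm (G x))\<^sup>2)"
    "(LINT x|lebesgue. (norm (weak_grad u x))\<^sup>2) = (LINT x|lebesgue. (norm (G x))\<^sup>2)"
  by (rule weak_grad_integral_cong[OF G, of "\<lambda>x y. (norm y)\<^sup>2"];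
      intro borel_measurable_power measurable_compose[OF _ borel_measurable_norm]; assumption)+

lemma H2_space_inequality:
  fixes u :: "'a::euclidean_space \<Rightarrow> real"
  assumes "u \<in> H2_space"
  shows "is_weak_grad u (weak_grad u) \<and> is_weak_laplacian u (weak_laplacian u) \<and>
    integrable lebesgue (\<lambda>x. (weak_laplacian u x)\<^sup>2) \<and>
    integrable lebesgue (\<lambda>x. (weak_grad u x \<bullet> x)\<^sup>2) \<and>
    integrable lebesgue (\<lambda>x. (norm (weak_grad u x))\<^sup>2) \<and>
    (LINT x|lebesgue. (weak_laplacian u x)\<^sup>2) * (LINT x|lebesgue. (weak_grad u x \<bullet> x)\<^sup>2)
      \<ge> ((real DIM('a) + 2) / 2)\<^sup>2 * (LINT x|lebesgue. (norm (weak_grad u x))\<^sup>2)\<^sup>2"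
proof -
  obtain \<phi> v G L where lim: "H2_limit \<phi> v G L" and G: "is_weak_grad u G" and L: "is_weak_laplacian u L"
    using H2_space_limit[OF assms] .
  show ?thesis
    unfolding weak_grad_radial_cong[OF G] weak_grad_norm_cong[OF G] weak_laplacian_integral_cong[OF L]
    using H2_limit_L2[OF lim] H2_limit_norm_grad(1)[OF lim] H2_limit_inequality[OF lim]
      weak_grad_AE_eq(1)[OF G] weak_laplacian_AE_eq(1)[OF L]
    by (simp add: L2_integrable)
qed

section \<open>The Gaussian\<close>

lemma partial_scale:
  assumes "\<And>x. f differentiable (at x)"
  shows "partial b (\<lambda>x. f (c *\<^sub>R x)) = (\<lambda>x. c * partial b f (c *\<^sub>R x))"
proof
  fix x
  let ?f' = "frechet_derivative f (at (c *\<^sub>R x))"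
  have f': "(f has_derivative ?f') (at (c *\<^sub>R x))"
    using assms by (simp add: frechet_derivative_works[symmetric])
  have "((\<lambda>x. f (c *\<^sub>R x)) has_derivative (\<lambda>h. ?f' (c *\<^sub>R h))) (at x)"
    by (rule has_derivative_compose[where f = "\<lambda>x. c *\<^sub>R x" and g = f, OF _ f']) (auto intro!: derivative_eq_intros)
  from partial_eqI[OF this] show "partial b (\<lambda>x. f (c *\<^sub>R x)) x = c * partial b f (c *\<^sub>R x)"
    using linear_scale[OF linear_frechet_derivative[OF assms], of "c *\<^sub>R x" c b] by (simp add: partial_def)
qed

lemma C_k_scale: "C_k k f \<Longrightarrow> C_k k (\<lambda>x. f (c *\<^sub>R x))"
proof (induction k arbitrary: f)
  case 0
  then show ?case
    by (auto intro!: continuous_on_compose2[of UNIV f] continuous_intros)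
next
  case (Suc k)
  then have d: "f differentiable (at x)" for x by simp
  have "(\<lambda>x. f (c *\<^sub>R x)) differentiable (at x)" for x
    by (rule differentiable_compose[where f = f]) (use d in auto)
  with Suc show ?case
    by (simp add: partial_scale[OF d] C_k_mult C_k_const)
qed

lemma smooth_scale: "smooth f \<Longrightarrow> smooth (\<lambda>x. f (c *\<^sub>R x))"
  by (simp add: smooth_def C_k_scale)

lemma smooth_exp: "smooth (exp :: real \<Rightarrow> real)"
proof -
  have d: "((exp :: real \<Rightarrow> real) has_derivative (\<lambda>h. h * exp t)) (at t)" for t
    using DERIV_exp[of t] by (simp add: has_field_derivative_def mult_commute_abs)
  have "partial 1 (exp :: real \<Rightarrow> real) = exp"
    by (rule ext) (simp add: partial_eqI[OF d])
  moreover have "(exp :: real \<Rightarrow> real) differentiable (at t)" for t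
    using d by (auto simp: differentiable_def)
  ultimately have "C_k k (exp :: real \<Rightarrow> real)" for k
    by (induction k) (auto intro: continuous_intros)
  then show ?thesis by (simp add: smooth_def)
qed

section \<open>Derivatives of the Gaussian\<close>

lemma smooth_gaussian: "smooth gaussian"
proof -
  have "smooth (\<lambda>x::'a. exp (- (1/2) * (norm x)\<^sup>2))"
    by (rule smooth_compose[OF smooth_exp]) (intro smooth_cmult smooth_norm_square)
  then show ?thesis by (simp add: gaussian_def[abs_def])
qed

lemma gaussian_pos: "0 < gaussian x"
  by (simp add: gaussian_def)

lemma partial_gaussian: "partial b gaussian x = - (x \<bullet> b) * gaussian x"
proof -
  have "((\<lambda>x. exp (- (x \<bullet> x) / 2)) has_derivative (\<lambda>h. exp (- (x \<bullet> x) / 2) * (- (x \<bullet> h)))) (at x)"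
    by (auto intro!: derivative_eq_intros simp: inner_commute fun_eq_iff)
  from partial_eqI[OF this, of b] show ?thesis
    by (simp add: gaussian_def[abs_def] power2_norm_eq_inner)
qed

lemma partial_partial_gaussian:
  assumes "b \<in> Basis" shows "partial b (partial b gaussian) x = ((x \<bullet> b)\<^sup>2 - 1) * gaussian x"
proof -
  have "partial b gaussian = (\<lambda>x. (-1 * (x \<bullet> b)) * gaussian x)"
    by (simp add: fun_eq_iff partial_gaussian)
  then have "partial b (partial b gaussian) x = partial b (\<lambda>x. (-1 * (x \<bullet> b)) * gaussian x) x"
    by simp
  also have "\<dots> = partial b (\<lambda>x. -1 * (x \<bullet> b)) x * gaussian x + (-1 * (x \<bullet> b)) * (- (x \<bullet> b) * gaussian x)"
    unfolding partial_gaussian[symmetric]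
    by (subst partial_mult) (auto intro: smooth_differentiable smooth_gaussian smooth_cmult smooth_inner)
  also have "partial b (\<lambda>x. -1 * (x \<bullet> b)) = (\<lambda>x. -1)"
    using assms by (subst partial_mult) (auto simp: partial_inner partial_eqI[OF has_derivative_const] smooth_inner smooth_differentiable)
  finally show ?thesis
    by (simp add: power2_eq_square algebra_simps)
qed

lemma norm_square_sum: "(norm x)\<^sup>2 = (\<Sum>b\<in>Basis. (x \<bullet> b)\<^sup>2)"
  unfolding power2_norm_eq_inner by (subst euclidean_inner) (simp add: power2_eq_square)

lemma grad_gaussian_radial: "grad gaussian x \<bullet> x = - (norm x)\<^sup>2 * gaussian x"
  by (simp add: grad_inner_sum partial_gaussian norm_square_sum sum_distrib_left sum_negf
      power2_eq_square[of "_ \<bullet> _"] mult_ac)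

lemma laplacian_gaussian:
  "laplacian gaussian (x::'a::euclidean_space) = - (grad gaussian x \<bullet> x + real DIM('a) * gaussian x)"
proof -
  have "laplacian gaussian x = (\<Sum>b\<in>Basis. (x \<bullet> b)\<^sup>2 - 1) * gaussian x"
    by (simp add: laplacian_def partial_partial_gaussian sum_distrib_right)
  also have "(\<Sum>b\<in>Basis. (x \<bullet> b)\<^sup>2 - 1) = (norm x)\<^sup>2 - real DIM('a)"
    by (simp add: norm_square_sum sum_subtractf)
  finally show ?thesis
    by (simp add: grad_gaussian_radial algebra_simps)
qed

text \<open>The function factorises over the coordinates into multiples of the standard normal
  density, so its integral is a finite product of finite factors.\<close>

lemma integrable_exp_norm_square: "integrable lborel (\<lambda>x::'a::euclidean_space. exp (- (norm x)\<^sup>2 / 2))"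
proof (rule integrableI_nonneg)
  have "integrable lborel (\<lambda>t. sqrt (2 * pi) * normal_density 0 1 t)"
    by (intro integrable_mult_right integrable_normal_density) simp
  then have "integrable lborel (\<lambda>t::real. exp (- t\<^sup>2 / 2))"
    by (simp add: normal_density_def)
  then have fin: "(\<integral>\<^sup>+t. ennreal (exp (- (t::real)\<^sup>2 / 2)) \<partial>lborel) < \<infinity>"
    by (subst nn_integral_eq_integral) auto
  have eq: "ennreal (exp (- (norm x)\<^sup>2 / 2)) = (\<Prod>b\<in>Basis. ennreal (exp (- (x \<bullet> b)\<^sup>2 / 2)))" for x :: 'a
    by (simp add: norm_square_sum prod_ennreal exp_sum[symmetric] sum_negf sum_divide_distrib)
  have "(\<integral>\<^sup>+x. ennreal (exp (- (norm (x::'a))\<^sup>2 / 2)) \<partial>lborel)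
      = (\<Prod>b\<in>(Basis::'a set). (\<integral>\<^sup>+t. ennreal (exp (- (t::real)\<^sup>2 / 2)) \<partial>lborel))"
    unfolding eq by (rule nn_integral_lborel_prod) auto
  also have "\<dots> < \<infinity>"
    using fin by (simp add: power_less_top_ennreal)
  finally show "(\<integral>\<^sup>+x. ennreal (exp (- (norm (x::'a))\<^sup>2 / 2)) \<partial>lborel) < \<infinity>" .
qed auto

text \<open>The common majorant: up to constants it dominates the Gaussian, its second derivatives,
  and its first derivatives multiplied by (1 + |x|^2)^(1/2).\<close>

definition gaussian_weight :: "'a::euclidean_space \<Rightarrow> real" where
  "gaussian_weight x = (1 + (norm x)\<^sup>2) * gaussian x"

lemma L2_gaussian_weight: "L2 lebesgue (gaussian_weight :: 'a::euclidean_space \<Rightarrow> real)"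
proof -
  have m: "continuous_on UNIV (gaussian_weight :: 'a \<Rightarrow> real)"
    unfolding gaussian_weight_def gaussian_def by (intro continuous_intros) auto
  have le: "(gaussian_weight x)\<^sup>2 \<le> 16 * exp (- (norm x)\<^sup>2 / 2)" for x :: 'a
  proof -
    let ?s = "(norm x)\<^sup>2"
    \<comment> \<open>The exponent s/4 becomes s/2 after squaring and so consumes only half of the
      decay exp(-s) of the squared Gaussian.\<close>
    have "1 + ?s \<le> 4 * exp (?s / 4)"
      using exp_ge_add_one_self[of "?s / 4"] by linarith
    then have "(1 + ?s)\<^sup>2 \<le> (4 * exp (?s / 4))\<^sup>2"
      by (intro power_mono) auto
    also have "\<dots> = 16 * exp (?s / 2)"
      by (simp add: power_mult_distrib flip: exp_double)
    finally have "(gaussian_weight x)\<^sup>2 \<le> 16 * exp (?s / 2) * (exp (- ?s / 2))\<^sup>2"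
      unfolding gaussian_weight_def gaussian_def power_mult_distrib by (rule mult_right_mono) simp
    also have "\<dots> = 16 * exp (- ?s / 2)"
      by (simp add: power2_eq_square flip: exp_add)
    finally show ?thesis .
  qed
  have "integrable lborel (\<lambda>x::'a. (gaussian_weight x)\<^sup>2)"
  proof (rule Bochner_Integration.integrable_bound)
    show "integrable lborel (\<lambda>x::'a. 16 * exp (- (norm x)\<^sup>2 / 2))"
      using integrable_exp_norm_square by simp
    show "(\<lambda>x::'a. (gaussian_weight x)\<^sup>2) \<in> borel_measurable lborel"
      using continuous_on_power[OF m] by (simp add: borel_measurable_continuous_onI)
    show "AE x::'a in lborel. norm ((gaussian_weight x)\<^sup>2) \<le> norm (16 * exp (- (norm x)\<^sup>2 / 2))"
      using le by simp
  qed
  moreover have "(\<lambda>x::'a. (gaussian_weight x)\<^sup>2) \<in> borel_measurable lborel"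
    using continuous_on_power[OF m] by (simp add: borel_measurable_continuous_onI)
  ultimately show ?thesis
    using continuous_lebesgue_measurable[OF m] by (simp add: L2_def integrable_completion)
qed

section \<open>Criteria for convergence in L2 and for the norm-Cauchy property\<close>

lemma L2_tendsto_dominated_convergence:
  assumes m: "\<And>k. f k \<in> borel_measurable M" "F \<in> borel_measurable M" and W: "L2 M W"
    and le: "\<And>k x. \<bar>f k x\<bar> \<le> C * \<bar>W x\<bar>" and lim: "\<And>x. (\<lambda>k. f k x) \<longlonglongrightarrow> F x"
  shows "L2_tendsto M f F"
proof -
  have leF: "\<bar>F x\<bar> \<le> C * \<bar>W x\<bar>" for x
    by (rule LIMSEQ_le_const2[OF tendsto_rabs[OF lim]]) (use le in auto)
  have L: "L2 M (f k)" "L2 M F" for k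
    using L2_dominated[OF W m(1) le] L2_dominated[OF W m(2) leF] by auto
  have "(\<lambda>k. LINT x|M. (f k x - F x)\<^sup>2) \<longlonglongrightarrow> (LINT x|M. 0)"
  proof (rule integral_dominated_convergence)
    show "integrable M (\<lambda>x. (2 * C)\<^sup>2 * (W x)\<^sup>2)"
      using W by (simp add: L2_def)
    show "AE x in M. (\<lambda>k. (f k x - F x)\<^sup>2) \<longlonglongrightarrow> 0"
    proof (rule AE_I2)
      fix x
      have "(\<lambda>k. (f k x - F x)\<^sup>2) \<longlonglongrightarrow> (F x - F x)\<^sup>2"
        by (intro tendsto_power tendsto_diff lim tendsto_const)
      then show "(\<lambda>k. (f k x - F x)\<^sup>2) \<longlonglongrightarrow> 0" by simp
    qed
    show "AE x in M. norm ((f k x - F x)\<^sup>2) \<le> (2 * C)\<^sup>2 * (W x)\<^sup>2" for k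
    proof (rule AE_I2)
      fix x
      have "\<bar>f k x - F x\<bar> \<le> 2 * C * \<bar>W x\<bar>"
        using le[of k x] leF[of x] abs_triangle_ineq4[of "f k x" "F x"] by linarith
      from power_mono[OF this, of 2] show "norm ((f k x - F x)\<^sup>2) \<le> (2 * C)\<^sup>2 * (W x)\<^sup>2"
        by (simp add: power_mult_distrib)
    qed
  qed (use m in auto)
  with L show ?thesis by (simp add: L2_tendsto_def)
qed

lemma L2_diff_bound:
  assumes "L2 M f" "L2 M g" "L2 M h"
  shows "(LINT x|M. (f x - g x)\<^sup>2) \<le> 2 * (LINT x|M. (f x - h x)\<^sup>2) + 2 * (LINT x|M. (g x - h x)\<^sup>2)"
proof -
  note i = L2_integrable[OF L2_diff[OF assms(1,2)]] L2_integrable[OF L2_diff[OF assms(1,3)]]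
    L2_integrable[OF L2_diff[OF assms(2,3)]]
  have "(LINT x|M. (f x - g x)\<^sup>2) \<le> (LINT x|M. 2 * (f x - h x)\<^sup>2 + 2 * (g x - h x)\<^sup>2)"
  proof (rule integral_mono)
    fix x
    have "0 \<le> ((f x - h x) + (g x - h x))\<^sup>2" by simp
    then show "(f x - g x)\<^sup>2 \<le> 2 * (f x - h x)\<^sup>2 + 2 * (g x - h x)\<^sup>2"
      by (simp add: power2_eq_square algebra_simps)
  qed (use i in auto)
  then show ?thesis using i by simp
qed

text \<open>The norm's weight |x|^2 is at most 1 + |x|^2, so squared distances in the norm are
  controlled by those of the weighted derivatives. The hypotheses are among those of
  \<open>H2_limitI\<close>: the same convergence statements give membership in the space and
  identify the limits.\<close>

lemma H2_CauchyI:
  fixes \<phi> :: "nat \<Rightarrow> 'a::euclidean_space \<Rightarrow> real"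
  assumes t: "\<And>k. test_function (\<phi> k)"
    and L: "L2_tendsto lebesgue (\<lambda>k. laplacian (\<phi> k)) L"
    and H: "\<And>b. b \<in> Basis \<Longrightarrow> L2_tendsto lebesgue (\<lambda>k x. sqrt (1 + (norm x)\<^sup>2) * partial b (\<phi> k) x) (H b)"
  shows "H2_Cauchy \<phi>"
  unfolding H2_Cauchy_def
proof (intro conjI allI impI t)
  let ?w = "\<lambda>x::'a. sqrt (1 + (norm x)\<^sup>2)"
  define d where "d k = (LINT x|lebesgue. (laplacian (\<phi> k) x - L x)\<^sup>2)
    + (\<Sum>b\<in>Basis. LINT x|lebesgue. (?w x * partial b (\<phi> k) x - H b x)\<^sup>2)" for k
  have "d \<longlonglongrightarrow> 0 + (\<Sum>b\<in>(Basis::'a set). 0)"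
    unfolding d_def using L H by (intro tendsto_add tendsto_sum) (auto simp: L2_tendsto_def)
  then have d0: "d \<longlonglongrightarrow> 0" by simp
  have HL: "L2 lebesgue (\<lambda>x. ?w x * partial b (\<phi> k) x)" "L2 lebesgue (H b)" if "b \<in> Basis" for b k
    using H[OF that] by (auto simp: L2_tendsto_def)
  have LL: "L2 lebesgue (laplacian (\<phi> k))" "L2 lebesgue L" for k
    using L by (auto simp: L2_tendsto_def)
  have bound: "(H2_norm (\<lambda>x. \<phi> j x - \<phi> k x))\<^sup>2 \<le> 2 * d j + 2 * d k" for j k
  proof -
    note s = test_function_smooth[OF t]
    have lap: "(LINT x|lebesgue. (laplacian (\<lambda>x. \<phi> j x - \<phi> k x) x)\<^sup>2)
        \<le> 2 * (LINT x|lebesgue. (laplacian (\<phi> j) x - L x)\<^sup>2) + 2 * (LINT x|lebesgue. (laplacian (\<phi> k) x - L x)\<^sup>2)"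
      using L2_diff_bound[OF LL(1) LL(1) LL(2)] by (simp add: laplacian_diff s)
    have part: "(LINT x|lebesgue. (norm x)\<^sup>2 * (partial b (\<lambda>x. \<phi> j x - \<phi> k x) x)\<^sup>2)
        \<le> 2 * (LINT x|lebesgue. (?w x * partial b (\<phi> j) x - H b x)\<^sup>2)
          + 2 * (LINT x|lebesgue. (?w x * partial b (\<phi> k) x - H b x)\<^sup>2)" if b: "b \<in> Basis" for b
    proof -
      have "(LINT x|lebesgue. (norm x)\<^sup>2 * (partial b (\<lambda>x. \<phi> j x - \<phi> k x) x)\<^sup>2)
          \<le> (LINT x|lebesgue. (?w x * partial b (\<phi> j) x - ?w x * partial b (\<phi> k) x)\<^sup>2)"
      proof (rule integral_mono)
        show "integrable lebesgue (\<lambda>x. (norm x)\<^sup>2 * (partial b (\<lambda>x. \<phi> j x - \<phi> k x) x)\<^sup>2)"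
          by (rule test_function_sqr_integral_le(3)[OF test_function_diff[OF t t] smooth_norm_square _ b]) simp
        show "integrable lebesgue (\<lambda>x. (?w x * partial b (\<phi> j) x - ?w x * partial b (\<phi> k) x)\<^sup>2)"
          by (rule L2_integrable[OF L2_diff[OF HL(1)[OF b] HL(1)[OF b]]])
        fix x
        have "(?w x * partial b (\<phi> j) x - ?w x * partial b (\<phi> k) x)\<^sup>2
            = (1 + (norm x)\<^sup>2) * (partial b (\<phi> j) x - partial b (\<phi> k) x)\<^sup>2"
          by (simp add: power_mult_distrib add_nonneg_nonneg flip: right_diff_distrib)
        then show "(norm x)\<^sup>2 * (partial b (\<lambda>x. \<phi> j x - \<phi> k x) x)\<^sup>2
            \<le> (?w x * partial b (\<phi> j) x - ?w x * partial b (\<phi> k) x)\<^sup>2"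
          by (simp add: partial_diff s mult_right_mono)
      qed
      also have "\<dots> \<le> 2 * (LINT x|lebesgue. (?w x * partial b (\<phi> j) x - H b x)\<^sup>2)
          + 2 * (LINT x|lebesgue. (?w x * partial b (\<phi> k) x - H b x)\<^sup>2)"
        by (rule L2_diff_bound[OF HL(1)[OF b] HL(1)[OF b] HL(2)[OF b]])
      finally show ?thesis .
    qed
    have "(LINT x|lebesgue. (norm x)\<^sup>2 * (norm (grad (\<lambda>x. \<phi> j x - \<phi> k x) x))\<^sup>2)
        = (\<Sum>b\<in>Basis. LINT x|lebesgue. (norm x)\<^sup>2 * (partial b (\<lambda>x. \<phi> j x - \<phi> k x) x)\<^sup>2)"
      unfolding norm_grad sum_distrib_left
      by (intro Bochner_Integration.integral_sum test_function_sqr_integral_le(3) test_function_diff t smooth_norm_square) simp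
    also have "\<dots> \<le> (\<Sum>b\<in>Basis. 2 * (LINT x|lebesgue. (?w x * partial b (\<phi> j) x - H b x)\<^sup>2)
          + 2 * (LINT x|lebesgue. (?w x * partial b (\<phi> k) x - H b x)\<^sup>2))"
      by (rule sum_mono) (rule part)
    finally show ?thesis
      unfolding H2_norm_square d_def using lap by (simp add: sum.distrib flip: sum_distrib_left)
  qed
  fix e :: real assume e: "0 < e"
  \<comment> \<open>The quarter compensates for the two terms with factor 2 in
    \<open>bound\<close>.\<close>
  then have "\<forall>\<^sub>F k in sequentially. d k < e\<^sup>2 / 4"
    using d0 by (intro order_tendstoD) auto
  then obtain N where N: "\<And>k. k \<ge> N \<Longrightarrow> d k < e\<^sup>2 / 4"
    by (auto simp: eventually_sequentially)
  have "H2_norm (\<lambda>x. \<phi> j x - \<phi> k x) < e" if "j \<ge> N" "k \<ge> N" for j k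
  proof (rule power2_less_imp_less)
    show "(H2_norm (\<lambda>x. \<phi> j x - \<phi> k x))\<^sup>2 < e\<^sup>2"
      using bound[of j k] N[OF that(1)] N[OF that(2)] by linarith
  qed (use e in simp)
  then show "\<exists>N. \<forall>j\<ge>N. \<forall>k\<ge>N. H2_norm (\<lambda>x. \<phi> j x - \<phi> k x) < e"
    by blast
qed

lemma L2_tendsto_L1_loc:
  fixes f :: "nat \<Rightarrow> 'a::euclidean_space \<Rightarrow> real"
  assumes f: "L2_tendsto lebesgue f F" shows "L1_loc_tendsto f F"
  unfolding L1_loc_tendsto_def
proof (intro allI impI)
  fix K :: "'a set" assume K: "compact K"
  note KL = L2_indicator_compact[OF K]
  let ?I = "sqrt (LINT x|lebesgue. (indicator K x :: real)\<^sup>2)"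
  have "(\<lambda>k. ?I * sqrt (LINT x|lebesgue. (f k x - F x)\<^sup>2)) \<longlonglongrightarrow> ?I * sqrt 0"
    using f by (intro tendsto_intros) (simp add: L2_tendsto_def)
  then have lim: "(\<lambda>k. ?I * sqrt (LINT x|lebesgue. (f k x - F x)\<^sup>2)) \<longlonglongrightarrow> 0"
    by simp
  have "\<bar>LINT x:K|lebesgue. \<bar>f k x - F x\<bar>\<bar> \<le> ?I * sqrt (LINT x|lebesgue. (f k x - F x)\<^sup>2)" for k
  proof -
    have D: "L2 lebesgue (\<lambda>x. f k x - F x)"
      using f by (auto simp: L2_tendsto_def intro: L2_diff)
    have "L2 lebesgue (\<lambda>x. \<bar>f k x - F x\<bar>)"
      by (rule L2_dominated[OF D borel_measurable_abs[OF L2_measurable[OF D]], of 1]) simp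
    from L2_abs_inner[OF KL this] show ?thesis
      by (simp add: set_lebesgue_integral_def)
  qed
  from tendsto_zero_bound[OF lim this] show "(\<lambda>k. LINT x:K|lebesgue. \<bar>f k x - F x\<bar>) \<longlonglongrightarrow> 0" .
qed

section \<open>Smooth cutoffs of the Gaussian\<close>

definition cutoff :: "'a::euclidean_space \<Rightarrow> real" where
  "cutoff x = exp 1 * step (1 - (norm x)\<^sup>2)"

lemma test_function_cutoff: "test_function (cutoff :: 'a::euclidean_space \<Rightarrow> real)"
proof -
  have "smooth (\<lambda>x::'a. step (1 - (norm x)\<^sup>2))"
    by (rule smooth_compose[OF smooth_step]) (intro smooth_diff smooth_const smooth_norm_square)
  then have "smooth (cutoff :: 'a \<Rightarrow> real)"
    unfolding cutoff_def[abs_def] by (rule smooth_cmult)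
  moreover have "{x::'a. cutoff x \<noteq> 0} \<subseteq> cball 0 1"
  proof
    fix x :: 'a assume "x \<in> {x. cutoff x \<noteq> 0}"
    then have "(norm x)\<^sup>2 < 1\<^sup>2"
      by (auto simp: cutoff_def step_eq split: if_splits)
    then have "norm x < 1"
      by (rule power2_less_imp_less) simp
    then show "x \<in> cball 0 1" by simp
  qed
  ultimately show ?thesis
    by (auto simp: test_function_iff intro: bounded_subset[OF bounded_cball])
qed

text \<open>The factor \<open>exp 1\<close> in \<open>cutoff\<close> is the inverse of
  \<open>step 1\<close>. The value at the origin is the pointwise limit of the dilated cutoffs at
  every x.\<close>

lemma cutoff_0: "cutoff 0 = 1"
  by (simp add: cutoff_def step_eq flip: exp_add)

text \<open>With \<open>Suc k\<close> the dilation factor is nonzero, which preserves boundedness of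
  the support, and at most 1, which makes the estimates uniform in \<open>k\<close>.\<close>

definition gaussian_approx :: "nat \<Rightarrow> 'a::euclidean_space \<Rightarrow> real" where
  "gaussian_approx k x = cutoff (inverse (real (Suc k)) *\<^sub>R x) * gaussian x"

context
begin

private abbreviation h where "h k \<equiv> inverse (real (Suc k))"

lemma test_function_scale:
  assumes f: "test_function f" and c: "c \<noteq> 0"
  shows "test_function (\<lambda>x. f (c *\<^sub>R x))"
proof -
  have "{x. f (c *\<^sub>R x) \<noteq> 0} \<subseteq> (\<lambda>x. inverse c *\<^sub>R x) ` {x. f x \<noteq> 0}"
  proof
    fix x assume "x \<in> {x. f (c *\<^sub>R x) \<noteq> 0}"
    then show "x \<in> (\<lambda>x. inverse c *\<^sub>R x) ` {x. f x \<noteq> 0}"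
      using c by (intro image_eqI[of _ _ "c *\<^sub>R x"]) auto
  qed
  then show ?thesis
    using f by (auto simp: test_function_iff smooth_scale intro: bounded_subset[OF bounded_scaling])
qed

lemma test_function_gaussian_approx: "test_function (gaussian_approx k)"
  unfolding gaussian_approx_def[abs_def]
  by (intro test_function_mult test_function_scale test_function_cutoff smooth_gaussian) simp

lemma partial_gaussian_approx:
  fixes x :: "'a::euclidean_space"
  shows "partial b (gaussian_approx k) x
    = h k * partial b cutoff (h k *\<^sub>R x) * gaussian x + cutoff (h k *\<^sub>R x) * partial b gaussian x"
proof -
  note s = test_function_smooth[OF test_function_cutoff]
  show ?thesis
    unfolding gaussian_approx_def[abs_def]
    by (simp add: partial_mult smooth_differentiable smooth_scale s smooth_gaussian partial_scale)
qed

text \<open>Every derivative that falls on the cutoff brings a factor \<open>h k\<close>. As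
  \<open>h k\<close> is at most 1 and tends to 0, all terms but the last stay dominated and
  disappear in the limit.\<close>

lemma partial_partial_gaussian_approx:
  fixes x :: "'a::euclidean_space"
  assumes b: "b \<in> Basis"
  shows "partial b (partial b (gaussian_approx k)) x
    = (h k)\<^sup>2 * partial b (partial b cutoff) (h k *\<^sub>R x) * gaussian x
      + 2 * h k * partial b cutoff (h k *\<^sub>R x) * partial b gaussian x
      + cutoff (h k *\<^sub>R x) * partial b (partial b gaussian) x"
proof -
  note s = test_function_smooth[OF test_function_cutoff]
  note s' = smooth_partial[OF s b] smooth_scale[OF s] smooth_scale[OF smooth_partial[OF s b]]
    smooth_gaussian smooth_partial[OF smooth_gaussian b]
  have "partial b (gaussian_approx k)
      = (\<lambda>x. h k * (partial b cutoff (h k *\<^sub>R x) * gaussian x) + cutoff (h k *\<^sub>R x) * partial b gaussian x)"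
    by (simp add: fun_eq_iff partial_gaussian_approx)
  then have "partial b (partial b (gaussian_approx k)) x
      = partial b (\<lambda>x. h k * (partial b cutoff (h k *\<^sub>R x) * gaussian x)) x
        + partial b (\<lambda>x. cutoff (h k *\<^sub>R x) * partial b gaussian x) x"
    by (simp add: partial_add smooth_differentiable smooth_mult smooth_cmult s')
  also have "partial b (\<lambda>x. h k * (partial b cutoff (h k *\<^sub>R x) * gaussian x)) x
      = h k * (h k * partial b (partial b cutoff) (h k *\<^sub>R x) * gaussian x + partial b cutoff (h k *\<^sub>R x) * partial b gaussian x)"
    by (simp add: partial_mult smooth_differentiable smooth_mult smooth_const s' partial_scale partial_eqI[OF has_derivative_const])
  also have "partial b (\<lambda>x. cutoff (h k *\<^sub>R x) * partial b gaussian x) x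
      = h k * partial b cutoff (h k *\<^sub>R x) * partial b gaussian x + cutoff (h k *\<^sub>R x) * partial b (partial b gaussian) x"
    by (simp add: partial_mult smooth_differentiable smooth_mult s' partial_scale s)
  finally show ?thesis
    by (simp add: power2_eq_square algebra_simps)
qed

lemma scaled_tendsto:
  fixes f :: "'a::euclidean_space \<Rightarrow> real"
  assumes "smooth f"
  shows "(\<lambda>k. f (h k *\<^sub>R x)) \<longlonglongrightarrow> f 0"
proof -
  have "(\<lambda>k. h k *\<^sub>R x) \<longlonglongrightarrow> 0 *\<^sub>R x"
    by (intro tendsto_scaleR LIMSEQ_inverse_real_of_nat tendsto_const)
  with smooth_continuous[OF assms] show ?thesis
    by (auto simp: continuous_on_eq_continuous_at intro: isCont_tendsto_compose)
qed

lemma inverse_Suc_bounds: "0 < h k" "h k \<le> 1"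
  by (auto simp: field_simps)

lemma gaussian_approx_tendsto:
  "L2_tendsto lebesgue gaussian_approx (gaussian :: 'a::euclidean_space \<Rightarrow> real)"
proof -
  obtain B where B: "\<bar>cutoff x\<bar> \<le> B" for x :: 'a
    using test_function_bound[OF test_function_cutoff] by blast
  show ?thesis
  proof (rule L2_tendsto_dominated_convergence[OF _ _ L2_gaussian_weight])
    show "gaussian_approx k \<in> borel_measurable lebesgue" for k
      by (intro smooth_measurable test_function_smooth test_function_gaussian_approx)
    show "gaussian \<in> borel_measurable lebesgue"
      by (intro smooth_measurable smooth_gaussian)
    show "\<bar>gaussian_approx k x\<bar> \<le> B * \<bar>gaussian_weight x\<bar>" for k and x :: 'a
    proof -
      have "\<bar>gaussian_approx k x\<bar> \<le> B * (1 * gaussian x)"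
        using B[of "h k *\<^sub>R x"] gaussian_pos[of x] by (simp add: gaussian_approx_def abs_mult mult_right_mono)
      also have "\<dots> \<le> B * ((1 + (norm x)\<^sup>2) * gaussian x)"
        using gaussian_pos[of x] B[of 0] by (intro mult_left_mono mult_right_mono) auto
      finally show ?thesis
        using gaussian_pos[of x] by (simp add: gaussian_weight_def abs_mult)
    qed
    show "(\<lambda>k. gaussian_approx k x) \<longlonglongrightarrow> gaussian x" for x :: 'a
      using tendsto_mult[OF scaled_tendsto[OF test_function_smooth[OF test_function_cutoff], of x] tendsto_const[of "gaussian x"]]
      by (simp add: gaussian_approx_def cutoff_0)
  qed
qed

lemma gaussian_approx_partial_tendsto:
  assumes b: "(b::'a::euclidean_space) \<in> Basis"
  shows "L2_tendsto lebesgue (\<lambda>k x. sqrt (1 + (norm x)\<^sup>2) * partial b (gaussian_approx k) x)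
    (\<lambda>x. sqrt (1 + (norm x)\<^sup>2) * partial b gaussian x)"
proof -
  note tc = test_function_cutoff[where 'a = 'a]
  obtain B0 where B0: "B0 > 0" "\<bar>cutoff x\<bar> \<le> B0" for x :: 'a
    using test_function_bound[OF tc] by blast
  obtain B1 where B1: "B1 > 0" "\<bar>partial b cutoff x\<bar> \<le> B1" for x :: 'a
    using test_function_bound[OF test_function_partial[OF tc b]] by blast
  have wm: "(\<lambda>x::'a. sqrt (1 + (norm x)\<^sup>2)) \<in> borel_measurable lebesgue"
    by (intro continuous_lebesgue_measurable continuous_intros)
  show ?thesis
  proof (rule L2_tendsto_dominated_convergence[OF _ _ L2_gaussian_weight])
    show "(\<lambda>x. sqrt (1 + (norm x)\<^sup>2) * partial b (gaussian_approx k) x) \<in> borel_measurable lebesgue" for k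
      by (intro borel_measurable_times wm smooth_measurable smooth_partial test_function_smooth
          test_function_gaussian_approx b)
    show "(\<lambda>x. sqrt (1 + (norm x)\<^sup>2) * partial b gaussian x) \<in> borel_measurable lebesgue"
      by (intro borel_measurable_times wm smooth_measurable smooth_partial smooth_gaussian b)
    show "\<bar>sqrt (1 + (norm x)\<^sup>2) * partial b (gaussian_approx k) x\<bar> \<le> (2 * (B0 + B1)) * \<bar>gaussian_weight x\<bar>" for k and x :: 'a
    proof -
      let ?g = "gaussian x"
      have g: "0 < ?g" by (rule gaussian_pos)
      \<comment> \<open>One factor 1 + |x| comes from the weight and another from the derivative;
        the square of 1 + |x| is at most 2 (1 + |x|^2), whence the 2 in the constant.\<close>
      have sq: "sqrt (1 + (norm x)\<^sup>2) \<le> 1 + norm x"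
        by (rule real_le_lsqrt) (auto simp: power2_eq_square algebra_simps)
      have "\<bar>h k * partial b cutoff (h k *\<^sub>R x) * ?g\<bar> \<le> 1 * B1 * ?g"
        unfolding abs_mult using inverse_Suc_bounds[of k] B1 g by (intro mult_mono) auto
      moreover have "\<bar>cutoff (h k *\<^sub>R x) * partial b gaussian x\<bar> \<le> B0 * (norm x * ?g)"
        unfolding abs_mult partial_gaussian using B0 g Basis_le_norm[OF b, of x] by (intro mult_mono) auto
      ultimately have p: "\<bar>partial b (gaussian_approx k) x\<bar> \<le> (B1 + B0 * norm x) * ?g"
        unfolding partial_gaussian_approx by (simp add: algebra_simps)
      also have "\<dots> \<le> ((B0 + B1) * (1 + norm x)) * ?g"
        using g B0(1) B1(1) by (intro mult_right_mono) (auto simp: algebra_simps)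
      finally have "\<bar>sqrt (1 + (norm x)\<^sup>2) * partial b (gaussian_approx k) x\<bar> \<le> (1 + norm x) * (((B0 + B1) * (1 + norm x)) * ?g)"
        unfolding abs_mult using sq by (intro mult_mono) auto
      also have "\<dots> = (B0 + B1) * ((1 + norm x)\<^sup>2 * ?g)"
        by (simp add: power2_eq_square)
      also have "\<dots> \<le> (B0 + B1) * ((2 * (1 + (norm x)\<^sup>2)) * ?g)"
      proof (intro mult_left_mono mult_right_mono)
        show "(1 + norm x)\<^sup>2 \<le> 2 * (1 + (norm x)\<^sup>2)"
          using sum_squares_bound[of 1 "norm x"] by (simp add: power2_eq_square algebra_simps)
      qed (use g B0(1) B1(1) in auto)
      finally show ?thesis
        using g by (simp add: gaussian_weight_def abs_mult algebra_simps)
    qed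
    show "(\<lambda>k. sqrt (1 + (norm x)\<^sup>2) * partial b (gaussian_approx k) x) \<longlonglongrightarrow> sqrt (1 + (norm x)\<^sup>2) * partial b gaussian x" for x :: 'a
    proof -
      note s = test_function_smooth[OF tc]
      have "(\<lambda>k. partial b (gaussian_approx k) x) \<longlonglongrightarrow> 0 * partial b cutoff 0 * gaussian x + cutoff (0::'a) * partial b gaussian x"
        unfolding partial_gaussian_approx
        by (rule tendsto_add[OF tendsto_mult[OF tendsto_mult[OF LIMSEQ_inverse_real_of_nat
                scaled_tendsto[OF smooth_partial[OF s b]]] tendsto_const]
              tendsto_mult[OF scaled_tendsto[OF s] tendsto_const]])
      then show ?thesis
        by (intro tendsto_mult tendsto_const) (simp add: cutoff_0)
    qed
  qed
qed

lemma gaussian_approx_partial_partial_tendsto: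
  assumes b: "(b::'a::euclidean_space) \<in> Basis"
  shows "L2_tendsto lebesgue (\<lambda>k. partial b (partial b (gaussian_approx k))) (partial b (partial b gaussian))"
proof -
  note tc = test_function_cutoff[where 'a = 'a]
  obtain B0 where B0: "B0 > 0" "\<bar>cutoff x\<bar> \<le> B0" for x :: 'a
    using test_function_bound[OF tc] by blast
  obtain B1 where B1: "B1 > 0" "\<bar>partial b cutoff x\<bar> \<le> B1" for x :: 'a
    using test_function_bound[OF test_function_partial[OF tc b]] by blast
  obtain B2 where B2: "B2 > 0" "\<bar>partial b (partial b cutoff) x\<bar> \<le> B2" for x :: 'a
    using test_function_bound[OF test_function_partial[OF test_function_partial[OF tc b] b]] by blast
  show ?thesis
  proof (rule L2_tendsto_dominated_convergence[OF _ _ L2_gaussian_weight])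
    show "partial b (partial b (gaussian_approx k)) \<in> borel_measurable lebesgue" for k
      by (intro smooth_measurable smooth_partial test_function_smooth test_function_gaussian_approx b)
    show "partial b (partial b gaussian) \<in> borel_measurable lebesgue"
      by (intro smooth_measurable smooth_partial smooth_gaussian b)
    show "\<bar>partial b (partial b (gaussian_approx k)) x\<bar> \<le> (B0 + B1 + B2) * \<bar>gaussian_weight x\<bar>" for k and x :: 'a
    proof -
      let ?g = "gaussian x" and ?n = "norm x"
      have g: "0 < ?g" by (rule gaussian_pos)
      have h2: "(h k)\<^sup>2 \<le> 1"
        using inverse_Suc_bounds[of k] by (simp add: power_le_one)
      \<comment> \<open>The mixed term grows only like 2 |x| and is absorbed here by the weight 1 +
        |x|^2.\<close>
      have n: "2 * ?n \<le> 1 + ?n\<^sup>2"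
        using sum_squares_bound[of 1 ?n] by simp
      have xb: "\<bar>x \<bullet> b\<bar> \<le> ?n" by (rule Basis_le_norm[OF b])
      have xb2: "\<bar>(x \<bullet> b)\<^sup>2 - 1\<bar> \<le> 1 + ?n\<^sup>2"
        using power_mono[OF xb, of 2] by (simp add: abs_le_iff)
      have 1: "\<bar>(h k)\<^sup>2 * partial b (partial b cutoff) (h k *\<^sub>R x) * ?g\<bar> \<le> 1 * B2 * ?g"
        unfolding abs_mult using h2 B2 g by (intro mult_mono) auto
      have 2: "\<bar>2 * h k * partial b cutoff (h k *\<^sub>R x) * partial b gaussian x\<bar> \<le> 2 * 1 * B1 * (?n * ?g)"
        unfolding abs_mult partial_gaussian using inverse_Suc_bounds[of k] B1 g xb by (intro mult_mono) auto
      have 3: "\<bar>cutoff (h k *\<^sub>R x) * partial b (partial b gaussian) x\<bar> \<le> B0 * ((1 + ?n\<^sup>2) * ?g)"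
        unfolding abs_mult partial_partial_gaussian[OF b] using B0 g xb2 by (intro mult_mono) auto
      have "\<bar>partial b (partial b (gaussian_approx k)) x\<bar> \<le> 1 * B2 * ?g + 2 * 1 * B1 * (?n * ?g) + B0 * ((1 + ?n\<^sup>2) * ?g)"
        unfolding partial_partial_gaussian_approx[OF b] using 1 2 3 by linarith
      also have "\<dots> = (B2 * 1 + B1 * (2 * ?n) + B0 * (1 + ?n\<^sup>2)) * ?g"
        by (simp add: algebra_simps)
      also have "\<dots> \<le> (B2 * (1 + ?n\<^sup>2) + B1 * (1 + ?n\<^sup>2) + B0 * (1 + ?n\<^sup>2)) * ?g"
        using B0(1) B1(1) B2(1) g n by (intro mult_right_mono add_mono mult_left_mono) auto
      also have "\<dots> = (B0 + B1 + B2) * \<bar>gaussian_weight x\<bar>"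
        using g by (simp add: gaussian_weight_def abs_mult algebra_simps)
      finally show ?thesis .
    qed
    show "(\<lambda>k. partial b (partial b (gaussian_approx k)) x) \<longlonglongrightarrow> partial b (partial b gaussian) x" for x :: 'a
    proof -
      note s = test_function_smooth[OF tc]
      have "(\<lambda>k. partial b (partial b (gaussian_approx k)) x) \<longlonglongrightarrow>
          0\<^sup>2 * partial b (partial b cutoff) 0 * gaussian x + 2 * 0 * partial b cutoff 0 * partial b gaussian x
          + cutoff (0::'a) * partial b (partial b gaussian) x"
        unfolding partial_partial_gaussian_approx[OF b]
        by (rule tendsto_add[OF tendsto_add[OF
                tendsto_mult[OF tendsto_mult[OF tendsto_power[OF LIMSEQ_inverse_real_of_nat]
                  scaled_tendsto[OF smooth_partial[OF smooth_partial[OF s b] b]]] tendsto_const]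
                tendsto_mult[OF tendsto_mult[OF tendsto_mult[OF tendsto_const LIMSEQ_inverse_real_of_nat]
                  scaled_tendsto[OF smooth_partial[OF s b]]] tendsto_const]]
              tendsto_mult[OF scaled_tendsto[OF s] tendsto_const]])
      then show ?thesis by (simp add: cutoff_0)
    qed
  qed
qed

end

section \<open>The Gaussian as an element of the completion\<close>

lemma gaussian_approx_laplacian_tendsto:
  "L2_tendsto lebesgue (\<lambda>k. laplacian (gaussian_approx k :: 'a::euclidean_space \<Rightarrow> real)) (laplacian gaussian)"
  unfolding laplacian_def[abs_def]
  by (intro L2_tendsto_sum gaussian_approx_partial_partial_tendsto)

lemma gaussian_H2_limit:
  "H2_limit gaussian_approx (gaussian :: 'a::euclidean_space \<Rightarrow> real) (grad gaussian) (laplacian gaussian)"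
proof -
  \<comment> \<open>\<open>H2_limitI\<close> delivers the limits of the weighted derivatives divided
    by the weight; the cancellation leaves the classical gradient.\<close>
  have "sqrt (1 + (norm x)\<^sup>2) * c / sqrt (1 + (norm x)\<^sup>2) = c" for x :: 'a and c
    by (simp add: add_nonneg_eq_0_iff)
  moreover have "H2_limit gaussian_approx gaussian (\<lambda>x. \<Sum>b\<in>Basis.
      (sqrt (1 + (norm x)\<^sup>2) * partial b gaussian x / sqrt (1 + (norm (x::'a))\<^sup>2)) *\<^sub>R b) (laplacian gaussian)"
    by (intro H2_limitI test_function_gaussian_approx gaussian_approx_tendsto
        gaussian_approx_laplacian_tendsto gaussian_approx_partial_tendsto)
  ultimately show ?thesis
    by (simp only: grad_def[abs_def])
qed

lemma gaussian_locally_integrable: "locally_integrable gaussian"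
  by (rule L2_locally_integrable[OF H2_limit_L2(1)[OF gaussian_H2_limit]])

lemma gaussian_L1_loc: "L1_loc_tendsto gaussian_approx gaussian"
  by (rule L2_tendsto_L1_loc[OF gaussian_approx_tendsto])

lemma gaussian_in_H2_space: "gaussian \<in> H2_space"
proof -
  have "H2_Cauchy gaussian_approx"
    by (rule H2_CauchyI[OF test_function_gaussian_approx gaussian_approx_laplacian_tendsto
          gaussian_approx_partial_tendsto])
  then show ?thesis
    using gaussian_locally_integrable gaussian_L1_loc
    unfolding H2_space_def L1_loc_tendsto_def by blast
qed

text \<open>Squaring the equation for \<open>L\<close> gives the first claim by the norm identity;
  multiplying it by \<open>L\<close> and integrating gives the second. The equality case thus
  follows without the evaluation of any Gaussian integral.\<close>

lemma H2_limit_equality: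
  fixes v :: "'a::euclidean_space \<Rightarrow> real"
  assumes lim: "H2_limit \<phi> v G L" and L: "\<And>x. L x = - (G x \<bullet> x + real DIM('a) * v x)"
  shows "(LINT x|lebesgue. (L x)\<^sup>2) = (LINT x|lebesgue. (G x \<bullet> x)\<^sup>2)"
    "(LINT x|lebesgue. (L x)\<^sup>2) = (real DIM('a) + 2) / 2 * (LINT x|lebesgue. (norm (G x))\<^sup>2)"
proof -
  show "(LINT x|lebesgue. (L x)\<^sup>2) = (LINT x|lebesgue. (G x \<bullet> x)\<^sup>2)"
    using H2_limit_shifted_norm[OF lim] by (simp only: L power2_minus)
  have "(L x)\<^sup>2 = - (L x * (G x \<bullet> x + real DIM('a) * v x))" for x
    by (simp add: L power2_eq_square algebra_simps)
  then have "(LINT x|lebesgue. (L x)\<^sup>2) = (LINT x|lebesgue. - (L x * (G x \<bullet> x + real DIM('a) * v x)))"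
    by simp
  also have "\<dots> = - (LINT x|lebesgue. L x * (G x \<bullet> x + real DIM('a) * v x))"
    by (rule Bochner_Integration.integral_minus)
  finally show "(LINT x|lebesgue. (L x)\<^sup>2) = (real DIM('a) + 2) / 2 * (LINT x|lebesgue. (norm (G x))\<^sup>2)"
    by (simp add: H2_limit_laplacian_shifted[OF lim])
qed

text \<open>Positivity is what permits the cancellation in the proof of sharpness. If the integral
  vanished, so would \<integral> (x \<cdot> \<nabla>u)^2 for the Gaussian u by the equality
  relations; Cauchy-Schwarz in the identity for \<integral> u (x \<cdot> \<nabla>u) would then force
  \<integral> u^2 = 0, although u is positive everywhere.\<close>

lemma gaussian_grad_norm_pos:
  "0 < (LINT x|lebesgue. (norm (grad (gaussian :: 'a::euclidean_space \<Rightarrow> real) x))\<^sup>2)"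
proof (rule ccontr)
  note lim = gaussian_H2_limit[where 'a = 'a]
  assume "\<not> ?thesis"
  moreover have "0 \<le> (LINT x|lebesgue. (norm (grad gaussian (x::'a)))\<^sup>2)" by simp
  ultimately have zero: "(LINT x|lebesgue. (norm (grad gaussian (x::'a)))\<^sup>2) = 0" by linarith
  have "(LINT x|lebesgue. (grad gaussian (x::'a) \<bullet> x)\<^sup>2) = 0"
    unfolding H2_limit_equality(1)[OF lim laplacian_gaussian, symmetric]
      H2_limit_equality(2)[OF lim laplacian_gaussian] zero by simp
  then have "(LINT x|lebesgue. (gaussian (x::'a))\<^sup>2) = 0"
    using L2_Cauchy_Schwarz[OF H2_limit_L2(1)[OF lim] H2_limit_L2(3)[OF lim]]
    by (simp add: H2_limit_function_radial[OF lim])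
  then have "AE x::'a in lebesgue. (gaussian x)\<^sup>2 = 0"
    by (subst (asm) integral_nonneg_eq_0_iff_AE) (auto intro: L2_integrable H2_limit_L2(1)[OF gaussian_H2_limit])
  then have "AE x::'a in lebesgue. False"
    by eventually_elim (simp add: gaussian_def)
  then have "emeasure lebesgue (UNIV :: 'a set) = 0"
    by (simp add: eventually_False trivial_limit_def[symmetric] ae_filter_eq_bot_iff)
  then show False by simp
qed

lemma gaussian_equality:
  "(LINT x|lebesgue. (weak_laplacian (gaussian :: 'a::euclidean_space \<Rightarrow> real) x)\<^sup>2) *
    (LINT x|lebesgue. (weak_grad (gaussian :: 'a \<Rightarrow> real) x \<bullet> x)\<^sup>2)
    = ((real DIM('a) + 2) / 2)\<^sup>2 * (LINT x|lebesgue. (norm (weak_grad (gaussian :: 'a \<Rightarrow> real) x))\<^sup>2)\<^sup>2"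
  "0 < (LINT x|lebesgue. (norm (weak_grad (gaussian :: 'a \<Rightarrow> real) x))\<^sup>2)"
proof -
  note lim = gaussian_H2_limit[where 'a = 'a]
  note G = H2_limit_weak_grad[OF lim gaussian_L1_loc gaussian_locally_integrable]
  note L = H2_limit_weak_laplacian[OF lim gaussian_L1_loc gaussian_locally_integrable]
  note eq = H2_limit_equality[OF lim laplacian_gaussian]
  show "(LINT x|lebesgue. (weak_laplacian (gaussian :: 'a \<Rightarrow> real) x)\<^sup>2) *
    (LINT x|lebesgue. (weak_grad (gaussian :: 'a \<Rightarrow> real) x \<bullet> x)\<^sup>2)
    = ((real DIM('a) + 2) / 2)\<^sup>2 * (LINT x|lebesgue. (norm (weak_grad (gaussian :: 'a \<Rightarrow> real) x))\<^sup>2)\<^sup>2"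
    unfolding weak_laplacian_integral_cong(2)[OF L] weak_grad_radial_cong(2)[OF G] weak_grad_norm_cong(2)[OF G]
      eq(1)[symmetric] eq(2)
    by (simp only: power2_eq_square mult_ac)
  show "0 < (LINT x|lebesgue. (norm (weak_grad (gaussian :: 'a \<Rightarrow> real) x))\<^sup>2)"
    unfolding weak_grad_norm_cong(2)[OF G] by (rule gaussian_grad_norm_pos)
qed

theorem corollary1p2:
  shows
    "(\<forall>u \<in> (H2_space :: (real ^ 'n \<Rightarrow> real) set).
        is_weak_grad u (weak_grad u) \<and> is_weak_laplacian u (weak_laplacian u) \<and>
        integrable lebesgue (\<lambda>x. (weak_laplacian u x)\<^sup>2) \<and>
        integrable lebesgue (\<lambda>x. (weak_grad u x \<bullet> x)\<^sup>2) \<and>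
        integrable lebesgue (\<lambda>x. (norm (weak_grad u x))\<^sup>2) \<and>
        (LINT x|lebesgue. (weak_laplacian u x)\<^sup>2) * (LINT x|lebesgue. (weak_grad u x \<bullet> x)\<^sup>2)
          \<ge> ((real CARD('n) + 2) / 2)\<^sup>2 * (LINT x|lebesgue. (norm (weak_grad u x))\<^sup>2)\<^sup>2)
     \<and>
     (\<forall>C::real.
        (\<forall>u \<in> (H2_space :: (real ^ 'n \<Rightarrow> real) set).
          (LINT x|lebesgue. (weak_laplacian u x)\<^sup>2) * (LINT x|lebesgue. (weak_grad u x \<bullet> x)\<^sup>2)
            \<ge> C * (LINT x|lebesgue. (norm (weak_grad u x))\<^sup>2)\<^sup>2)
        \<longrightarrow> C \<le> ((real CARD('n) + 2) / 2)\<^sup>2)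
     \<and>
     (gaussian :: real ^ 'n \<Rightarrow> real) \<in> H2_space \<and>
     (LINT x|lebesgue. (weak_laplacian (gaussian :: real ^ 'n \<Rightarrow> real) x)\<^sup>2) *
       (LINT x|lebesgue. (weak_grad (gaussian :: real ^ 'n \<Rightarrow> real) x \<bullet> x)\<^sup>2)
       = ((real CARD('n) + 2) / 2)\<^sup>2 *
         (LINT x|lebesgue. (norm (weak_grad (gaussian :: real ^ 'n \<Rightarrow> real) x))\<^sup>2)\<^sup>2"
proof (intro conjI ballI allI impI)
  fix u :: "real ^ 'n \<Rightarrow> real" assume "u \<in> H2_space"
  note ineq = H2_space_inequality[OF this]
  show "is_weak_grad u (weak_grad u)" "is_weak_laplacian u (weak_laplacian u)"
    "integrable lebesgue (\<lambda>x. (weak_laplacian u x)\<^sup>2)"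
    "integrable lebesgue (\<lambda>x. (weak_grad u x \<bullet> x)\<^sup>2)"
    "integrable lebesgue (\<lambda>x. (norm (weak_grad u x))\<^sup>2)"
    using ineq by blast+
  show "((real CARD('n) + 2) / 2)\<^sup>2 * (LINT x|lebesgue. (norm (weak_grad u x))\<^sup>2)\<^sup>2
      \<le> (LINT x|lebesgue. (weak_laplacian u x)\<^sup>2) * (LINT x|lebesgue. (weak_grad u x \<bullet> x)\<^sup>2)"
    using ineq by simp
next
  let ?g = "gaussian :: real ^ 'n \<Rightarrow> real"
  fix C :: real
  assume C: "\<forall>u \<in> (H2_space :: (real ^ 'n \<Rightarrow> real) set).
    C * (LINT x|lebesgue. (norm (weak_grad u x))\<^sup>2)\<^sup>2
      \<le> (LINT x|lebesgue. (weak_laplacian u x)\<^sup>2) * (LINT x|lebesgue. (weak_grad u x \<bullet> x)\<^sup>2)"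
  \<comment> \<open>The Gaussian is the competitor that bounds C: the product of its integrals has
    the exact value, and the common positive factor can be cancelled.\<close>
  have "C * (LINT x|lebesgue. (norm (weak_grad ?g x))\<^sup>2)\<^sup>2
      \<le> ((real CARD('n) + 2) / 2)\<^sup>2 * (LINT x|lebesgue. (norm (weak_grad ?g x))\<^sup>2)\<^sup>2"
    using C[rule_format, OF gaussian_in_H2_space] unfolding gaussian_equality(1) by simp
  then show "C \<le> ((real CARD('n) + 2) / 2)\<^sup>2"
    using gaussian_equality(2)[where 'a = "real ^ 'n"] by (simp only: mult_le_cancel_right_pos zero_less_power)
next
  show "gaussian \<in> H2_space" by (rule gaussian_in_H2_space)
  show "(LINT x|lebesgue. (weak_laplacian (gaussian :: real ^ 'n \<Rightarrow> real) x)\<^sup>2) *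
       (LINT x|lebesgue. (weak_grad (gaussian :: real ^ 'n \<Rightarrow> real) x \<bullet> x)\<^sup>2)
       = ((real CARD('n) + 2) / 2)\<^sup>2 *
         (LINT x|lebesgue. (norm (weak_grad (gaussian :: real ^ 'n \<Rightarrow> real) x))\<^sup>2)\<^sup>2"
    using gaussian_equality(1)[where 'a = "real ^ 'n"] by simp
qed

end
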